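(* For each $n\ge 2$ let $x_i=(i-1/2)/n$, $i=1,\dots,n$, and suppose $$Y_i=\frac{\beta(x_i)}{\sqrt n}+\epsilon_i,\qquad i=1,\dots,n,$$ where $\epsilon_1,\epsilon_2,\dots$ are independent and identically distributed with density $f$, and $\beta:[0,1]\to\mathbb R$ satisfies $\int_0^1\beta^2(x)\,dx>0$. Let $h$ be the density of $\epsilon_1-\epsilon_2$. Assume: (i) $h$ is Lipschitz continuous in a neighborhood of $0$; (ii) $\beta$ is Lipschitz continuous on $[0,1]$ except perhaps at finitely many points, at which it has simple (jump) discontinuities. Let $R(Y_i)$ be the rank of $Y_i$ among $Y_1,\dots,Y_n$, $U_i=R(Y_i)/(n+1)$, $$\hat\phi_j=\frac1n\sum_{i=1}^n U_i\cos(\pi jx_i),\quad j=1,\dots,n-1,\qquad R_n=\max_{1\le m<n}\frac1m\sum_{j=1}^m 24n\hat\phi_j^2 .$$ Let $G(t)=\exp\{-\sum_{j=1}^\infty P(\chi_j^2>jt)/j\}$ (with $\chi_j^2$ chi-squared with $j$ degrees of freedom), let $\alpha\in(0,1)$ and let $t_\alpha$ be the $1-\alpha$ quantile of $G$. Let $Z_1,Z_2,\dots$ be i.i.d. standard normal random variables, $\beta_j=\int_0^1\beta(x)\cos(\pi jx)\,dx$, and $$\mathcal T=\max_{m\ge1}\frac1m\sum_{j=1}^m\big(Z_j+\sqrt{24}\,h(0)\beta_j\big)^2 .$$ Then the power of the level-$\alpha$ rank-based order selection test, which rejects when $R_n\ge t_\alpha$, satisfies $$\lim_{n\to\infty}P(R_n\ge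 t_\alpha)=P(\mathcal T\ge t_\alpha).$$
   Context: The rank-based order selection (OS) test rejects the null hypothesis that the regression function is constant for large values of $R_n$; $G$ is the limiting null distribution of $R_n$. The model considered is a sequence of local alternatives $r_n(x)=\beta(x)/\sqrt n$ to the constant-regression null. *)

theory Defs
  imports "HOL-Probability.Probability"
begin

definition xpt :: "nat \<Rightarrow> nat \<Rightarrow> real" where
  "xpt n i = (real i - 1/2) / real n"

definition Yobs :: "(real \<Rightarrow> real) \<Rightarrow> (nat \<Rightarrow> 'a \<Rightarrow> real) \<Rightarrow> nat \<Rightarrow> 'a \<Rightarrow> nat \<Rightarrow> real" where
  "Yobs \<beta> eps n \<omega> i = \<beta> (xpt n i) / sqrt (real n) + eps i \<omega>"

definition rank :: "nat \<Rightarrow> (nat \<Rightarrow> real) \<Rightarrow> nat \<Rightarrow> nat" where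
  "rank n Y i = card {k \<in> {1..n}. Y k \<le> Y i}"

definition phi_hat :: "nat \<Rightarrow> (nat \<Rightarrow> real) \<Rightarrow> nat \<Rightarrow> real" where
  "phi_hat n Y j = (1 / real n) *
     (\<Sum>i=1..n. (real (rank n Y i) / (real n + 1)) * cos (pi * real j * xpt n i))"

definition Rn :: "nat \<Rightarrow> (nat \<Rightarrow> real) \<Rightarrow> real" where
  "Rn n Y = Max ((\<lambda>m. (1 / real m) * (\<Sum>j=1..m. 24 * real n * (phi_hat n Y j)\<^sup>2)) ` {1..<n})"

definition chisq_density :: "nat \<Rightarrow> real \<Rightarrow> real" where
  "chisq_density k x = (if x > 0 then x powr (real k / 2 - 1) * exp (- x / 2) /
       (2 powr (real k / 2) * Gamma (real k / 2)) else 0)"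

definition chisq_tail :: "nat \<Rightarrow> real \<Rightarrow> real" where
  "chisq_tail k t = (LINT x:{t<..}|lborel. chisq_density k x)"

text \<open>G(t) = exp(- sum_{j>=1} P(chi^2_j > j t)/j); exp(-infinity) = 0 when the series diverges.\<close>
definition G_os :: "real \<Rightarrow> real" where
  "G_os t = (if summable (\<lambda>j. chisq_tail (Suc j) (real (Suc j) * t) / real (Suc j))
             then exp (- (\<Sum>j. chisq_tail (Suc j) (real (Suc j) * t) / real (Suc j)))
             else 0)"

definition t_alpha :: "real \<Rightarrow> real" where
  "t_alpha \<alpha> = Inf {t. 1 - \<alpha> \<le> G_os t}"

definition beta_coef :: "(real \<Rightarrow> real) \<Rightarrow> nat \<Rightarrow> real" where
  "beta_coef \<beta> j = (LBINT x=0..1. \<beta> x * cos (pi * real j * x))"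

definition T_lim :: "(nat \<Rightarrow> real) \<Rightarrow> real \<Rightarrow> (real \<Rightarrow> real) \<Rightarrow> real" where
  "T_lim z h0 \<beta> = (SUP m\<in>{1..}. (1 / real m) *
      (\<Sum>j=1..m. (z j + sqrt 24 * h0 * beta_coef \<beta> j)\<^sup>2))"

end

theory Submission
  imports Defs "HOL-Library.Discrete_Functions"
begin

text \<open>
  Let \<open>F\<close> be the distribution function of the errors. Writing ranks as double sums of indicators and removing
  degenerate and near-constant parts gives
  \<open>sqrt (24 n) phi_hat j = V j + shift j + res j\<close>, where \<open>V j\<close> is the cosine sum of the independent uniform
  variables \<open>F (eps i) - 1/2\<close>, \<open>shift j\<close> is a Riemann sum for \<open>sqrt 24 h(0) beta_j\<close>, and
  \<open>E (res j)^2 = O(n^(-1/2))\<close> uniformly in \<open>j < n\<close>. Hence \<open>sum_{j<n} (res j)^2 / j\<close> tends to 0 in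
  probability, which controls the remainder in all averages over \<open>j \<le> m\<close>, \<open>m < n\<close>, simultaneously.
  Since \<open>sum_{j \<le> m} (V j)^2 - m\<close> has variance \<open>O(m)\<close> for \<open>m < n\<close>, averages over many frequencies stay below any level
  above 1, so only finitely many \<open>m\<close> matter; for these a central limit theorem applies, in the form of
  convergence of Laplace transforms of quadratic forms. The critical value exceeds 1 because the series
  \<open>sum_j P(chi^2_j > j)/j\<close> diverges, and above 1 the limit law has no atoms.
\<close>

section \<open>The critical value exceeds 1\<close>

text \<open>Two obstacles shape the proof. The maximum in \<open>Rn\<close> runs over n - 1
  averages, so convergence of finitely many coefficients does not suffice and error bounds must be
  uniform in the frequency. Second moments achieve this with no moment assumption on the errors,
  since only indicators and values of \<open>F\<close> occur. Moreover only \<open>h\<close> is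
  regular, and only near 0: the shifts enter the ranks through comparisons of two errors, and P(eps
  k - eps i \<le> u) has derivative h(0) at u = 0. A comparison changes with probability
  O(n^(-1/2)), which fixes the rate of \<open>res\<close>; the harmonic sum over j then costs a
  logarithm. The constant 24 is 12 * 2: the scores F (eps i) - 1/2 have variance 1/12, and the
  squared cosines average 1/2 over the design points. The cosines are exactly orthogonal there, so
  the design causes no approximation error in linear and quadratic forms of \<open>V\<close>. The
  level 1 is critical because the averages of (V j)^2 have mean 1; below it infinitely many of them
  would matter.\<close>

lemma has_bochner_integral_gamma_kernel:
  fixes a b :: real
  assumes "a > 0" "b > 0"
  shows "has_bochner_integral lborel (\<lambda>x. if x > 0 then x powr (a - 1) * exp (- b * x) else 0)
           (Gamma a / b powr a)"
proof (rule has_bochner_integral_nn_integral)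
  have "Gamma a = (\<integral>\<^sup>+t. ennreal (indicator {0..} t * t powr (a - 1) / exp t) \<partial>lborel)"
    using Gamma_conv_nn_integral_real[OF assms(1)] .
  also have "\<dots> = b * (\<integral>\<^sup>+x. ennreal (indicator {0..} (b*x) * (b*x) powr (a - 1) / exp (b*x)) \<partial>lborel)"
    using assms(2) by (subst nn_integral_real_affine[where c=b and t=0]) auto
  also have "(\<integral>\<^sup>+x. ennreal (indicator {0..} (b*x) * (b*x) powr (a - 1) / exp (b*x)) \<partial>lborel)
     = (\<integral>\<^sup>+x. ennreal (b powr (a-1)) * ennreal (if x > 0 then x powr (a - 1) * exp (- b * x) else 0) \<partial>lborel)"
  proof (rule nn_integral_cong_AE)
    have "AE x in lborel. x \<noteq> (0::real)" by (rule AE_lborel_singleton)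
    then show "AE x in lborel. ennreal (indicator {0..} (b*x) * (b*x) powr (a - 1) / exp (b*x)) =
       ennreal (b powr (a-1)) * ennreal (if x > 0 then x powr (a - 1) * exp (- b * x) else 0)"
      by eventually_elim
        (use assms in \<open>auto simp: indicator_def powr_mult exp_minus divide_inverse ennreal_mult[symmetric] mult.assoc zero_le_mult_iff\<close>)
  qed
  also have "\<dots> = ennreal (b powr (a-1)) * (\<integral>\<^sup>+x. ennreal (if x > 0 then x powr (a - 1) * exp (- b * x) else 0) \<partial>lborel)"
    by (rule nn_integral_cmult) auto
  finally have *: "ennreal (Gamma a) = ennreal (b powr a) * (\<integral>\<^sup>+x. ennreal (if x > 0 then x powr (a - 1) * exp (- b * x) else 0) \<partial>lborel)"
    using assms by (simp add: mult.assoc[symmetric] ennreal_mult[symmetric] powr_diff)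
  have "(\<integral>\<^sup>+x. ennreal (if x > 0 then x powr (a - 1) * exp (- b * x) else 0) \<partial>lborel)
     = ennreal (1 / b powr a) * (ennreal (b powr a) * (\<integral>\<^sup>+x. ennreal (if x > 0 then x powr (a - 1) * exp (- b * x) else 0) \<partial>lborel))"
    using assms by (simp add: mult.assoc[symmetric] ennreal_mult[symmetric])
  also have "\<dots> = ennreal (Gamma a / b powr a)"
    using assms by (simp add: *[symmetric] ennreal_mult[symmetric] Gamma_real_pos less_imp_le)
  finally show "(\<integral>\<^sup>+x. ennreal (if x > 0 then x powr (a - 1) * exp (- b * x) else 0) \<partial>lborel)
     = ennreal (Gamma a / b powr a)" .
qed (use assms Gamma_real_pos in \<open>auto intro!: AE_I2 less_imp_le\<close>)

section \<open>Tails of the chi-squared distribution\<close>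

lemma chisq_density_nonneg: "0 \<le> chisq_density k x"
  by (cases "k = 0") (auto simp: chisq_density_def intro!: divide_nonneg_nonneg less_imp_le[OF Gamma_real_pos])

lemma chisq_density_measurable [measurable]: "chisq_density k \<in> borel_measurable borel"
  unfolding chisq_density_def by measurable

lemma
  assumes "k > 0"
  shows integrable_chisq_density: "integrable lborel (chisq_density k)"
    and integral_chisq_density: "(LINT x|lborel. chisq_density k x) = 1"
proof -
  define a where "a = real k / 2"
  have a: "a > 0" using assms by (simp add: a_def)
  have "has_bochner_integral lborel (\<lambda>x. (if x > 0 then x powr (a - 1) * exp (- (1/2) * x) else 0) / (2 powr a * Gamma a))
           (Gamma a / (1/2) powr a / (2 powr a * Gamma a))"
    by (rule has_bochner_integral_divide_zero, rule has_bochner_integral_gamma_kernel) (use a in auto)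
  also have "Gamma a / (1/2) powr a / (2 powr a * Gamma a) = 1"
    using Gamma_real_pos[OF a] by (simp add: powr_divide)
  also have "(\<lambda>x. (if x > 0 then x powr (a - 1) * exp (- (1/2) * x) else 0) / (2 powr a * Gamma a)) = chisq_density k"
    by (auto simp: chisq_density_def a_def fun_eq_iff)
  finally have "has_bochner_integral lborel (chisq_density k) 1" .
  then show "integrable lborel (chisq_density k)" "(LINT x|lborel. chisq_density k x) = 1"
    by (auto simp: has_bochner_integral_iff)
qed

lemma set_integrable_chisq_density:
  assumes "k > 0" "A \<in> sets borel"
  shows "set_integrable lborel A (chisq_density k)"
  using assms integrable_chisq_density[OF assms(1)] unfolding set_integrable_def
  by (intro integrable_mult_indicator) auto

lemma chisq_tail_nonneg: "0 \<le> chisq_tail k t"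
  unfolding chisq_tail_def set_lebesgue_integral_def
  by (intro integral_nonneg_AE AE_I2) (auto simp: chisq_density_nonneg)

lemma chisq_tail_antimono:
  assumes "k > 0" "s \<le> t"
  shows "chisq_tail k t \<le> chisq_tail k s"
  unfolding chisq_tail_def set_lebesgue_integral_def
proof (rule integral_mono)
  fix x show "indicat_real {t<..} x *\<^sub>R chisq_density k x \<le> indicat_real {s<..} x *\<^sub>R chisq_density k x"
    using assms by (auto simp: indicator_def chisq_density_nonneg)
qed (use set_integrable_chisq_density[OF assms(1)] in \<open>auto simp: set_integrable_def\<close>)

text \<open>Exponential Markov with exponent 1/4, halfway to the pole 1/2 of the moment generating
  function, where that function equals 2 powr (k/2). The tilted density is again a gamma kernel, now
  with rate 1/4.\<close>

lemma chisq_tail_chernoff: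
  assumes k: "k > 0" and t: "t \<ge> 0"
  shows "chisq_tail k t \<le> exp (- t / 4) * 2 powr (real k / 2)"
proof -
  define a where "a = real k / 2"
  have a: "a > 0" using k by (simp add: a_def)
  define g where "g x = (if x > 0 then x powr (a - 1) * exp (- (1/4) * x) else 0) * (exp (- t / 4) / (2 powr a * Gamma a))" for x
  have g: "has_bochner_integral lborel g (Gamma a / (1/4) powr a * (exp (- t / 4) / (2 powr a * Gamma a)))"
    unfolding g_def
    by (intro has_bochner_integral_mult_left has_bochner_integral_gamma_kernel) (use a in auto)
  have eq: "Gamma a / (1/4) powr a * (exp (- t / 4) / (2 powr a * Gamma a)) = exp (- t / 4) * 2 powr a"
  proof -
    have "(4::real) powr a = 2 powr a * 2 powr a"
      by (simp add: powr_mult[symmetric])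
    then show ?thesis
      using Gamma_real_pos[OF a] by (simp add: powr_divide field_simps)
  qed
  have "chisq_tail k t \<le> (LINT x|lborel. g x)"
    unfolding chisq_tail_def set_lebesgue_integral_def
  proof (rule integral_mono)
    show "integrable lborel (\<lambda>x. indicat_real {t<..} x *\<^sub>R chisq_density k x)"
      using set_integrable_chisq_density[OF k, of "{t<..}"] unfolding set_integrable_def by simp
    show "integrable lborel g" using g by (simp add: has_bochner_integral_iff)
    fix x
    show "indicat_real {t<..} x *\<^sub>R chisq_density k x \<le> g x"
    proof (cases "x > t")
      case True
      then have "exp (- x / 2) \<le> exp (- (1/4) * x) * exp (- t / 4)"
        by (simp add: exp_add[symmetric])
      then show ?thesis using True t a Gamma_real_pos[OF a]
        by (auto simp: g_def chisq_density_def a_def[symmetric] mult.assoc intro!: divide_right_mono mult_left_mono)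
    next
      case False
      then show ?thesis using Gamma_real_pos[OF a] by (auto simp: g_def)
    qed
  qed
  also have "\<dots> = exp (- t / 4) * 2 powr a" using g eq by (simp add: has_bochner_integral_iff)
  finally show ?thesis by (simp add: a_def)
qed

text \<open>The difference of the two sides has derivative 2 x^2 / (1 - x^2), which is nonnegative.
  This is the logarithmic form of the reflection inequality for the gamma kernel.\<close>

lemma ln_ratio_ge:
  fixes u :: real
  assumes "0 \<le> u" "u < 1"
  shows "2 * u \<le> ln (1 + u) - ln (1 - u)"
proof -
  have "(\<lambda>u. ln (1 + u) - ln (1 - u) - 2 * u) 0 \<le> (\<lambda>u. ln (1 + u) - ln (1 - u) - 2 * u) u"
  proof (rule DERIV_nonneg_imp_nondecreasing[OF assms(1)])
    fix x assume x: "0 \<le> x" "x \<le> u"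
    then have x1: "x < 1" using assms by simp
    have "((\<lambda>u. ln (1 + u) - ln (1 - u) - 2 * u) has_real_derivative (1 / (1 + x) + 1 / (1 - x) - 2)) (at x)"
      using x x1 by (auto intro!: derivative_eq_intros)
    moreover have "1 / (1 + x) + 1 / (1 - x) - 2 \<ge> 0"
    proof -
      have "1 / (1 + x) + 1 / (1 - x) - 2 = 2 * x^2 / ((1 + x) * (1 - x))"
        using x x1 by (simp add: divide_simps) (simp add: algebra_simps power2_eq_square)
      then show ?thesis using x x1 by simp
    qed
    ultimately show "\<exists>y. ((\<lambda>u. ln (1 + u) - ln (1 - u) - 2 * u) has_real_derivative y) (at x) \<and> 0 \<le> y"
      by blast
  qed
  then show ?thesis by simp
qed

text \<open>The kernel x^a exp (-x/2) peaks at 2a and decays more slowly to the right of the peak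
  than to the left. Taking logarithms, dividing by a and putting u = s/(2a) reduces this to
  \<open>ln_ratio_ge\<close>.\<close>

lemma gamma_kernel_reflect:
  fixes a s :: real
  assumes "a \<ge> 0" "0 \<le> s" "s < 2 * a"
  shows "(2*a - s) powr a * exp (- (2*a - s) / 2) \<le> (2*a + s) powr a * exp (- (2*a + s) / 2)"
proof -
  have a: "a > 0" using assms by linarith
  define u where "u = s / (2 * a)"
  have u: "0 \<le> u" "u < 1" using assms a by (auto simp: u_def)
  have "a * (2 * u) \<le> a * (ln (1 + u) - ln (1 - u))"
    using ln_ratio_ge[OF u] a by (intro mult_left_mono) auto
  moreover have "ln (2*a + s) = ln (2*a) + ln (1 + u)" "ln (2*a - s) = ln (2*a) + ln (1 - u)"
  proof -
    have "2*a * (1+u) = 2*a+s" "2*a * (1-u) = 2*a-s" using a by (simp_all add: u_def distrib_left right_diff_distrib)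
    then show "ln (2*a + s) = ln (2*a) + ln (1 + u)" "ln (2*a - s) = ln (2*a) + ln (1 - u)"
      using a u ln_mult_pos[of "2*a" "1+u"] ln_mult_pos[of "2*a" "1-u"] by simp_all
  qed
  moreover have "a * (2 * u) = s" using a by (simp add: u_def)
  ultimately have "s + a * ln (2*a - s) \<le> a * ln (2*a+s)"
    by (simp only: distrib_left right_diff_distrib)
  then have "a * ln (2*a - s) + (- (2*a - s)/2) \<le> a * ln (2*a+s) + (- (2*a+s)/2)" by argo
  then have "exp (a * ln (2*a - s)) * exp (- (2*a - s)/2) \<le> exp (a * ln (2*a+s)) * exp (- (2*a+s)/2)"
    by (simp only: exp_add[symmetric] exp_le_cancel_iff)
  then show ?thesis
    using assms a by (simp only: powr_def) simp
qed

lemma gamma_kernel_shift: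
  fixes a x :: real
  assumes "a \<ge> 0" "2 * a \<le> x" "x > 0"
  shows "exp (-2) * (x powr a * exp (- x / 2)) \<le> (x + 4) powr a * exp (- (x + 4) / 2)"
proof -
  have "x powr a \<le> (x+4) powr a" using assms by (intro powr_mono2) auto
  moreover have "exp (- (x + 4) / 2) = exp (-2) * exp (- x / 2)"
    by (simp add: exp_add[symmetric] add_divide_distrib diff_divide_distrib)
  ultimately show ?thesis by (simp add: mult_left_mono mult_right_mono)
qed

text \<open>Reflection at the mode \<open>k - 2\<close> puts at least half of the mass above the mode;
  translating by 4 costs at most a factor \<open>exp 2\<close>.\<close>
lemma chisq_tail_lower:
  assumes k: "k \<ge> 2"
  shows "exp (-2) / 2 \<le> chisq_tail k (real k + 2)"
proof -
  \<comment> \<open>The density is a multiple of x^a exp (-x/2) with mode 2a = k - 2; k \<ge> 2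
    makes a nonnegative, and 2a + 4 is the target k + 2.\<close>
  define a where "a = real k / 2 - 1"
  define D where "D = 2 powr (real k / 2) * Gamma (real k / 2)"
  have D: "D > 0" using k by (auto simp: D_def intro!: Gamma_real_pos)
  have a: "a \<ge> 0" "real k = 2 * a + 2" using k by (auto simp: a_def)
  define d where "d = chisq_density k"
  have d: "d x = (if x > 0 then x powr a * exp (- x / 2) / D else 0)" for x
    by (simp add: d_def chisq_density_def a_def D_def)
  have k0: "k > 0" using k by simp
  have int: "set_integrable lborel A d" if "A \<in> sets borel" for A
    using set_integrable_chisq_density[OF k0 that] by (simp add: d_def)
  have dpos: "d x \<ge> 0" for x by (simp add: d_def chisq_density_nonneg)
  have dmeas [measurable]: "d \<in> borel_measurable borel" by (simp add: d_def)
  have total: "1 = (LINT x:{..2*a}|lborel. d x) + (LINT x:{2*a<..}|lborel. d x)"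
  proof -
    have "(LINT x:{..2*a} \<union> {2*a<..}|lborel. d x) = (LINT x:{..2*a}|lborel. d x) + (LINT x:{2*a<..}|lborel. d x)"
      by (rule set_integral_Un) (auto intro!: int)
    moreover have "{..2*a} \<union> {2*a<..} = UNIV" by auto
    ultimately show ?thesis using integral_chisq_density[OF k0] by (simp add: set_lebesgue_integral_def d_def)
  qed
  have refl_int: "integrable lborel (\<lambda>x. indicat_real {2*a..} x *\<^sub>R d x)"
    using int[of "{2*a..}"] unfolding set_integrable_def by simp
  have "(LINT x:{..2*a}|lborel. d x) \<le> (LINT x:{2*a<..}|lborel. d x)"
  proof -
    have "(LINT x:{..2*a}|lborel. d x) = (LINT x|lborel. indicat_real {..2*a} (4*a + (-1)*x) *\<^sub>R d (4*a + (-1)*x))"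
      unfolding set_lebesgue_integral_def by (subst lborel_integral_real_affine[where c="-1" and t="4*a"]) auto
    also have "\<dots> \<le> (LINT x|lborel. indicat_real {2*a..} x *\<^sub>R d x)"
    proof (rule integral_mono[OF _ refl_int])
      have "integrable lborel (\<lambda>x. indicat_real {..2*a} x *\<^sub>R d x)"
        using int[of "{..2*a}"] unfolding set_integrable_def by simp
      from lborel_integrable_real_affine[OF this, of "-1" "4*a"]
      show "integrable lborel (\<lambda>x. indicat_real {..2*a} (4*a + (-1)*x) *\<^sub>R d (4*a + (-1)*x))" by simp
    next
      fix x
      show "indicat_real {..2*a} (4*a + (-1)*x) *\<^sub>R d (4*a + (-1)*x) \<le> indicat_real {2*a..} x *\<^sub>R d x"
      \<comment> \<open>Points x \<ge> 4a reflect to 4a - x \<le> 0, where the density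
        vanishes.\<close>
      proof (cases "2*a \<le> x \<and> x < 4*a")
        case True
        from gamma_kernel_reflect[of a "x - 2*a"] True a
        have "(4*a - x) powr a * exp (- (4*a - x) / 2) \<le> x powr a * exp (- x / 2)"
          by (simp add: algebra_simps)
        with True a D show ?thesis by (auto simp: d indicator_def intro!: divide_right_mono)
      next
        case False
        then have "x < 2*a \<or> d (4*a + (-1)*x) = 0" by (auto simp: d)
        then show ?thesis using dpos[of x] by (auto simp: indicator_def)
      qed
    qed
    also have "\<dots> = (LINT x:{2*a<..}|lborel. d x)"
      unfolding set_lebesgue_integral_def
    proof (rule integral_cong_AE)
      show "AE x in lborel. indicat_real {2 * a..} x *\<^sub>R d x = indicat_real {2 * a<..} x *\<^sub>R d x"
        using AE_lborel_singleton[of "2*a"] by eventually_elim (auto simp: indicator_def)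
    qed auto
    finally show ?thesis .
  qed
  with total have half: "1/2 \<le> (LINT x:{2*a<..}|lborel. d x)" by simp
  have "exp (-2) * (LINT x:{2*a<..}|lborel. d x) \<le> (LINT x:{2*a+4<..}|lborel. d x)"
  proof -
    have "exp (-2) * (LINT x:{2*a<..}|lborel. d x) = (LINT x|lborel. exp (-2) * (indicat_real {2*a<..} x *\<^sub>R d x))"
      by (simp add: set_lebesgue_integral_def)
    also have "\<dots> \<le> (LINT x|lborel. indicat_real {2*a+4<..} (4 + 1*x) *\<^sub>R d (4+1*x))"
    proof (rule integral_mono)
      show "integrable lborel (\<lambda>x. exp (-2) * (indicat_real {2*a<..} x *\<^sub>R d x))"
        using int[of "{2*a<..}"] unfolding set_integrable_def by simp
      have "integrable lborel (\<lambda>x. indicat_real {2*a+4<..} x *\<^sub>R d x)"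
        using int[of "{2*a+4<..}"] unfolding set_integrable_def by simp
      from lborel_integrable_real_affine[OF this, of 1 4]
      show "integrable lborel (\<lambda>x. indicat_real {2*a+4<..} (4 + 1*x) *\<^sub>R d (4+1*x))" by simp
      fix x
      show "exp (-2) * (indicat_real {2*a<..} x *\<^sub>R d x) \<le> indicat_real {2*a+4<..} (4 + 1*x) *\<^sub>R d (4+1*x)"
      proof (cases "x > 2*a")
        case True
        have "exp (-2) * (x powr a * exp (- x / 2)) / D \<le> (x + 4) powr a * exp (- (x + 4) / 2) / D"
          using True a D by (intro divide_right_mono gamma_kernel_shift) auto
        with True a show ?thesis by (auto simp: d indicator_def add.commute)
      qed (auto simp: indicator_def)
    qed
    also have "\<dots> = (LINT x:{2*a+4<..}|lborel. d x)"
      unfolding set_lebesgue_integral_def by (subst (2) lborel_integral_real_affine[where c=1 and t=4]) auto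
    finally show ?thesis .
  qed
  moreover have "exp (-2) * (1/2) \<le> exp (-2) * (LINT x:{2*a<..}|lborel. d x)"
    using half by (intro mult_left_mono) auto
  moreover have "chisq_tail k (real k + 2) = (LINT x:{2*a+4<..}|lborel. d x)"
    using a by (simp add: chisq_tail_def d_def algebra_simps)
  ultimately show ?thesis by linarith
qed

section \<open>The limiting null distribution function near 1, and its quantiles\<close>

lemma G_os_le_exp_partial:
  assumes "t \<le> s"
  shows "G_os t \<le> exp (- (\<Sum>j<n. chisq_tail (Suc j) (real (Suc j) * s) / real (Suc j)))"
proof (cases "summable (\<lambda>j. chisq_tail (Suc j) (real (Suc j) * t) / real (Suc j))")
  case True
  have "(\<Sum>j<n. chisq_tail (Suc j) (real (Suc j) * s) / real (Suc j))
     \<le> (\<Sum>j<n. chisq_tail (Suc j) (real (Suc j) * t) / real (Suc j))"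
    using assms by (intro sum_mono divide_right_mono chisq_tail_antimono mult_left_mono) auto
  also have "\<dots> \<le> (\<Sum>j. chisq_tail (Suc j) (real (Suc j) * t) / real (Suc j))"
    by (rule sum_le_suminf[OF True]) (auto simp: chisq_tail_nonneg)
  finally show ?thesis using True by (simp add: G_os_def)
next
  case False
  then show ?thesis by (simp add: G_os_def)
qed

text \<open>The tails P(chi^2_j > j + 2) are bounded below for j \<ge> 2, so the exponent picks up a
  harmonic sum. The slack 2 lets finitely many terms survive at some s strictly above 1, uniformly
  over t \<le> s.\<close>

lemma G_os_small_near_1:
  assumes "\<delta> > 0"
  shows "\<exists>s>1. \<forall>t\<le>s. G_os t < \<delta>"
proof -
  have "filterlim (\<lambda>n. harm n :: real) at_top sequentially"
    by (rule harm_at_top)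
  \<comment> \<open>Solves exp (-2) / 2 * (harm n - 1) \<ge> 1 - ln \<delta>; the extra 1 makes the
    final inequality strict.\<close>
  then have "eventually (\<lambda>n. harm n \<ge> 1 + 2 * exp 2 * (1 - ln \<delta>)) sequentially"
    by (simp add: filterlim_at_top)
  with eventually_gt_at_top[of 0] have "eventually (\<lambda>n. n > 0 \<and> harm n \<ge> 1 + 2 * exp 2 * (1 - ln \<delta>)) sequentially"
    by eventually_elim auto
  then obtain n where n: "n > 0" "harm n \<ge> 1 + 2 * exp 2 * (1 - ln \<delta>)"
    by (auto simp: eventually_sequentially)
  \<comment> \<open>For j \<le> n this gives j * s \<le> j + 2, the point up to which
    \<open>chisq_tail_lower\<close> controls the tail.\<close>
  define s where "s = 1 + 2 / real n"
  have lower: "exp (-2) / 2 * (harm n - 1) \<le> (\<Sum>j<n. chisq_tail (Suc j) (real (Suc j) * s) / real (Suc j))"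
  proof -
    \<comment> \<open>The term with one degree of freedom is given up, since
      \<open>chisq_tail_lower\<close> starts at two.\<close>
    have "harm n - 1 = (\<Sum>j<n. inverse (real (Suc j)) - (if j = 0 then 1 else 0))"
      using n(1) by (simp add: harm_altdef sum_subtractf sum.delta)
    then have "exp (-2) / 2 * (harm n - 1) = (\<Sum>j<n. exp (-2) / 2 * (inverse (real (Suc j)) - (if j = 0 then 1 else 0)))"
      by (simp only: sum_distrib_left)
    also have "\<dots> \<le> (\<Sum>j<n. chisq_tail (Suc j) (real (Suc j) * s) / real (Suc j))"
    proof (rule sum_mono)
      fix j assume j: "j \<in> {..<n}"
      show "exp (-2) / 2 * (inverse (real (Suc j)) - (if j = 0 then 1 else 0)) \<le> chisq_tail (Suc j) (real (Suc j) * s) / real (Suc j)"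
      proof (cases "j = 0")
        case True
        then show ?thesis using chisq_tail_nonneg[of "Suc 0" s] by simp
      next
        case False
        have "real (Suc j) * s \<le> real (Suc j) + 2"
        proof -
          have "real (Suc j) * (2 / real n) \<le> real n * (2 / real n)"
            using j by (intro mult_right_mono) auto
          then show ?thesis using n(1) unfolding s_def distrib_left by simp
        qed
        then have "chisq_tail (Suc j) (real (Suc j) + 2) \<le> chisq_tail (Suc j) (real (Suc j) * s)"
          by (intro chisq_tail_antimono) auto
        with chisq_tail_lower[of "Suc j"] False
        have "exp (-2) / 2 \<le> chisq_tail (Suc j) (real (Suc j) * s)" by linarith
        then have "exp (-2) / 2 / real (Suc j) \<le> chisq_tail (Suc j) (real (Suc j) * s) / real (Suc j)"
          by (intro divide_right_mono) auto
        then show ?thesis using False by (simp only: divide_inverse if_False diff_zero)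
      qed
    qed
    finally show ?thesis .
  qed
  have "1 - ln \<delta> = exp (-2) / 2 * (2 * exp 2 * (1 - ln \<delta>))"
    unfolding exp_minus by simp
  also have "\<dots> \<le> exp (-2) / 2 * (harm n - 1)"
    using n(2) by (intro mult_left_mono) simp_all
  also note lower
  finally have *: "1 - ln \<delta> \<le> (\<Sum>j<n. chisq_tail (Suc j) (real (Suc j) * s) / real (Suc j))" .
  have "G_os t < \<delta>" if "t \<le> s" for t
  proof -
    define S where "S = (\<Sum>j<n. chisq_tail (Suc j) (real (Suc j) * s) / real (Suc j))"
    have "G_os t \<le> exp (- S)"
      unfolding S_def using that by (rule G_os_le_exp_partial)
    also have "- S < ln \<delta>" using * unfolding S_def[symmetric] by simp
    then have "exp (- S) < exp (ln \<delta>)" by simp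
    finally show ?thesis using assms by simp
  qed
  moreover have "s > 1" using n(1) by (simp add: s_def)
  ultimately show ?thesis by blast
qed

text \<open>Makes the set defining \<open>t_alpha\<close> nonempty, without which its infimum would
  carry no information. The Chernoff bound dominates the series by a geometric one.\<close>

lemma G_os_attains:
  assumes "\<alpha> > 0"
  shows "\<exists>t. 1 - \<alpha> \<le> G_os t"
proof (cases "\<alpha> < 1")
  case True
  \<comment> \<open>Chosen so that the geometric sum q / (1 - q) equals \<alpha>; then G \<ge> exp
    (- \<alpha>) \<ge> 1 - \<alpha>.\<close>
  define q where "q = \<alpha> / (1 + \<alpha>)"
  have q: "0 < q" "q < 1" using assms by (auto simp: q_def field_simps)
  \<comment> \<open>Solves exp (- t / 4) * sqrt 2 = q, the base of the Chernoff bound at k *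
    t.\<close>
  define t where "t = 4 * (ln 2 / 2 - ln q)"
  have "ln q < 0" using q by simp
  moreover have "ln (2::real) > 0" by simp
  ultimately have t0: "t > 0" unfolding t_def by argo
  have bd: "chisq_tail (Suc j) (real (Suc j) * t) / real (Suc j) \<le> q * q ^ j" for j
  proof -
    have "chisq_tail (Suc j) (real (Suc j) * t) \<le> exp (- (real (Suc j) * t) / 4) * 2 powr (real (Suc j) / 2)"
      using t0 by (intro chisq_tail_chernoff) auto
    also have "\<dots> = exp (real (Suc j) * ln q)"
    proof -
      have "- (real (Suc j) * t) / 4 + real (Suc j) / 2 * ln 2 = real (Suc j) * ln q"
        by (simp only: t_def) (simp add: field_simps del: of_nat_Suc)
      then show ?thesis by (simp add: powr_def exp_add[symmetric] del: of_nat_Suc)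
    qed
    also have "\<dots> = q ^ Suc j" using q by (simp add: exp_of_nat_mult del: of_nat_Suc)
    finally have "chisq_tail (Suc j) (real (Suc j) * t) \<le> q ^ Suc j" .
    moreover have "chisq_tail (Suc j) (real (Suc j) * t) / real (Suc j) \<le> chisq_tail (Suc j) (real (Suc j) * t) / 1"
      by (intro divide_left_mono) (auto simp: chisq_tail_nonneg)
    ultimately show ?thesis by simp
  qed
  have sq: "summable (\<lambda>j. q * q ^ j)" using q by (intro summable_mult summable_geometric) auto
  have sm: "summable (\<lambda>j. chisq_tail (Suc j) (real (Suc j) * t) / real (Suc j))"
    by (rule summable_comparison_test'[OF sq, of 0]) (use bd in \<open>auto simp: chisq_tail_nonneg\<close>)
  have "(\<Sum>j. chisq_tail (Suc j) (real (Suc j) * t) / real (Suc j)) \<le> (\<Sum>j. q * q ^ j)"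
    by (rule suminf_le[OF bd sm sq])
  also have "\<dots> = q / (1 - q)" using q by (simp add: suminf_mult suminf_geometric summable_geometric)
  also have "\<dots> = \<alpha>" using assms by (simp add: q_def field_simps)
  finally have "- (\<Sum>j. chisq_tail (Suc j) (real (Suc j) * t) / real (Suc j)) \<ge> - \<alpha>" by simp
  then have "exp (- \<alpha>) \<le> G_os t" using sm by (simp add: G_os_def)
  moreover have "1 - \<alpha> \<le> exp (- \<alpha>)" using exp_ge_add_one_self[of "-\<alpha>"] by simp
  ultimately show ?thesis by (intro exI[of _ t]) linarith
next
  case False
  moreover have "G_os 0 \<ge> 0" by (simp add: G_os_def)
  ultimately show ?thesis by (intro exI[of _ 0]) simp
qed

lemma t_alpha_gt_1:
  assumes "0 < \<alpha>" "\<alpha> < 1"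
  shows "t_alpha \<alpha> > 1"
proof -
  obtain s where s: "s > 1" "\<And>t. t \<le> s \<Longrightarrow> G_os t < 1 - \<alpha>"
    using G_os_small_near_1[of "1 - \<alpha>"] assms by auto
  have "s \<le> t_alpha \<alpha>" unfolding t_alpha_def
  proof (rule cInf_greatest)
    show "{t. 1 - \<alpha> \<le> G_os t} \<noteq> {}" using G_os_attains[OF assms(1)] by auto
    fix t assume "t \<in> {t. 1 - \<alpha> \<le> G_os t}"
    then show "s \<le> t" using s(2)[of t] by fastforce
  qed
  with s(1) show ?thesis by simp
qed

section \<open>Cosines at the design points\<close>

text \<open>Multiplying by 2 sin (\<theta> / 2) makes the sum telescope to sin (j pi) - sin 0.
  Frequencies up to 2n - 1 are covered because a product of two cosines with frequencies below n
  produces the sum frequency j + l.\<close>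

lemma sum_cos_midpoints:
  fixes j n :: nat
  assumes "0 < j" "j < 2 * n"
  shows "(\<Sum>i=1..n. cos (pi * real j * xpt n i)) = 0"
proof -
  define \<theta> where "\<theta> = pi * real j / real n"
  have n: "real n > 0" using assms by auto
  have "0 < \<theta> / 2" using assms n by (simp add: \<theta>_def)
  moreover have "\<theta> / 2 < pi"
    using assms n by (simp add: \<theta>_def divide_simps)
  ultimately have s: "sin (\<theta> / 2) > 0" by (rule sin_gt_zero)
  have tel: "2 * sin (\<theta> / 2) * cos (pi * real j * xpt n (Suc i)) = sin (\<theta> * real (Suc i)) - sin (\<theta> * real i)" for i
  proof -
    have "pi * real j * xpt n (Suc i) = \<theta> * real i + \<theta> / 2"
      using n by (simp add: xpt_def \<theta>_def field_simps)
    moreover have "sin (\<theta> * real (Suc i)) - sin (\<theta> * real i)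
        = 2 * sin ((\<theta> * real (Suc i) - \<theta> * real i) / 2) * cos ((\<theta> * real (Suc i) + \<theta> * real i) / 2)"
      by (rule sin_diff_sin)
    moreover have "\<theta> * real (Suc i) - \<theta> * real i = \<theta>" "(\<theta> * real (Suc i) + \<theta> * real i) / 2 = \<theta> * real i + \<theta> / 2"
      by (simp_all add: algebra_simps add_divide_distrib)
    ultimately show ?thesis by (simp only:)
  qed
  have "2 * sin (\<theta> / 2) * (\<Sum>i=1..n. cos (pi * real j * xpt n i))
      = (\<Sum>i<n. 2 * sin (\<theta> / 2) * cos (pi * real j * xpt n (Suc i)))"
    unfolding sum_distrib_left One_nat_def by (rule sum.atLeast1_atMost_eq)
  also have "\<dots> = (\<Sum>i<n. sin (\<theta> * real (Suc i)) - sin (\<theta> * real i))"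
    by (simp only: tel)
  also have "\<dots> = sin (\<theta> * real n) - sin (\<theta> * real 0)" by (rule sum_lessThan_telescope)
  also have "\<theta> * real n = real j * pi" using n by (simp add: \<theta>_def)
  finally show ?thesis using s by simp
qed

lemma cos_midpoints_orthogonal:
  assumes "1 \<le> j" "j < n" "1 \<le> l" "l < n"
  shows "(\<Sum>i=1..n. cos (pi * real j * xpt n i) * cos (pi * real l * xpt n i)) = (if j = l then real n / 2 else 0)"
proof -
  have main: "(\<Sum>i=1..n. cos (pi * real j * xpt n i) * cos (pi * real l * xpt n i)) = (if j = l then real n / 2 else 0)"
    if jl: "l \<le> j" "1 \<le> l" "j < n" for j l
  proof -
    have "(\<Sum>i=1..n. cos (pi * real j * xpt n i) * cos (pi * real l * xpt n i))
       = (\<Sum>i=1..n. cos (pi * real (j - l) * xpt n i) + cos (pi * real (j + l) * xpt n i)) / 2"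
      unfolding sum_divide_distrib
      by (intro sum.cong refl) (simp add: cos_times_cos of_nat_diff jl algebra_simps)
    also have "\<dots> = (\<Sum>i=1..n. cos (pi * real (j - l) * xpt n i)) / 2"
      using sum_cos_midpoints[of "j + l" n] jl by (simp add: sum.distrib)
    also have "\<dots> = (if j = l then real n / 2 else 0)"
      using sum_cos_midpoints[of "j - l" n] jl by auto
    finally show ?thesis .
  qed
  show ?thesis
  proof (cases "l \<le> j")
    case True
    then show ?thesis using main[of l j] assms by simp
  next
    case False
    then show ?thesis using main[of j l] assms by (simp add: mult.commute)
  qed
qed

text \<open>In the proof, p is the projection of b onto the first m cosines, whose squared norms at
  the design points are n / 2; the inequality expands the nonnegative squared norm of b - p.\<close>

lemma discrete_cosine_bessel:
  fixes b :: "nat \<Rightarrow> real"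
  assumes "m < n"
  shows "(\<Sum>j=1..m. (\<Sum>i=1..n. b i * cos (pi * real j * xpt n i))\<^sup>2) \<le> real n / 2 * (\<Sum>i=1..n. (b i)\<^sup>2)"
proof -
  define c where "c j i = cos (pi * real j * xpt n i)" for j i
  define B where "B j = (\<Sum>i=1..n. b i * c j i)" for j
  define p where "p i = 2 / real n * (\<Sum>j=1..m. B j * c j i)" for i
  have n: "real n > 0" using assms by simp
  have bp: "(\<Sum>i=1..n. b i * p i) = 2 / real n * (\<Sum>j=1..m. (B j)\<^sup>2)"
  proof -
    have "(\<Sum>i=1..n. b i * p i) = (\<Sum>i=1..n. \<Sum>j=1..m. 2 / real n * (B j * (b i * c j i)))"
      by (simp add: p_def sum_distrib_left algebra_simps)
    also have "\<dots> = (\<Sum>j=1..m. \<Sum>i=1..n. 2 / real n * (B j * (b i * c j i)))" by (rule sum.swap)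
    also have "\<dots> = 2 / real n * (\<Sum>j=1..m. (B j)\<^sup>2)"
      by (simp only: sum_distrib_left[symmetric] B_def[symmetric] power2_eq_square)
    finally show ?thesis .
  qed
  have pp: "(\<Sum>i=1..n. (p i)\<^sup>2) = 2 / real n * (\<Sum>j=1..m. (B j)\<^sup>2)"
  proof -
    have "(\<Sum>i=1..n. (p i)\<^sup>2) = (\<Sum>i=1..n. \<Sum>j=1..m. \<Sum>l=1..m. (2 / real n)\<^sup>2 * (B j * B l * (c j i * c l i)))"
      unfolding p_def power_mult_distrib power2_eq_square[of "sum _ _"] sum_product
      by (simp add: sum_distrib_left algebra_simps)
    also have "\<dots> = (\<Sum>j=1..m. \<Sum>l=1..m. \<Sum>i=1..n. (2 / real n)\<^sup>2 * (B j * B l * (c j i * c l i)))"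
      by (subst sum.swap) (intro sum.cong refl sum.swap)
    also have "\<dots> = (\<Sum>j=1..m. \<Sum>l=1..m. (2 / real n)\<^sup>2 * (B j * B l * (if j = l then real n / 2 else 0)))"
    proof (intro sum.cong refl)
      fix j l assume "j \<in> {1..m}" "l \<in> {1..m}"
      then have "(\<Sum>i=1..n. c j i * c l i) = (if j = l then real n / 2 else 0)"
        using assms unfolding c_def by (intro cos_midpoints_orthogonal) auto
      then show "(\<Sum>i=1..n. (2 / real n)\<^sup>2 * (B j * B l * (c j i * c l i))) = (2 / real n)\<^sup>2 * (B j * B l * (if j = l then real n / 2 else 0))"
        by (simp only: sum_distrib_left[symmetric])
    qed
    also have "\<dots> = (\<Sum>j=1..m. (2 / real n)\<^sup>2 * (B j * B j * (real n / 2)))"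
      by (intro sum.cong refl) (simp add: if_distrib cong: if_cong)
    also have "\<dots> = 2 / real n * (\<Sum>j=1..m. (B j)\<^sup>2)"
      using n by (simp add: sum_distrib_left power2_eq_square)
    finally show ?thesis .
  qed
  have "0 \<le> (\<Sum>i=1..n. (b i - p i)\<^sup>2)" by (intro sum_nonneg) auto
  also have "\<dots> = (\<Sum>i=1..n. (b i)\<^sup>2) - 2 * (\<Sum>i=1..n. b i * p i) + (\<Sum>i=1..n. (p i)\<^sup>2)"
    by (simp add: power2_diff sum.distrib sum_subtractf sum_distrib_left algebra_simps)
  also have "\<dots> = (\<Sum>i=1..n. (b i)\<^sup>2) - 2 / real n * (\<Sum>j=1..m. (B j)\<^sup>2)" unfolding bp pp by simp
  finally have "real n / 2 * (2 / real n * (\<Sum>j=1..m. (B j)\<^sup>2)) \<le> real n / 2 * (\<Sum>i=1..n. (b i)\<^sup>2)"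
    using n by (intro mult_left_mono) auto
  then show ?thesis using n by (simp add: B_def c_def)
qed

section \<open>Riemann sums of piecewise Lipschitz functions\<close>

lemma xpt_mem: "i \<in> {1..n} \<Longrightarrow> xpt n i \<in> {0<..<1}"
  by (auto simp: xpt_def field_simps)

lemma piecewise_lipschitz_bounded:
  fixes \<beta> :: "real \<Rightarrow> real"
  assumes "finite S" and lip: "\<And>a b. {a..b} \<subseteq> {0..1} - S \<Longrightarrow> L-lipschitz_on {a..b} \<beta>"
  obtains B where "B > 0" "\<And>x. x \<in> {0..1} \<Longrightarrow> \<bar>\<beta> x\<bar> \<le> B"
proof -
  \<comment> \<open>\<open>P A\<close> collects the points that have exactly the exceptional points
    A to their left. Two points of one class bound an interval free of S, so \<beta> varies there by
    at most L; there are only finitely many classes.\<close>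
  define P where "P A = {x \<in> {0..1} - S. {s \<in> S. s < x} = A}" for A
  \<comment> \<open>The empty interval {1..0} satisfies the premise and yields L \<ge> 0.\<close>
  have L: "L \<ge> 0" using lip[of 1 0] by (auto simp: lipschitz_on_def)
  have close: "\<bar>\<beta> x - \<beta> y\<bar> \<le> L" if "x \<in> P A" "y \<in> P A" "x \<le> y" for x y A
  proof -
    have "{x..y} \<subseteq> {0..1} - S"
    proof
      fix z assume z: "z \<in> {x..y}"
      have "z \<notin> S"
      proof
        assume "z \<in> S"
        then have "z < y" using that z by (auto simp: P_def less_le)
        with \<open>z \<in> S\<close> have "z \<in> A" using that by (auto simp: P_def)
        then have "z < x" using that by (auto simp: P_def)
        with z show False by simp
      qed
      then show "z \<in> {0..1} - S" using z that by (auto simp: P_def)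
    qed
    from lip[OF this] have "dist (\<beta> x) (\<beta> y) \<le> L * dist x y"
      using that by (auto simp: lipschitz_on_def)
    also have "\<dots> \<le> L * 1" using that L by (intro mult_left_mono) (auto simp: dist_real_def P_def)
    finally show ?thesis by (simp add: dist_real_def)
  qed
  have "bounded (\<beta> ` P A)" for A
  proof (cases "P A = {}")
    case False
    then obtain y where y: "y \<in> P A" by auto
    have "\<bar>\<beta> x\<bar> \<le> \<bar>\<beta> y\<bar> + L" if "x \<in> P A" for x
      using close[OF that y] close[OF y that] by (cases "x \<le> y") auto
    then show ?thesis by (auto simp: bounded_real)
  qed auto
  then have "bounded (\<Union>A\<in>Pow S. \<beta> ` P A)" using assms(1) by (intro bounded_UN) auto
  moreover have "bounded (\<beta> ` S)" using assms(1) by (intro finite_imp_bounded) auto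
  ultimately have "bounded ((\<Union>A\<in>Pow S. \<beta> ` P A) \<union> \<beta> ` S)" by (rule bounded_Un[THEN iffD2, OF conjI])
  moreover have "\<beta> ` {0..1} \<subseteq> (\<Union>A\<in>Pow S. \<beta> ` P A) \<union> \<beta> ` S"
  proof -
    have "x \<in> P {s \<in> S. s < x}" if "x \<in> {0..1} - S" for x using that by (simp add: P_def)
    then have "\<beta> x \<in> (\<Union>A\<in>Pow S. \<beta> ` P A)" if "x \<in> {0..1} - S" for x
      using that by (intro UN_I[of "{s \<in> S. s < x}"]) auto
    then show ?thesis by (smt (verit) DiffI UnI1 UnI2 image_iff subsetI)
  qed
  ultimately have "bounded (\<beta> ` {0..1})" by (rule bounded_subset)
  then obtain B where "B > 0" "\<And>x. x \<in> {0..1} \<Longrightarrow> \<bar>\<beta> x\<bar> \<le> B" by (auto simp: bounded_pos)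
  then show ?thesis using that by blast
qed

lemma piecewise_lipschitz_isCont:
  fixes \<beta> :: "real \<Rightarrow> real"
  assumes "finite S" and lip: "\<And>a b. {a..b} \<subseteq> {0..1} - S \<Longrightarrow> L-lipschitz_on {a..b} \<beta>"
    and x: "x \<in> {0<..<1} - S"
  shows "isCont \<beta> x"
proof -
  have "open ({0<..<1} - S)" using assms(1) by (intro open_Diff finite_imp_closed) auto
  with x obtain e where e: "e > 0" "cball x e \<subseteq> {0<..<1} - S" unfolding open_contains_cball by blast
  have "{x - e..x + e} \<subseteq> {0..1} - S" using e by (auto simp: cball_eq_atLeastAtMost subset_iff)
  from lipschitz_on_continuous_on[OF lip[OF this]] show ?thesis
    using e by (intro continuous_on_interior[of "{x-e..x+e}"]) auto
qed

text \<open>The midpoint sum is the integral of the step function \<open>s n\<close>, which takes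
  the value of g at the midpoint of the cell containing x. It converges to g at every continuity
  point, so dominated convergence applies.\<close>

lemma midpoint_sum_tendsto_integral:
  fixes g :: "real \<Rightarrow> real"
  assumes S: "finite S" and cont: "\<And>x. x \<in> {0<..<1} - S \<Longrightarrow> isCont g x"
    and bd: "\<And>x. x \<in> {0..1} \<Longrightarrow> \<bar>g x\<bar> \<le> B"
  shows "(\<lambda>n. (1 / real n) * (\<Sum>i=1..n. g (xpt n i))) \<longlonglongrightarrow> (LBINT x=0..1. g x)"
proof -
  define s where "s n x = (\<Sum>i=1..n. g (xpt n i) * indicator {(real i - 1) / real n<..real i / real n} x)" for n x
  define U where "U = {0<..<1} - S"
  \<comment> \<open>g is not assumed measurable. On the open set U it is continuous, which makes f
    measurable, and only finitely many points of (0, 1) are lost.\<close>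
  define f where "f = (\<lambda>x. indicator U x *\<^sub>R g x)"
  have U: "open U" unfolding U_def using S by (intro open_Diff finite_imp_closed) auto
  have f [measurable]: "f \<in> borel_measurable borel"
    unfolding f_def using U cont
    by (intro borel_measurable_continuous_on_indicator) (auto simp: U_def intro!: continuous_at_imp_continuous_on)
  have step: "s n x = g (xpt n (nat \<lceil>real n * x\<rceil>)) \<and> nat \<lceil>real n * x\<rceil> \<in> {1..n}" if "x \<in> {0<..1}" "n > 0" for n x
  proof -
    define k where "k = nat \<lceil>real n * x\<rceil>"
    have pos: "real n * x > 0" using that by simp
    have le: "real n * x \<le> real n" using that by (simp add: mult_left_le)
    have "k \<in> {1..n}" using pos le by (auto simp: k_def Suc_le_eq ceiling_le_iff nat_le_iff)
    have ind: "indicator {(real i - 1) / real n<..real i / real n} x = (if i = k then 1 else 0 :: real)" if "i \<in> {1..n}" for i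
    proof -
      have "x \<in> {(real i - 1) / real n<..real i / real n} \<longleftrightarrow> real i - 1 < real n * x \<and> real n * x \<le> real i"
        using \<open>n > 0\<close> by (simp add: field_simps)
      also have "\<dots> \<longleftrightarrow> \<lceil>real n * x\<rceil> = int i"
        by (auto simp: ceiling_eq_iff)
      also have "\<dots> \<longleftrightarrow> i = k" using pos by (auto simp: k_def)
      finally show ?thesis by (simp add: indicator_def)
    qed
    have "s n x = (\<Sum>i=1..n. g (xpt n i) * (if i = k then 1 else 0))"
      unfolding s_def by (intro sum.cong refl) (simp only: ind)
    also have "\<dots> = g (xpt n k)" using \<open>k \<in> {1..n}\<close> by (simp add: if_distrib cong: if_cong)
    finally show ?thesis using \<open>k \<in> {1..n}\<close> by (simp add: k_def)
  qed
  have outside: "s n x = 0" if "x \<notin> {0<..1}" for n x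
  proof -
    have "x \<notin> {(real i - 1) / real n<..real i / real n}" if i: "i \<in> {1..n}" for i
    proof -
      have "(real i - 1) / real n \<ge> 0" "real i / real n \<le> 1" using i by auto
      with \<open>x \<notin> {0<..1}\<close> show ?thesis by auto
    qed
    then show ?thesis unfolding s_def by (intro sum.neutral) auto
  qed
  have int_s: "(LINT x|lborel. s n x) = (1 / real n) * (\<Sum>i=1..n. g (xpt n i))" for n
  proof -
    have "(LINT x|lborel. s n x) = (\<Sum>i=1..n. g (xpt n i) * measure lborel {(real i - 1) / real n<..real i / real n})"
      unfolding s_def by (subst Bochner_Integration.integral_sum) (auto simp: divide_right_mono)
    also have "\<dots> = (\<Sum>i=1..n. g (xpt n i) * (1 / real n))"
      by (intro sum.cong refl) (auto simp: divide_right_mono diff_divide_distrib)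
    finally show ?thesis by (simp add: sum_distrib_left mult.commute)
  qed
  have "(\<lambda>n. LINT x|lborel. s n x) \<longlonglongrightarrow> (LINT x|lborel. f x)"
  proof (rule integral_dominated_convergence[where w="\<lambda>x. B * indicator {0<..1} x"])
    show "AE x in lborel. (\<lambda>n. s n x) \<longlonglongrightarrow> f x"
    proof -
      have "AE x in lborel. x \<notin> S \<union> {1::real}"
        by (rule AE_not_in) (use S in \<open>auto intro!: finite_imp_null_set_lborel\<close>)
      then show ?thesis
      proof eventually_elim
        case (elim x)
        show ?case
        proof (cases "x \<in> {0<..<1}")
          case True
          then have xU: "x \<in> U" using elim by (auto simp: U_def)
          have "(\<lambda>n. xpt n (nat \<lceil>real n * x\<rceil>)) \<longlonglongrightarrow> x"
          proof (rule real_tendsto_sandwich)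
            show "(\<lambda>n. x - 1 / real n) \<longlonglongrightarrow> x" "(\<lambda>n. x + 1 / real n) \<longlonglongrightarrow> x"
              using tendsto_diff[OF tendsto_const lim_1_over_n, of x] tendsto_add[OF tendsto_const lim_1_over_n, of x]
              by simp_all
            have "x - 1 / real n \<le> xpt n (nat \<lceil>real n * x\<rceil>) \<and> xpt n (nat \<lceil>real n * x\<rceil>) \<le> x + 1 / real n" if "n > 0" for n
            proof -
              have "real n * x > 0" using that True by simp
              then have "real (nat \<lceil>real n * x\<rceil>) = real_of_int \<lceil>real n * x\<rceil>"
                by (simp add: of_nat_nat)
              then have "real n * x \<le> real (nat \<lceil>real n * x\<rceil>)" "real (nat \<lceil>real n * x\<rceil>) \<le> real n * x + 1"
                by linarith+
              then have "(real n * x - 1) / real n \<le> xpt n (nat \<lceil>real n * x\<rceil>)" "xpt n (nat \<lceil>real n * x\<rceil>) \<le> (real n * x + 1) / real n"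
                unfolding xpt_def by (intro divide_right_mono; simp)+
              then show ?thesis using that by (simp add: diff_divide_distrib add_divide_distrib)
            qed
            then show "\<forall>\<^sub>F n in sequentially. x - 1 / real n \<le> xpt n (nat \<lceil>real n * x\<rceil>)"
              "\<forall>\<^sub>F n in sequentially. xpt n (nat \<lceil>real n * x\<rceil>) \<le> x + 1 / real n"
              by (auto intro!: eventually_mono[OF eventually_gt_at_top[of 0]])
          qed
          then have "(\<lambda>n. g (xpt n (nat \<lceil>real n * x\<rceil>))) \<longlonglongrightarrow> g x"
            using cont[of x] xU unfolding U_def by (intro isCont_tendsto_compose[of x g]) auto
          moreover have "\<forall>\<^sub>F n in sequentially. g (xpt n (nat \<lceil>real n * x\<rceil>)) = s n x"
            using eventually_gt_at_top[of 0] by eventually_elim (use step True in auto)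
          ultimately have "(\<lambda>n. s n x) \<longlonglongrightarrow> g x" by (rule Lim_transform_eventually)
          then show ?thesis using xU by (simp add: f_def)
        next
          case False
          then have "x \<notin> {0<..1}" using elim by auto
          moreover have "f x = 0" using False by (auto simp: f_def U_def)
          ultimately show ?thesis using outside by simp
        qed
      qed
    qed
    show "AE x in lborel. norm (s n x) \<le> B * indicator {0<..1} x" for n
    proof (rule AE_I2)
      fix x
      show "norm (s n x) \<le> B * indicator {0<..1} x"
      proof (cases "x \<in> {0<..1} \<and> n > 0")
        case True
        then have "s n x = g (xpt n (nat \<lceil>real n * x\<rceil>))" "nat \<lceil>real n * x\<rceil> \<in> {1..n}" using step by auto
        with xpt_mem[of _ n] bd True show ?thesis by (auto simp: less_imp_le)
      next
        case False
        have "B \<ge> 0" using bd[of 0] by auto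
        moreover have "s n x = 0"
        proof (cases "n = 0")
          case True
          then show ?thesis by (simp add: s_def)
        qed (use False outside[of x n] in auto)
        ultimately show ?thesis by simp
      qed
    qed
    show "s n \<in> borel_measurable lborel" for n unfolding s_def by measurable
  qed (auto simp: divide_right_mono)
  moreover have "(LINT x|lborel. f x) = (LBINT x=0..1. g x)"
  proof -
    have "(LINT x|lborel. f x) = (LINT x|lborel. indicator {0<..<1} x *\<^sub>R g x)"
    proof (rule Bochner_Integration.integral_cong_AE)
      have *: "AE x in lborel. x \<notin> S" by (rule AE_not_in) (use S in \<open>auto intro!: finite_imp_null_set_lborel\<close>)
      then show "AE x in lborel. f x = indicat_real {0<..<1} x *\<^sub>R g x"
        by eventually_elim (auto simp: f_def U_def indicator_def)
      \<comment> \<open>Adding back the finitely many exceptional points shows that g itself is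
        measurable on (0, 1).\<close>
      have "(\<lambda>x. indicat_real {0<..<1} x *\<^sub>R g x) = (\<lambda>x. f x + (\<Sum>y\<in>S \<inter> {0<..<1}. g y * indicator {y} x))"
      proof
        fix x
        have "(\<Sum>y\<in>S \<inter> {0<..<1}. g y * indicator {y} x) = (\<Sum>y\<in>S \<inter> {0<..<1}. if y = x then g x else 0)"
          by (intro sum.cong refl) (auto simp: indicator_def)
        also have "\<dots> = (if x \<in> S \<inter> {0<..<1} then g x else 0)" using S by (simp add: sum.delta)
        finally show "indicat_real {0<..<1} x *\<^sub>R g x = f x + (\<Sum>y\<in>S \<inter> {0<..<1}. g y * indicator {y} x)"
          by (auto simp: f_def U_def indicator_def)
      qed
      then show "(\<lambda>x. indicat_real {0<..<1} x *\<^sub>R g x) \<in> borel_measurable lborel" by simp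
    qed auto
    moreover have "einterval 0 1 = {0<..<1::real}"
      by (auto simp: einterval_def zero_ereal_def one_ereal_def)
    ultimately show ?thesis
      by (simp add: interval_lebesgue_integral_def set_lebesgue_integral_def)
  qed
  ultimately show ?thesis by (simp add: int_s)
qed

section \<open>Second moments and tails\<close>

context prob_space
begin

text \<open>Independence makes the joint law of X k and the block J a product, so Fubini allows
  integrating over X k first with the block frozen. This serves both the orthogonality of degenerate
  kernels and the absence of atoms of quadratic forms.\<close>

lemma indep_vars_integral_eq_0:
  fixes X :: "'i \<Rightarrow> 'a \<Rightarrow> real" and \<phi> :: "real \<Rightarrow> ('i \<Rightarrow> real) \<Rightarrow> real"
  assumes ind: "indep_vars (\<lambda>_. borel) X UNIV" and k: "k \<notin> J"
    and meas [measurable]: "(\<lambda>(x, v). \<phi> x v) \<in> borel_measurable (borel \<Otimes>\<^sub>M PiM J (\<lambda>_. borel))"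
    and bd: "\<And>x v. \<bar>\<phi> x v\<bar> \<le> B"
    and zero: "\<And>v. (LINT \<omega>|M. \<phi> (X k \<omega>) v) = 0"
  shows "(LINT \<omega>|M. \<phi> (X k \<omega>) (restrict (\<lambda>i. X i \<omega>) J)) = 0"
proof -
  define R where "R \<omega> = restrict (\<lambda>i. X i \<omega>) J" for \<omega>
  define K where "K \<omega> = restrict (\<lambda>i. X i \<omega>) {k}" for \<omega>
  let ?PJ = "PiM J (\<lambda>_. borel :: real measure)" and ?PK = "PiM {k} (\<lambda>_. borel :: real measure)"
  have X [measurable]: "random_variable borel (X i)" for i
    using ind by (auto simp: indep_vars_def)
  have R [measurable]: "R \<in> measurable M ?PJ" and K [measurable]: "K \<in> measurable M ?PK"
    unfolding R_def K_def by (intro measurable_restrict; simp)+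
  have "indep_var ?PK K ?PJ R"
    unfolding K_def R_def by (rule indep_var_restrict[OF ind]) (use k in auto)
  then have eq: "distr M ?PK K \<Otimes>\<^sub>M distr M ?PJ R = distr M (?PK \<Otimes>\<^sub>M ?PJ) (\<lambda>\<omega>. (K \<omega>, R \<omega>))"
    using indep_var_distribution_eq by auto
  interpret D1: prob_space "distr M ?PK K" by (rule prob_space_distr) simp
  interpret D2: prob_space "distr M ?PJ R" by (rule prob_space_distr) simp
  interpret P: pair_prob_space "distr M ?PK K" "distr M ?PJ R" ..
  have "(\<lambda>p. (fst p k, snd p)) \<in> measurable (?PK \<Otimes>\<^sub>M ?PJ) (borel \<Otimes>\<^sub>M ?PJ)" by measurable
  from measurable_compose[OF this meas]
  have m [measurable]: "(\<lambda>(u, v). \<phi> (u k) v) \<in> borel_measurable (?PK \<Otimes>\<^sub>M ?PJ)" by (simp add: split_beta)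
  have int: "integrable (distr M ?PK K \<Otimes>\<^sub>M distr M ?PJ R) (\<lambda>(u, v). \<phi> (u k) v)"
    by (rule P.integrable_const_bound[of _ B]) (use m bd in \<open>auto simp: split_beta\<close>)
  have "(LINT \<omega>|M. \<phi> (X k \<omega>) (R \<omega>)) = (LINT z|distr M (?PK \<Otimes>\<^sub>M ?PJ) (\<lambda>\<omega>. (K \<omega>, R \<omega>)). (case z of (u, v) \<Rightarrow> \<phi> (u k) v))"
    by (subst integral_distr) (auto simp: K_def)
  also have "\<dots> = (LINT v|distr M ?PJ R. (LINT u|distr M ?PK K. \<phi> (u k) v))"
    unfolding eq[symmetric] by (rule P.integral_snd[OF int, symmetric])
  also have "\<dots> = (LINT v|distr M ?PJ R. 0)"
  proof (rule Bochner_Integration.integral_cong[OF refl])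
    fix v assume "v \<in> space (distr M ?PJ R)"
    then have v: "v \<in> space ?PJ" by simp
    have "(\<lambda>u. (u, v)) \<in> measurable ?PK (?PK \<Otimes>\<^sub>M ?PJ)"
      using v by (rule measurable_Pair2')
    from measurable_compose[OF this m] have "(\<lambda>u. \<phi> (u k) v) \<in> borel_measurable ?PK" by simp
    then have "(LINT u|distr M ?PK K. \<phi> (u k) v) = (LINT \<omega>|M. \<phi> (X k \<omega>) v)"
      by (subst integral_distr) (auto simp: K_def)
    then show "(LINT u|distr M ?PK K. \<phi> (u k) v) = 0" using zero by simp
  qed
  finally show ?thesis by (simp add: R_def)
qed

lemma second_moment_sum:
  fixes X :: "'p \<Rightarrow> 'a \<Rightarrow> real"
  assumes int: "\<And>p q. p \<in> P \<Longrightarrow> q \<in> P \<Longrightarrow> integrable M (\<lambda>\<omega>. X p \<omega> * X q \<omega>)"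
  shows "integrable M (\<lambda>\<omega>. (\<Sum>p\<in>P. X p \<omega>)\<^sup>2)"
    and "(LINT \<omega>|M. (\<Sum>p\<in>P. X p \<omega>)\<^sup>2) = (\<Sum>p\<in>P. \<Sum>q\<in>P. LINT \<omega>|M. X p \<omega> * X q \<omega>)"
  unfolding power2_eq_square sum_product using int by (auto intro!: Bochner_Integration.integrable_sum)

text \<open>Here \<open>rel p\<close> lists the indices that may correlate with p, so at most card P
  * D covariances survive the expansion of the square.\<close>

lemma second_moment_sum_sparse:
  fixes X :: "'p \<Rightarrow> 'a \<Rightarrow> real"
  assumes P: "finite P" and int: "\<And>p q. p \<in> P \<Longrightarrow> q \<in> P \<Longrightarrow> integrable M (\<lambda>\<omega>. X p \<omega> * X q \<omega>)"
    and zero: "\<And>p q. p \<in> P \<Longrightarrow> q \<in> P \<Longrightarrow> q \<notin> rel p \<Longrightarrow> (LINT \<omega>|M. X p \<omega> * X q \<omega>) = 0"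
    and bound: "\<And>p q. p \<in> P \<Longrightarrow> q \<in> P \<Longrightarrow> (LINT \<omega>|M. X p \<omega> * X q \<omega>) \<le> B"
    and card: "\<And>p. p \<in> P \<Longrightarrow> card (rel p \<inter> P) \<le> D" and B: "B \<ge> 0"
  shows "(LINT \<omega>|M. (\<Sum>p\<in>P. X p \<omega>)\<^sup>2) \<le> real (card P) * real D * B"
proof -
  have "(\<Sum>q\<in>P. LINT \<omega>|M. X p \<omega> * X q \<omega>) \<le> real D * B" if p: "p \<in> P" for p
  proof -
    have "(\<Sum>q\<in>P. LINT \<omega>|M. X p \<omega> * X q \<omega>) = (\<Sum>q\<in>rel p \<inter> P. LINT \<omega>|M. X p \<omega> * X q \<omega>)"
      using zero[OF p] P by (intro sum.mono_neutral_right) auto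
    also have "\<dots> \<le> real (card (rel p \<inter> P)) * B"
      using bound[OF p] by (intro sum_bounded_above) auto
    also have "\<dots> \<le> real D * B" using card[OF p] B by (intro mult_right_mono) auto
    finally show ?thesis .
  qed
  then have "(\<Sum>p\<in>P. \<Sum>q\<in>P. LINT \<omega>|M. X p \<omega> * X q \<omega>) \<le> real (card P) * (real D * B)"
    by (intro sum_bounded_above)
  then show ?thesis using second_moment_sum(2)[of P X] int by (simp add: mult.assoc)
qed

text \<open>Only p itself and its mirror image \<open>prod.swap p\<close> correlate with p. Bounding
  the mirror covariance by the mean of the two second moments gives weights 3/2 and 1/2, which add
  up to 2 because the index set is invariant under the swap.\<close>

lemma second_moment_sum_degenerate:
  fixes X :: "'i \<times> 'i \<Rightarrow> 'a \<Rightarrow> real"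
  assumes I: "finite I"
    and int: "\<And>p q. p \<in> I \<times> I \<Longrightarrow> q \<in> I \<times> I \<Longrightarrow> integrable M (\<lambda>\<omega>. X p \<omega> * X q \<omega>)"
    and zero: "\<And>p q. p \<in> I \<times> I \<Longrightarrow> q \<in> I \<times> I \<Longrightarrow> q \<noteq> p \<Longrightarrow> q \<noteq> prod.swap p \<Longrightarrow> (LINT \<omega>|M. X p \<omega> * X q \<omega>) = 0"
  shows "(LINT \<omega>|M. (\<Sum>p\<in>I\<times>I. X p \<omega>)\<^sup>2) \<le> 2 * (\<Sum>p\<in>I\<times>I. LINT \<omega>|M. (X p \<omega>)\<^sup>2)"
proof -
  define e where "e p = (LINT \<omega>|M. (X p \<omega>)\<^sup>2)" for p
  have e0: "e p \<ge> 0" for p by (simp add: e_def)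
  have fin: "finite (I \<times> I)" using I by simp
  have am: "(LINT \<omega>|M. X p \<omega> * X q \<omega>) \<le> (e p + e q) / 2" if "p \<in> I \<times> I" "q \<in> I \<times> I" for p q
  proof -
    have "(LINT \<omega>|M. X p \<omega> * X q \<omega>) \<le> (LINT \<omega>|M. ((X p \<omega>)\<^sup>2 + (X q \<omega>)\<^sup>2) / 2)"
    proof (rule integral_mono)
      show "integrable M (\<lambda>\<omega>. ((X p \<omega>)\<^sup>2 + (X q \<omega>)\<^sup>2) / 2)"
        using int[OF that(1) that(1)] int[OF that(2) that(2)] by (auto simp: power2_eq_square)
      show "X p \<omega> * X q \<omega> \<le> ((X p \<omega>)\<^sup>2 + (X q \<omega>)\<^sup>2) / 2" for \<omega>
        using sum_squares_bound[of "X p \<omega>" "X q \<omega>"] by simp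
    qed (rule int[OF that])
    also have "\<dots> = (e p + e q) / 2"
      using int[OF that(1) that(1)] int[OF that(2) that(2)] by (simp add: e_def power2_eq_square)
    finally show ?thesis .
  qed
  have row: "(\<Sum>q\<in>I\<times>I. LINT \<omega>|M. X p \<omega> * X q \<omega>) \<le> 3 / 2 * e p + e (prod.swap p) / 2" if p: "p \<in> I \<times> I" for p
  proof -
    have sw: "prod.swap p \<in> I \<times> I" using p by auto
    have "(\<Sum>q\<in>I\<times>I. LINT \<omega>|M. X p \<omega> * X q \<omega>) = (\<Sum>q\<in>{p, prod.swap p}. LINT \<omega>|M. X p \<omega> * X q \<omega>)"
      using p sw fin zero[OF p] by (intro sum.mono_neutral_right) auto
    also have "\<dots> \<le> 3 / 2 * e p + e (prod.swap p) / 2"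
    proof (cases "prod.swap p = p")
      case True
      then have "(\<Sum>q\<in>{p, prod.swap p}. LINT \<omega>|M. X p \<omega> * X q \<omega>) = (LINT \<omega>|M. X p \<omega> * X p \<omega>)" by simp
      then show ?thesis using am[OF p p] e0[of p] True by simp
    next
      case False
      then have "(\<Sum>q\<in>{p, prod.swap p}. LINT \<omega>|M. X p \<omega> * X q \<omega>) = (LINT \<omega>|M. X p \<omega> * X p \<omega>) + (LINT \<omega>|M. X p \<omega> * X (prod.swap p) \<omega>)"
        by (subst sum.insert) auto
      then show ?thesis using am[OF p p] am[OF p sw] by simp
    qed
    finally show ?thesis .
  qed
  have "(LINT \<omega>|M. (\<Sum>p\<in>I\<times>I. X p \<omega>)\<^sup>2) = (\<Sum>p\<in>I\<times>I. \<Sum>q\<in>I\<times>I. LINT \<omega>|M. X p \<omega> * X q \<omega>)"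
    by (rule second_moment_sum(2)[OF int])
  also have "\<dots> \<le> (\<Sum>p\<in>I\<times>I. 3 / 2 * e p + e (prod.swap p) / 2)" by (rule sum_mono[OF row])
  also have "\<dots> = 3 / 2 * (\<Sum>p\<in>I\<times>I. e p) + (\<Sum>p\<in>I\<times>I. e (prod.swap p)) / 2"
    by (simp add: sum.distrib sum_distrib_left sum_divide_distrib)
  also have "(\<Sum>p\<in>I\<times>I. e (prod.swap p)) = (\<Sum>p\<in>I\<times>I. e p)"
    by (rule sum.reindex_bij_witness[of _ prod.swap prod.swap]) auto
  finally show ?thesis by (simp add: e_def)
qed

end

text \<open>The term - 1/n makes the induction close, since 1/(n+1)^2 is at most 1/n -
  1/(n+1).\<close>

lemma sum_inverse_squares_le:
  assumes "1 \<le> L" "L \<le> n"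
  shows "(\<Sum>l=L..n. 1 / (real l)\<^sup>2) \<le> 2 / real L - 1 / real n"
  using assms(2)
proof (induction n rule: dec_induct)
  case base
  have "1 / (real L)\<^sup>2 \<le> 1 / real L" using assms by (simp add: power2_eq_square divide_simps)
  then show ?case by simp
next
  case (step n)
  have n: "real n \<ge> 1" using assms step by simp
  have "1 / (real (Suc n))\<^sup>2 \<le> 1 / (real n * real (Suc n))"
    using n by (intro divide_left_mono) (auto simp: power2_eq_square)
  also have "\<dots> = 1 / real n - 1 / real (Suc n)" using n by (simp add: field_simps)
  finally show ?case using step by (simp add: sum.nat_ivl_Suc')
qed

context prob_space
begin

text \<open>A second-moment bound that grows only linearly suffices along the squares; monotonicity of the
  partial sums fills the gaps between consecutive squares.\<close>
lemma monotone_partial_sums_tail: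
  fixes S :: "nat \<Rightarrow> 'a \<Rightarrow> real"
  assumes meas [measurable]: "\<And>m. random_variable borel (S m)"
    and mono: "\<And>m m' \<omega>. m \<le> m' \<Longrightarrow> S m \<omega> \<le> S m' \<omega>"
    and int: "\<And>m. 1 \<le> m \<Longrightarrow> m < n \<Longrightarrow> integrable M (\<lambda>\<omega>. (S m \<omega> - real m)\<^sup>2)"
    and var: "\<And>m. 1 \<le> m \<Longrightarrow> m < n \<Longrightarrow> (LINT \<omega>|M. (S m \<omega> - real m)\<^sup>2) \<le> C * real m"
    and C: "C \<ge> 0" and s: "s > 1" and L: "L \<ge> 1"
    and ratio: "\<And>l. l \<ge> L \<Longrightarrow> real ((l + 1)\<^sup>2) \<le> (1 + s) / 2 * real (l\<^sup>2)"
  shows "prob {\<omega>\<in>space M. \<exists>m. L\<^sup>2 \<le> m \<and> m < n \<and> s * real m \<le> S m \<omega>} \<le> 32 * C / ((s - 1)\<^sup>2 * real L)"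
proof (cases "n \<ge> 2 \<and> L \<le> n")
  case False
  have "{\<omega>\<in>space M. \<exists>m. L\<^sup>2 \<le> m \<and> m < n \<and> s * real m \<le> S m \<omega>} = {}"
  proof -
    have False if "L\<^sup>2 \<le> m" "m < n" for m
    proof -
      have "1 \<le> L\<^sup>2" "L \<le> L\<^sup>2" using L by (auto simp: power2_eq_square)
      with that have "2 \<le> n" "L \<le> n" by linarith+
      with False show False by simp
    qed
    then show ?thesis by auto
  qed
  then show ?thesis using C L by (simp only: measure_empty) simp
next
  case True
  \<comment> \<open>The square following l^2, capped at n - 1 because moments are controlled only
    below n.\<close>
  define k where "k l = min ((l + 1)\<^sup>2) (n - 1)" for l
  \<comment> \<open>An exceedance at some m between l^2 and (l + 1)^2 gives S (k l) \<ge> s l^2,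
    while k l \<le> (1 + s) / 2 * l^2; the threshold is the difference.\<close>
  define E where "E l = {\<omega>\<in>space M. (s - 1) / 2 * real (l\<^sup>2) \<le> \<bar>S (k l) \<omega> - real (k l)\<bar>}" for l
  have E [measurable]: "E l \<in> events" for l unfolding E_def by measurable
  have "{\<omega>\<in>space M. \<exists>m. L\<^sup>2 \<le> m \<and> m < n \<and> s * real m \<le> S m \<omega>} \<subseteq> (\<Union>l\<in>{L..n}. E l)"
  proof safe
    fix \<omega> m assume \<omega>: "\<omega> \<in> space M" and m: "L\<^sup>2 \<le> m" "m < n" "s * real m \<le> S m \<omega>"
    define l where "l = floor_sqrt m"
    have l: "l\<^sup>2 \<le> m" "m < (l + 1)\<^sup>2" unfolding l_def
      using Suc_floor_sqrt_power2_gt[of m] by auto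
    have "L \<le> l"
    proof (rule ccontr)
      assume "\<not> L \<le> l"
      then have "(l + 1)\<^sup>2 \<le> L\<^sup>2" by (intro power_mono) auto
      with m l show False by linarith
    qed
    have "l \<le> l\<^sup>2" by (simp add: power2_eq_square)
    with l m have "l \<le> n" by linarith
    have "m \<le> k l" using l m by (simp add: k_def)
    have "real (k l) \<le> (1 + s) / 2 * real (l\<^sup>2)"
    proof -
      have "real (k l) \<le> real ((l + 1)\<^sup>2)" unfolding k_def by (intro of_nat_mono) simp
      also note ratio[OF \<open>L \<le> l\<close>]
      finally show ?thesis .
    qed
    moreover have "s * real (l\<^sup>2) \<le> s * real m" using l s by (intro mult_left_mono) (auto simp del: of_nat_power)
    moreover have "S m \<omega> \<le> S (k l) \<omega>" using mono[OF \<open>m \<le> k l\<close>] .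
    ultimately have "(s - 1) / 2 * real (l\<^sup>2) \<le> S (k l) \<omega> - real (k l)" using m(3)
      by (simp add: algebra_simps diff_divide_distrib add_divide_distrib)
    then have "\<omega> \<in> E l" using \<omega> order_trans[OF _ abs_ge_self] unfolding E_def by blast
    then show "\<omega> \<in> (\<Union>l\<in>{L..n}. E l)" using \<open>L \<le> l\<close> \<open>l \<le> n\<close> by auto
  qed
  then have "prob {\<omega>\<in>space M. \<exists>m. L\<^sup>2 \<le> m \<and> m < n \<and> s * real m \<le> S m \<omega>} \<le> prob (\<Union>l\<in>{L..n}. E l)"
    by (intro finite_measure_mono) auto
  also have "\<dots> \<le> (\<Sum>l=L..n. prob (E l))" by (intro finite_measure_subadditive_finite) auto
  \<comment> \<open>Chebyshev: a second moment of order l^2 against a squared deviation of order l^4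
    leaves 1 / l^2, whose sum from L on is O(1 / L).\<close>
  also have "\<dots> \<le> (\<Sum>l=L..n. 16 * C / (s - 1)\<^sup>2 * (1 / (real l)\<^sup>2))"
  proof (rule sum_mono)
    fix l assume l: "l \<in> {L..n}"
    then have l1: "l \<ge> 1" using L by simp
    have k: "1 \<le> k l" "k l < n" using True by (auto simp: k_def)
    have "prob (E l) \<le> (LINT \<omega>|M. (S (k l) \<omega> - real (k l))\<^sup>2) / ((s - 1) / 2 * real (l\<^sup>2))\<^sup>2"
      unfolding E_def using int[OF k] s l1 by (intro second_moment_method) auto
    also have "\<dots> \<le> C * real (k l) / ((s - 1) / 2 * real (l\<^sup>2))\<^sup>2"
      using var[OF k] by (intro divide_right_mono) auto
    also have "\<dots> \<le> C * (4 * (real l)\<^sup>2) / ((s - 1) / 2 * real (l\<^sup>2))\<^sup>2"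
    proof -
      have "k l \<le> (l + 1)\<^sup>2" by (simp add: k_def)
      also have "\<dots> \<le> (2 * l)\<^sup>2" using l1 by (intro power_mono) auto
      finally have "real (k l) \<le> real ((2 * l)\<^sup>2)" by (rule of_nat_mono)
      then show ?thesis using C by (intro divide_right_mono mult_left_mono) (auto simp: power_mult_distrib)
    qed
    also have "\<dots> = 16 * C / (s - 1)\<^sup>2 * (1 / (real l)\<^sup>2)"
    proof -
      have "C * (4 * x\<^sup>2) / (d / 2 * x\<^sup>2)\<^sup>2 = 16 * C / d\<^sup>2 * (1 / x\<^sup>2)" if "x > 0" "d > 0" for x d :: real
        using that by (simp add: field_simps power2_eq_square)
      from this[of "real l" "s - 1"] show ?thesis using l1 s by simp
    qed
    finally show "prob (E l) \<le> 16 * C / (s - 1)\<^sup>2 * (1 / (real l)\<^sup>2)" .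
  qed
  also have "\<dots> = 16 * C / (s - 1)\<^sup>2 * (\<Sum>l=L..n. 1 / (real l)\<^sup>2)" by (simp add: sum_distrib_left)
  also have "\<dots> \<le> 16 * C / (s - 1)\<^sup>2 * (2 / real L)"
  proof (rule mult_left_mono)
    have "(\<Sum>l=L..n. 1 / (real l)\<^sup>2) \<le> 2 / real L - 1 / real n"
      by (rule sum_inverse_squares_le) (use L True in auto)
    moreover have "1 / real n \<ge> 0" by simp
    ultimately show "(\<Sum>l=L..n. 1 / (real l)\<^sup>2) \<le> 2 / real L" by linarith
  qed (use C in auto)
  finally show ?thesis by (simp add: mult.commute)
qed

end

section \<open>Independent errors\<close>

text \<open>Without atoms \<open>C\<close> is continuous, and C (I u) = u for the quantile transform
  \<open>I\<close> on (0, 1). Since \<open>I\<close> of a uniform variable has law \<open>M\<close>,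
  the value of \<open>C\<close> at a draw from \<open>M\<close> is uniform, and these are the
  uniform moments.\<close>

lemma (in cdf_distribution) integral_cdf_power:
  assumes "\<And>x. measure M {x} = 0"
  shows "(LINT x|M. C x ^ k) = 1 / real (Suc k)"
proof -
  let ?\<Omega> = "restrict_space lborel {0<..<1} :: real measure"
  have CI: "C (I \<omega>) = \<omega>" if "\<omega> \<in> {0<..<1}" for \<omega>
  proof (rule antisym)
    show "\<omega> \<le> C (I \<omega>)" using pseudoinverse[of \<omega> "I \<omega>"] that by simp
    \<comment> \<open>To the left of I \<omega> the values of C are at most \<omega>; continuity
      carries this bound to I \<omega> itself.\<close>
    have "isCont C (I \<omega>)" using isCont_cdf assms by blast
    then have lim: "(C \<longlongrightarrow> C (I \<omega>)) (at_left (I \<omega>))"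
      by (simp add: isCont_def filterlim_at_split)
    show "C (I \<omega>) \<le> \<omega>"
    proof (rule tendsto_upperbound[OF lim])
      show "\<forall>\<^sub>F x in at_left (I \<omega>). C x \<le> \<omega>"
        unfolding eventually_at_filter
      proof (intro always_eventually allI impI)
        fix x assume "x \<in> {..<I \<omega>}"
        then have "\<not> \<omega> \<le> C x" using pseudoinverse[of \<omega> x] that by auto
        then show "C x \<le> \<omega>" by simp
      qed
    qed simp
  qed
  have "(LINT x|M. C x ^ k) = (LINT x|distr ?\<Omega> borel I. C x ^ k)" by (simp only: distr_I_eq_M)
  also have "\<dots> = (LINT \<omega>|?\<Omega>. C (I \<omega>) ^ k)"
    by (subst integral_distr) auto
  also have "\<dots> = (LINT \<omega>|?\<Omega>. \<omega> ^ k)"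
    by (intro Bochner_Integration.integral_cong refl) (simp add: CI space_restrict_space)
  also have "\<dots> = (LINT x|lborel. x ^ k * indicator {0..1} x)"
  proof -
    have "(LINT \<omega>|?\<Omega>. \<omega> ^ k) = (LINT x|lborel. indicator {0<..<1} x *\<^sub>R x ^ k)"
      by (subst integral_restrict_space) (auto simp: set_lebesgue_integral_def)
    also have "\<dots> = (LINT x|lborel. x ^ k * indicator {0..1} x)"
    proof (rule integral_cong_AE)
      show "AE x in lborel. indicator {0<..<1} x *\<^sub>R x ^ k = x ^ k * indicator {0..1::real} x"
        using AE_lborel_singleton[of 0] AE_lborel_singleton[of 1]
        by eventually_elim (auto simp: indicator_def)
    qed auto
    finally show ?thesis .
  qed
  also have "\<dots> = 1 / real (Suc k)" by (subst integral_power) auto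
  finally show ?thesis .
qed

locale rank_sample = prob_space M for M :: "'a measure" +
  fixes eps :: "nat \<Rightarrow> 'a \<Rightarrow> real" and f :: "real \<Rightarrow> real"
  assumes eps_indep: "indep_vars (\<lambda>_. borel) eps UNIV"
    and eps_dens: "\<And>i. distributed M lborel (eps i) (\<lambda>x. ennreal (f x))"
begin

lemma eps_measurable [measurable]: "random_variable borel (eps i)"
  using eps_indep by (auto simp: indep_vars_def)

definition law :: "real measure" where "law = distr M borel (eps 0)"

definition F :: "real \<Rightarrow> real" where "F = cdf law"

lemma eps_law: "distr M borel (eps i) = law"
proof -
  have "distr M borel (eps j) = density lborel (\<lambda>x. ennreal (f x))" for j
    using distributed_distr_eq_density[OF eps_dens[of j]] by (metis distr_cong sets_lborel)
  then show ?thesis by (simp add: law_def)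
qed

sublocale law: cdf_distribution law
  unfolding law_def cdf_distribution_def by simp

lemma law_no_atoms: "measure law {x} = 0"
proof -
  have "(\<lambda>x. ennreal (f x)) \<in> borel_measurable lborel"
    using distributed_borel_measurable[OF eps_dens[of 0]] .
  moreover have "law = density lborel (\<lambda>x. ennreal (f x))"
    using distributed_distr_eq_density[OF eps_dens[of 0]] unfolding law_def by (metis distr_cong sets_lborel)
  ultimately have "emeasure law {x} = (\<integral>\<^sup>+y. ennreal (f y) * indicator {x} y \<partial>lborel)"
    by (simp add: emeasure_density)
  also have "\<dots> = 0"
    by (intro nn_integral_null_set finite_imp_null_set_lborel) auto
  finally show ?thesis by (simp add: measure_def)
qed

lemma F_measurable [measurable]: "F \<in> borel_measurable borel"
  unfolding F_def by (rule law.measurable_C)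

lemma F_bounds: "0 \<le> F x" "F x \<le> 1"
  unfolding F_def by (auto simp: cdf_def)

lemma expectation_eps: "g \<in> borel_measurable borel \<Longrightarrow> (LINT \<omega>|M. g (eps i \<omega>)) = (LINT x|law. g x)"
  for g :: "real \<Rightarrow> 'b::{banach, second_countable_topology}"
  using integral_distr[of "eps i" M borel g] by (simp add: eps_law)

lemma expectation_eps_le: "(LINT \<omega>|M. of_bool (eps i \<omega> \<le> x)) = F x"
proof -
  have "(\<lambda>y. of_bool (y \<le> x)) = (indicator {..x} :: real \<Rightarrow> real)" by (auto simp: fun_eq_iff)
  then show ?thesis
    using expectation_eps[of "indicator {..x} :: real \<Rightarrow> real" i] by (simp add: fun_eq_iff F_def cdf_def)
qed

lemma expectation_eps_ge: "(LINT \<omega>|M. of_bool (x \<le> eps i \<omega>)) = 1 - F x"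
proof -
  have "(LINT \<omega>|M. of_bool (x \<le> eps i \<omega>)) = (LINT y|law. indicator {x..} y :: real)"
  proof -
    have "(\<lambda>y. of_bool (x \<le> y)) = (indicator {x..} :: real \<Rightarrow> real)" by (auto simp: fun_eq_iff)
    then show ?thesis
      using expectation_eps[of "indicator {x..} :: real \<Rightarrow> real" i] by (simp add: fun_eq_iff)
  qed
  also have "\<dots> = measure law {x..}" by simp
  also have "{x..} = {x} \<union> (space law - {..x})" by auto
  also have "measure law \<dots> = measure law {x} + measure law (space law - {..x})"
    by (subst law.finite_measure_Union) auto
  also have "\<dots> = 1 - F x"
    by (subst law.prob_compl) (auto simp: law_no_atoms F_def cdf_def)
  finally show ?thesis .
qed

definition \<zeta> :: "nat \<Rightarrow> 'a \<Rightarrow> real" where "\<zeta> i \<omega> = F (eps i \<omega>) - 1 / 2"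

lemma \<zeta>_measurable [measurable]: "random_variable borel (\<zeta> i)"
  unfolding \<zeta>_def by measurable

lemma \<zeta>_bound: "\<bar>\<zeta> i \<omega>\<bar> \<le> 1 / 2"
  using F_bounds[of "eps i \<omega>"] unfolding \<zeta>_def by linarith

lemma integrable_bounded [intro]:
  fixes g :: "'a \<Rightarrow> real"
  assumes "random_variable borel g" "\<And>\<omega>. \<bar>g \<omega>\<bar> \<le> B"
  shows "integrable M g"
  by (rule integrable_const_bound[of _ B]) (use assms in auto)

lemma integrable_F: "integrable M (\<lambda>\<omega>. F (eps i \<omega>))" "integrable M (\<lambda>\<omega>. (F (eps i \<omega>))\<^sup>2)"
  by (rule integrable_bounded[of _ 1]; use F_bounds in \<open>auto simp: abs_le_iff power_le_one\<close>)+

lemma expectation_F: "(LINT \<omega>|M. F (eps i \<omega>)) = 1 / 2" "(LINT \<omega>|M. (F (eps i \<omega>))\<^sup>2) = 1 / 3"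
  using law.integral_cdf_power[of 1] law.integral_cdf_power[of 2] law_no_atoms
  by (simp_all add: expectation_eps[of F] expectation_eps[of "\<lambda>x. (F x)\<^sup>2"] F_def[symmetric])

lemma expectation_\<zeta>: "(LINT \<omega>|M. \<zeta> i \<omega>) = 0" "(LINT \<omega>|M. (\<zeta> i \<omega>)\<^sup>2) = 1 / 12"
proof -
  show "(LINT \<omega>|M. \<zeta> i \<omega>) = 0"
    unfolding \<zeta>_def using integrable_F expectation_F by (simp add: prob_space)
  have "(LINT \<omega>|M. (\<zeta> i \<omega>)\<^sup>2) = (LINT \<omega>|M. (F (eps i \<omega>))\<^sup>2 - F (eps i \<omega>) + 1 / 4)"
    by (intro Bochner_Integration.integral_cong) (auto simp: \<zeta>_def power2_diff power2_eq_square field_simps)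
  then show "(LINT \<omega>|M. (\<zeta> i \<omega>)\<^sup>2) = 1 / 12"
    using integrable_F[of i] expectation_F[of i] by (simp add: prob_space)
qed

text \<open>Degenerate means that each kernel has mean zero in either argument, the other being held fixed;
  then distinct unordered index pairs are orthogonal.\<close>
lemma degenerate_double_sum_second_moment:
  fixes g :: "nat \<times> nat \<Rightarrow> real \<Rightarrow> real \<Rightarrow> real"
  assumes I: "finite I"
    and meas: "\<And>p. (\<lambda>(x, y). g p x y) \<in> borel_measurable (borel \<Otimes>\<^sub>M borel)"
    and bd: "\<And>p x y. \<bar>g p x y\<bar> \<le> B p"
    and diag: "\<And>i. (LINT \<omega>|M. g (i, i) (eps i \<omega>) (eps i \<omega>)) = 0"
    and left: "\<And>i k y. i \<noteq> k \<Longrightarrow> (LINT \<omega>|M. g (i, k) (eps i \<omega>) y) = 0"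
    and right: "\<And>i k x. i \<noteq> k \<Longrightarrow> (LINT \<omega>|M. g (i, k) x (eps k \<omega>)) = 0"
  shows "(LINT \<omega>|M. (\<Sum>p\<in>I\<times>I. g p (eps (fst p) \<omega>) (eps (snd p) \<omega>))\<^sup>2) \<le> 2 * (\<Sum>p\<in>I\<times>I. (B p)\<^sup>2)"
proof -
  define X where "X p \<omega> = g p (eps (fst p) \<omega>) (eps (snd p) \<omega>)" for p \<omega>
  have X [measurable]: "random_variable borel (X p)" for p
    using measurable_compose[OF measurable_Pair[OF eps_measurable[of "fst p"] eps_measurable[of "snd p"]] meas[of p]]
    by (simp add: X_def[abs_def])
  have Xb: "\<bar>X p \<omega>\<bar> \<le> B p" for p \<omega> unfolding X_def by (rule bd)
  have B0: "B p \<ge> 0" for p using bd[of p 0 0] by linarith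
  have int: "integrable M (\<lambda>\<omega>. X p \<omega> * X q \<omega>)" for p q
    by (rule integrable_bounded[of _ "B p * B q"]) (auto simp: abs_mult intro!: mult_mono Xb B0)
  \<comment> \<open>Freeze every error except eps r. Since r occurs in p but not in q, the factor of
    q is constant and the factor of p integrates to zero.\<close>
  have zero: "(LINT \<omega>|M. X p \<omega> * X q \<omega>) = 0" if r: "r = fst p \<or> r = snd p" "r \<noteq> fst q" "r \<noteq> snd q" for p q r
  proof -
    obtain i k where p: "p = (i, k)" by (cases p)
    obtain i' k' where q: "q = (i', k')" by (cases q)
    define J where "J = {i, k, i', k'} - {r}"
    define a where "a s x v = (if s = r then x else v s)" for s x and v :: "nat \<Rightarrow> real"
    define \<phi> where "\<phi> x v = g p (a i x v) (a k x v) * g q (v i') (v k')" for x v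
    have qJ: "i' \<in> J" "k' \<in> J" using r by (auto simp: J_def q)
    have "(LINT \<omega>|M. \<phi> (eps r \<omega>) (restrict (\<lambda>i. eps i \<omega>) J)) = 0"
    proof (rule indep_vars_integral_eq_0[OF eps_indep, where B = "B p * B q"])
      show "r \<notin> J" by (simp add: J_def)
      show "\<bar>\<phi> x v\<bar> \<le> B p * B q" for x v
        unfolding \<phi>_def abs_mult by (intro mult_mono bd abs_ge_zero B0)
      have am: "(\<lambda>z. a s (fst z) (snd z)) \<in> borel_measurable (borel \<Otimes>\<^sub>M PiM J (\<lambda>_. borel))" if "s \<in> {i, k}" for s
      proof (cases "s = r")
        case False
        then have "s \<in> J" using that by (auto simp: J_def)
        then have "(\<lambda>z. snd z s) \<in> borel_measurable (borel \<Otimes>\<^sub>M PiM J (\<lambda>_. borel))"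
          by (intro measurable_compose[OF measurable_snd measurable_component_singleton])
        then show ?thesis using False by (simp add: a_def)
      qed (simp add: a_def)
      have vm: "(\<lambda>z. snd z s) \<in> borel_measurable (borel \<Otimes>\<^sub>M PiM J (\<lambda>_. borel))" if "s \<in> J" for s
        using that by (intro measurable_compose[OF measurable_snd measurable_component_singleton])
      have "(\<lambda>z. g p (a i (fst z) (snd z)) (a k (fst z) (snd z)) * g q (snd z i') (snd z k')) \<in> borel_measurable (borel \<Otimes>\<^sub>M PiM J (\<lambda>_. borel))"
        using measurable_compose[OF measurable_Pair[OF am[of i] am[of k]] meas[of p]]
          measurable_compose[OF measurable_Pair[OF vm[OF qJ(1)] vm[OF qJ(2)]] meas[of q]]
        by (intro borel_measurable_times) auto
      then show "(\<lambda>(x, v). \<phi> x v) \<in> borel_measurable (borel \<Otimes>\<^sub>M PiM J (\<lambda>_. borel))"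
        by (simp add: \<phi>_def split_beta)
      show "(LINT \<omega>|M. \<phi> (eps r \<omega>) v) = 0" for v
      proof -
        have "(LINT \<omega>|M. g p (a i (eps r \<omega>) v) (a k (eps r \<omega>) v)) = 0"
        proof (cases "i = k")
          case True
          then have "r = i" using r p by auto
          then show ?thesis using diag[of i] True by (simp add: p a_def)
        next
          case False
          then show ?thesis using r p left[OF False] right[OF False] by (auto simp: a_def)
        qed
        then show ?thesis by (simp add: \<phi>_def)
      qed
    qed
    moreover have "\<phi> (eps r \<omega>) (restrict (\<lambda>i. eps i \<omega>) J) = X p \<omega> * X q \<omega>" for \<omega>
    proof -
      have "a s (eps r \<omega>) (restrict (\<lambda>i. eps i \<omega>) J) = eps s \<omega>" if "s \<in> {i, k}" for s
        using that by (auto simp: a_def J_def)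
      then show ?thesis using qJ by (simp add: \<phi>_def X_def p q)
    qed
    ultimately show ?thesis by simp
  qed
  have "(LINT \<omega>|M. (\<Sum>p\<in>I\<times>I. X p \<omega>)\<^sup>2) \<le> 2 * (\<Sum>p\<in>I\<times>I. LINT \<omega>|M. (X p \<omega>)\<^sup>2)"
  proof (rule second_moment_sum_degenerate[OF I int])
    fix p q :: "nat \<times> nat" assume ne: "q \<noteq> p" "q \<noteq> prod.swap p"
    \<comment> \<open>Different index sets leave an index that belongs to only one of the two
      pairs.\<close>
    then have "{fst p, snd p} \<noteq> {fst q, snd q}"
      by (cases p; cases q) (auto simp: doubleton_eq_iff)
    then consider r where "r \<in> {fst p, snd p}" "r \<notin> {fst q, snd q}" | r where "r \<in> {fst q, snd q}" "r \<notin> {fst p, snd p}"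
      by blast
    then show "(LINT \<omega>|M. X p \<omega> * X q \<omega>) = 0"
    proof cases
      case 1
      then show ?thesis using zero[of r p q] by auto
    next
      case 2
      then have "(LINT \<omega>|M. X q \<omega> * X p \<omega>) = 0" using zero[of r q p] by auto
      then show ?thesis by (simp only: mult.commute)
    qed
  qed
  also have "\<dots> \<le> 2 * (\<Sum>p\<in>I\<times>I. (B p)\<^sup>2)"
  proof (intro mult_left_mono sum_mono)
    fix p
    have "(LINT \<omega>|M. (X p \<omega>)\<^sup>2) \<le> (LINT \<omega>|M. (B p)\<^sup>2)"
    proof (rule integral_mono)
      show "integrable M (\<lambda>\<omega>. (X p \<omega>)\<^sup>2)" using int[of p p] by (simp add: power2_eq_square)
      show "(X p \<omega>)\<^sup>2 \<le> (B p)\<^sup>2" for \<omega> using Xb[of p \<omega>] by (simp add: abs_le_square_iff[symmetric] B0)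
    qed simp
    then show "(LINT \<omega>|M. (X p \<omega>)\<^sup>2) \<le> (B p)\<^sup>2" by (simp add: prob_space)
  qed simp
  finally show ?thesis by (simp add: X_def)
qed

end

section \<open>Second moments of the cosine sums and of the degenerate rank kernel\<close>

context rank_sample
begin

text \<open>The factor 24 = 12 * 2 gives unit variance for 1 \<le> j < n: each
  \<open>\<zeta>\<close> has variance 1/12, and the squared cosines sum to n/2.\<close>

definition V :: "nat \<Rightarrow> nat \<Rightarrow> 'a \<Rightarrow> real" where
  "V n j \<omega> = sqrt (24 / real n) * (\<Sum>i=1..n. \<zeta> i \<omega> * cos (pi * real j * xpt n i))"

lemma V_measurable [measurable]: "random_variable borel (V n j)"
  unfolding V_def by measurable

lemma V_bound: "\<bar>V n j \<omega>\<bar> \<le> sqrt (6 * real n)"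
proof (cases "n = 0")
  case False
  have "\<bar>\<Sum>i=1..n. \<zeta> i \<omega> * cos (pi * real j * xpt n i)\<bar> \<le> (\<Sum>i=1..n. 1 / 2 * 1)"
  proof (intro order_trans[OF sum_abs] sum_mono)
    show "\<bar>\<zeta> i \<omega> * cos (pi * real j * xpt n i)\<bar> \<le> 1 / 2 * 1" for i
      unfolding abs_mult by (intro mult_mono \<zeta>_bound abs_cos_le_one) auto
  qed
  then have "\<bar>\<Sum>i=1..n. \<zeta> i \<omega> * cos (pi * real j * xpt n i)\<bar> \<le> real n / 2" by simp
  then have "\<bar>V n j \<omega>\<bar> \<le> sqrt (24 / real n) * (real n / 2)"
    unfolding V_def abs_mult by (intro mult_mono) auto
  also have "\<dots> = sqrt (6 * real n)"
  proof (rule power2_eq_imp_eq)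
    show "(sqrt (24 / real n) * (real n / 2))\<^sup>2 = (sqrt (6 * real n))\<^sup>2"
    proof -
      have "(sqrt (24 / real n))\<^sup>2 = 24 / real n" "(sqrt (6 * real n))\<^sup>2 = 6 * real n"
        by (rule real_sqrt_pow2; simp)+
      then show ?thesis using False by (simp only: power_mult_distrib) (simp add: power2_eq_square)
    qed
  qed auto
  finally show ?thesis .
qed (simp add: V_def)

lemma V_square_bound: "(V n j \<omega>)\<^sup>2 \<le> 6 * real n"
  using power_mono[OF V_bound abs_ge_zero, of n j \<omega> 2] by simp

lemma integrable_V_sums: "integrable M (\<lambda>\<omega>. ((\<Sum>j=1..m. (V n j \<omega>)\<^sup>2) - real m)\<^sup>2)"
proof (rule integrable_bounded)
  fix \<omega>
  have "\<bar>(\<Sum>j=1..m. (V n j \<omega>)\<^sup>2) - real m\<bar> \<le> \<bar>\<Sum>j=1..m. (V n j \<omega>)\<^sup>2\<bar> + \<bar>real m\<bar>" by (rule abs_triangle_ineq4)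
  also have "\<bar>\<Sum>j=1..m. (V n j \<omega>)\<^sup>2\<bar> = (\<Sum>j=1..m. (V n j \<omega>)\<^sup>2)" by (simp add: sum_nonneg)
  also have "\<dots> \<le> (\<Sum>j=1..m. 6 * real n)" by (intro sum_mono V_square_bound)
  finally have "\<bar>(\<Sum>j=1..m. (V n j \<omega>)\<^sup>2) - real m\<bar> \<le> (\<Sum>j=1..m. 6 * real n) + real m" by simp
  from power_mono[OF this abs_ge_zero, of 2]
  show "\<bar>((\<Sum>j=1..m. (V n j \<omega>)\<^sup>2) - real m)\<^sup>2\<bar> \<le> ((\<Sum>j=1..m. 6 * real n) + real m)\<^sup>2"
    by simp
qed measurable

text \<open>As a matrix, A is 12 times the orthogonal projection onto the first m cosine vectors.
  Its trace is therefore 12 m, which the factor 1/12 turns into the mean m, and its squared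
  Frobenius norm is 144 m; the bound for degenerate double sums doubles the latter.\<close>

lemma V_sums_second_moment:
  assumes "1 \<le> m" "m < n"
  shows "(LINT \<omega>|M. ((\<Sum>j=1..m. (V n j \<omega>)\<^sup>2) - real m)\<^sup>2) \<le> 288 * real m"
proof -
  define c where "c j i = cos (pi * real j * xpt n i)" for j i
  define A where "A p = 24 / real n * (\<Sum>j=1..m. c j (fst p) * c j (snd p))" for p
  \<comment> \<open>Subtracting the variance 1/12 on the diagonal centres the diagonal kernels as
    well.\<close>
  define g where "g p x y = A p * ((F x - 1/2) * (F y - 1/2) - (if fst p = snd p then 1/12 else 0))" for p x y
  define I where "I = {1..n}"
  have n: "real n > 0" using assms by simp
  have orth: "(\<Sum>i\<in>I. c j i * c l i) = (if j = l then real n / 2 else 0)" if "j \<in> {1..m}" "l \<in> {1..m}" for j l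
    unfolding c_def I_def using that assms by (intro cos_midpoints_orthogonal) auto
  have trace: "(\<Sum>i\<in>I. A (i, i)) = 12 * real m"
  proof -
    have "(\<Sum>i\<in>I. A (i, i)) = 24 / real n * (\<Sum>j=1..m. \<Sum>i\<in>I. c j i * c j i)"
      unfolding A_def fst_conv snd_conv sum_distrib_left[symmetric] by (subst sum.swap) (rule refl)
    also have "\<dots> = 24 / real n * (\<Sum>j=1..m. real n / 2)" by (simp add: orth)
    finally show ?thesis using n by simp
  qed
  have frob: "(\<Sum>p\<in>I\<times>I. (A p)\<^sup>2) = 144 * real m"
  proof -
    have "(\<Sum>p\<in>I\<times>I. (A p)\<^sup>2) = (24 / real n)\<^sup>2 * (\<Sum>p\<in>I\<times>I. \<Sum>j=1..m. \<Sum>l=1..m. (c j (fst p) * c l (fst p)) * (c j (snd p) * c l (snd p)))"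
      unfolding sum_distrib_left[of _ _ "I \<times> I"]
    proof (intro sum.cong refl)
      fix p
      have "(\<Sum>j=1..m. c j (fst p) * c j (snd p))\<^sup>2 = (\<Sum>j=1..m. \<Sum>l=1..m. (c j (fst p) * c l (fst p)) * (c j (snd p) * c l (snd p)))"
        unfolding power2_eq_square sum_product by (intro sum.cong refl) (simp only: mult_ac)
      then show "(A p)\<^sup>2 = (24 / real n)\<^sup>2 * (\<Sum>j=1..m. \<Sum>l=1..m. (c j (fst p) * c l (fst p)) * (c j (snd p) * c l (snd p)))"
        by (simp only: A_def power_mult_distrib)
    qed
    also have "(\<Sum>p\<in>I\<times>I. \<Sum>j=1..m. \<Sum>l=1..m. (c j (fst p) * c l (fst p)) * (c j (snd p) * c l (snd p)))
       = (\<Sum>j=1..m. \<Sum>l=1..m. \<Sum>p\<in>I\<times>I. (c j (fst p) * c l (fst p)) * (c j (snd p) * c l (snd p)))"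
      by (subst sum.swap) (intro sum.cong refl sum.swap)
    also have "\<dots> = (\<Sum>j=1..m. \<Sum>l=1..m. (\<Sum>i\<in>I. c j i * c l i) * (\<Sum>k\<in>I. c j k * c l k))"
      by (simp only: sum_product) (simp add: sum.cartesian_product split_beta)
    also have "\<dots> = (\<Sum>j=1..m. \<Sum>l=1..m. (if j = l then (real n / 2)\<^sup>2 else 0))"
      by (intro sum.cong refl) (simp add: orth power2_eq_square)
    also have "\<dots> = real m * (real n / 2)\<^sup>2" by simp
    finally show ?thesis using n by (simp add: power2_eq_square)
  qed
  have eq: "(\<Sum>p\<in>I\<times>I. g p (eps (fst p) \<omega>) (eps (snd p) \<omega>)) = (\<Sum>j=1..m. (V n j \<omega>)\<^sup>2) - real m" for \<omega>
  proof -
    have "(\<Sum>p\<in>I\<times>I. g p (eps (fst p) \<omega>) (eps (snd p) \<omega>))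
        = (\<Sum>p\<in>I\<times>I. A p * (\<zeta> (fst p) \<omega> * \<zeta> (snd p) \<omega>)) - (\<Sum>p\<in>I\<times>I. if fst p = snd p then A p / 12 else 0)"
      unfolding sum_subtractf[symmetric] by (intro sum.cong refl) (simp add: g_def \<zeta>_def algebra_simps)
    also have "(\<Sum>p\<in>I\<times>I. if fst p = snd p then A p / 12 else 0) = (\<Sum>i\<in>I. \<Sum>k\<in>I. if i = k then A (i, k) / 12 else 0)"
      unfolding sum.cartesian_product by (intro sum.cong refl) auto
    also have "\<dots> = (\<Sum>i\<in>I. A (i, i)) / 12" by (simp add: I_def sum_divide_distrib)
    also have "\<dots> = real m" using trace by simp
    also have "(\<Sum>p\<in>I\<times>I. A p * (\<zeta> (fst p) \<omega> * \<zeta> (snd p) \<omega>)) = 24 / real n * (\<Sum>p\<in>I\<times>I. \<Sum>j=1..m. (\<zeta> (fst p) \<omega> * c j (fst p)) * (\<zeta> (snd p) \<omega> * c j (snd p)))"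
      unfolding A_def by (simp add: sum_distrib_left sum_distrib_right algebra_simps)
    also have "(\<Sum>p\<in>I\<times>I. \<Sum>j=1..m. (\<zeta> (fst p) \<omega> * c j (fst p)) * (\<zeta> (snd p) \<omega> * c j (snd p)))
       = (\<Sum>j=1..m. \<Sum>p\<in>I\<times>I. (\<zeta> (fst p) \<omega> * c j (fst p)) * (\<zeta> (snd p) \<omega> * c j (snd p)))" by (rule sum.swap)
    also have "\<dots> = (\<Sum>j=1..m. (\<Sum>i\<in>I. \<zeta> i \<omega> * c j i) * (\<Sum>k\<in>I. \<zeta> k \<omega> * c j k))"
      by (simp only: sum_product) (simp add: sum.cartesian_product split_beta)
    also have "24 / real n * \<dots> = (\<Sum>j=1..m. (V n j \<omega>)\<^sup>2)"
    proof -
      have "(sqrt (24 / real n))\<^sup>2 = 24 / real n" by (rule real_sqrt_pow2) simp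
      then show ?thesis
        unfolding V_def c_def I_def power_mult_distrib sum_distrib_left[of "24 / real n"] by (simp only: power2_eq_square)
    qed
    finally show ?thesis .
  qed
  have "(LINT \<omega>|M. (\<Sum>p\<in>I\<times>I. g p (eps (fst p) \<omega>) (eps (snd p) \<omega>))\<^sup>2) \<le> 2 * (\<Sum>p\<in>I\<times>I. \<bar>A p\<bar>\<^sup>2)"
  proof (rule degenerate_double_sum_second_moment)
    show "finite I" by (simp add: I_def)
    show "(\<lambda>(x, y). g p x y) \<in> borel_measurable (borel \<Otimes>\<^sub>M borel)" for p
      unfolding g_def by measurable
    show "\<bar>g p x y\<bar> \<le> \<bar>A p\<bar>" for p x y
    proof -
      have "\<bar>F x - 1/2\<bar> \<le> 1/2" "\<bar>F y - 1/2\<bar> \<le> 1/2"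
        using F_bounds[of x] F_bounds[of y] by linarith+
      then have "\<bar>(F x - 1/2) * (F y - 1/2)\<bar> \<le> 1/2 * (1/2)"
        unfolding abs_mult by (intro mult_mono) auto
      then have "\<bar>(F x - 1/2) * (F y - 1/2) - (if fst p = snd p then 1/12 else 0)\<bar> \<le> 1"
        by (simp split: if_splits) linarith
      then have "\<bar>A p\<bar> * \<bar>(F x - 1/2) * (F y - 1/2) - (if fst p = snd p then 1/12 else 0)\<bar> \<le> \<bar>A p\<bar> * 1"
        by (intro mult_left_mono) auto
      then show ?thesis by (simp add: g_def abs_mult)
    qed
    have z: "(LINT \<omega>|M. F (eps i \<omega>) - 1/2) = 0" for i
      using expectation_\<zeta>(1)[of i] by (simp add: \<zeta>_def[abs_def])
    have i1: "integrable M (\<lambda>\<omega>. F (eps i \<omega>) - 1/2)" for i using integrable_F by simp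
    show "(LINT \<omega>|M. g (i, i) (eps i \<omega>) (eps i \<omega>)) = 0" for i
    proof -
      have "integrable M (\<lambda>\<omega>. (\<zeta> i \<omega>)\<^sup>2)"
        by (rule integrable_bounded[of _ 1]) (use \<zeta>_bound[of i] in \<open>auto intro!: abs_square_le_1[THEN iffD2] order_trans[OF \<zeta>_bound]\<close>)
      then have "(LINT \<omega>|M. (\<zeta> i \<omega>)\<^sup>2 - 1 / 12) = 0" using expectation_\<zeta>(2)[of i] by (simp add: prob_space)
      then show ?thesis by (simp add: g_def \<zeta>_def power2_eq_square)
    qed
    show "(LINT \<omega>|M. g (i, k) (eps i \<omega>) y) = 0" "(LINT \<omega>|M. g (i, k) x (eps k \<omega>)) = 0" if "i \<noteq> k" for i k x y
      using that z by (simp_all add: g_def)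
  qed
  then show ?thesis by (simp add: eq frob)
qed

text \<open>The kernel is the Hoeffding remainder of the comparison indicator: 1(eps k \<le> x) has
  mean F x and 1(y \<le> eps i) has mean 1 - F y, so subtracting F x - F y + 1/2 centres it in
  either argument. The diagonal is set to 0, because the indicator is constantly 1 there.\<close>

lemma degenerate_rank_kernel_second_moment:
  fixes c :: "nat \<Rightarrow> real"
  assumes "\<And>i. \<bar>c i\<bar> \<le> 1"
  shows "(LINT \<omega>|M. (\<Sum>p\<in>{1..n}\<times>{1..n}. c (fst p) * (if fst p = snd p then 0 else
      of_bool (eps (snd p) \<omega> \<le> eps (fst p) \<omega>) - F (eps (fst p) \<omega>) + F (eps (snd p) \<omega>) - 1 / 2))\<^sup>2) \<le> 8 * (real n)\<^sup>2"
proof -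
  define g where "g p x y = c (fst p) * (if fst p = snd p then 0 else of_bool (y \<le> x) - F x + F y - 1 / 2)"
    for p :: "nat \<times> nat" and x y
  have "(LINT \<omega>|M. (\<Sum>p\<in>{1..n}\<times>{1..n}. g p (eps (fst p) \<omega>) (eps (snd p) \<omega>))\<^sup>2) \<le> 2 * (\<Sum>p\<in>{1..n}\<times>{1..n}. 2\<^sup>2)"
  proof (rule degenerate_double_sum_second_moment)
    show "(\<lambda>(x, y). g p x y) \<in> borel_measurable (borel \<Otimes>\<^sub>M borel)" for p
    proof (cases "fst p = snd p")
      case False
      have "(\<lambda>z. of_bool (snd z \<le> (fst z :: real)) :: real) \<in> borel_measurable (borel \<Otimes>\<^sub>M borel)" by measurable
      then show ?thesis using False by (simp add: g_def split_beta)
    qed (simp add: g_def)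
    show "\<bar>g p x y\<bar> \<le> 2" for p x y
    proof -
      have "\<bar>of_bool (y \<le> x) - F x + F y - 1 / 2\<bar> \<le> 2"
        using F_bounds[of x] F_bounds[of y] by (cases "y \<le> x") auto
      then have "\<bar>c (fst p)\<bar> * \<bar>if fst p = snd p then 0 else of_bool (y \<le> x) - F x + F y - 1 / 2\<bar> \<le> 1 * 2"
        by (intro mult_mono assms) auto
      then show ?thesis by (simp add: g_def abs_mult)
    qed
    show "(LINT \<omega>|M. g (i, i) (eps i \<omega>) (eps i \<omega>)) = 0" for i by (simp add: g_def)
    show "(LINT \<omega>|M. g (i, k) (eps i \<omega>) y) = 0" if "i \<noteq> k" for i k :: nat and y
    proof -
      have "integrable M (\<lambda>\<omega>. of_bool (y \<le> eps i \<omega>) :: real)" by (rule integrable_bounded[of _ 1]) auto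
      then show ?thesis using that integrable_F(1)[of i] expectation_F(1)[of i] expectation_eps_ge[of y i]
        by (simp add: g_def prob_space)
    qed
    show "(LINT \<omega>|M. g (i, k) x (eps k \<omega>)) = 0" if "i \<noteq> k" for i k :: nat and x
    proof -
      have "integrable M (\<lambda>\<omega>. of_bool (eps k \<omega> \<le> x) :: real)" by (rule integrable_bounded[of _ 1]) auto
      then show ?thesis using that integrable_F(1)[of k] expectation_F(1)[of k] expectation_eps_le[of k x]
        by (simp add: g_def prob_space)
    qed
  qed simp
  then show ?thesis by (simp add: g_def power2_eq_square)
qed

end

section \<open>Differences of two errors and the effect of shifts on their comparison\<close>

context rank_sample
begin

lemma distr_eps_pair:
  assumes "i \<noteq> k"
  shows "distr M (borel \<Otimes>\<^sub>M borel) (\<lambda>\<omega>. (eps i \<omega>, eps k \<omega>)) = law \<Otimes>\<^sub>M law"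
proof -
  have "indep_var (PiM {i} (\<lambda>_. borel)) (\<lambda>\<omega>. restrict (\<lambda>i. eps i \<omega>) {i}) (PiM {k} (\<lambda>_. borel)) (\<lambda>\<omega>. restrict (\<lambda>i. eps i \<omega>) {k})"
    by (rule indep_var_restrict[OF eps_indep]) (use assms in auto)
  from indep_var_compose[OF this, where ?Y1.0 = "\<lambda>u. u i" and ?N1.0 = borel and ?Y2.0 = "\<lambda>v. v k" and ?N2.0 = borel]
  have "indep_var borel (eps i) borel (eps k)" by (simp add: comp_def)
  then show ?thesis using indep_var_distribution_eq[of borel "eps i" borel "eps k"] by (simp add: eps_law)
qed

text \<open>The density h is given for one pair of errors only; this carries it over to all
  pairs.\<close>

lemma distr_eps_diff:
  assumes "i \<noteq> k" "i' \<noteq> k'"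
  shows "distr M borel (\<lambda>\<omega>. eps i \<omega> - eps k \<omega>) = distr M borel (\<lambda>\<omega>. eps i' \<omega> - eps k' \<omega>)"
proof -
  have "distr M borel (\<lambda>\<omega>. eps i \<omega> - eps k \<omega>) = distr (law \<Otimes>\<^sub>M law) borel (\<lambda>z. fst z - snd z)" if "i \<noteq> k" for i k
    unfolding distr_eps_pair[OF that, symmetric] by (subst distr_distr) (auto simp: comp_def)
  then show ?thesis using assms by simp
qed

end

locale rank_sample_diff = rank_sample +
  fixes h :: "real \<Rightarrow> real" and \<delta> L :: real
  assumes h_nonneg: "\<And>x. h x \<ge> 0"
    and h_dens: "distributed M lborel (\<lambda>\<omega>. eps 1 \<omega> - eps 2 \<omega>) (\<lambda>x. ennreal (h x))"
    and \<delta>_pos: "\<delta> > 0" and h_lip: "L-lipschitz_on {-\<delta>..\<delta>} h"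
begin

lemma L_nonneg: "L \<ge> 0"
  using h_lip by (auto simp: lipschitz_on_def)

lemma h_measurable [measurable]: "h \<in> borel_measurable borel"
  using distributed_real_measurable[OF _ h_dens] h_nonneg by simp

lemma h_near_0: "\<bar>x\<bar> \<le> \<delta> \<Longrightarrow> \<bar>h x - h 0\<bar> \<le> L * \<bar>x\<bar>"
  using lipschitz_onD[OF h_lip, of x 0] \<delta>_pos by (auto simp: dist_real_def abs_le_iff)

definition hmax :: real where "hmax = h 0 + L * \<delta>"

lemma h_le_hmax: "\<bar>x\<bar> \<le> \<delta> \<Longrightarrow> h x \<le> hmax"
  using h_near_0[of x] mult_left_mono[OF _ L_nonneg, of "\<bar>x\<bar>" \<delta>] unfolding hmax_def by linarith

lemma hmax_nonneg: "hmax \<ge> 0"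
  using h_nonneg[of 0] L_nonneg \<delta>_pos by (simp add: hmax_def)

lemma
  fixes g :: "real \<Rightarrow> real"
  assumes [measurable]: "g \<in> borel_measurable borel" and bd: "\<And>x. \<bar>g x\<bar> \<le> B" and ik: "i \<noteq> k"
  shows expectation_eps_diff: "(LINT \<omega>|M. g (eps i \<omega> - eps k \<omega>)) = (LINT x|lborel. h x * g x)"
    and integrable_h_mult: "integrable lborel (\<lambda>x. h x * g x)"
proof -
  have "(LINT \<omega>|M. g (eps i \<omega> - eps k \<omega>)) = (LINT x|distr M borel (\<lambda>\<omega>. eps i \<omega> - eps k \<omega>). g x)"
    by (subst integral_distr) auto
  also have "\<dots> = (LINT x|distr M borel (\<lambda>\<omega>. eps 1 \<omega> - eps 2 \<omega>). g x)"
    using distr_eps_diff[OF ik, of 1 2] by simp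
  also have "\<dots> = (LINT \<omega>|M. g (eps 1 \<omega> - eps 2 \<omega>))" by (subst integral_distr) auto
  also have "\<dots> = (LINT x|lborel. h x * g x)"
    using distributed_integral[OF h_dens] h_nonneg by simp
  finally show "(LINT \<omega>|M. g (eps i \<omega> - eps k \<omega>)) = (LINT x|lborel. h x * g x)" .
  have "integrable M (\<lambda>\<omega>. g (eps 1 \<omega> - eps 2 \<omega>))"
    by (rule integrable_bounded[of _ B]) (use bd in auto)
  then show "integrable lborel (\<lambda>x. h x * g x)"
    using distributed_integrable[OF h_dens, of g] h_nonneg by simp
qed

lemma expectation_eps_close:
  assumes "i \<noteq> k" "0 \<le> u" "u \<le> \<delta>"
  shows "(LINT \<omega>|M. of_bool (\<bar>eps k \<omega> - eps i \<omega>\<bar> \<le> u)) \<le> 2 * u * hmax"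
proof -
  have "(LINT \<omega>|M. of_bool (\<bar>eps k \<omega> - eps i \<omega>\<bar> \<le> u)) = (LINT x|lborel. h x * of_bool (\<bar>x\<bar> \<le> u))"
    by (rule expectation_eps_diff[of _ 1]) (use assms in auto)
  also have "\<dots> \<le> (LINT x|lborel. hmax * indicator {-u..u} x)"
  proof (rule integral_mono)
    show "integrable lborel (\<lambda>x. h x * of_bool (\<bar>x\<bar> \<le> u))"
      by (rule integrable_h_mult[of _ 1 k i]) (use assms in auto)
    show "h x * of_bool (\<bar>x\<bar> \<le> u) \<le> hmax * indicator {-u..u} x" for x
      using h_le_hmax[of x] assms by (auto simp: indicator_def)
    show "integrable lborel (\<lambda>x. hmax * indicator {-u..u} x)"
      by (intro integrable_mult_right integrable_real_indicator) (use assms in auto)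
  qed
  also have "\<dots> = 2 * u * hmax" using assms by simp
  finally show ?thesis .
qed

text \<open>This is where h(0) enters. The signed indicator s of the interval between 0 and u
  integrates to u, and replacing h by h(0) on that interval costs at most L |u| times its length
  |u|.\<close>

lemma expectation_eps_shift:
  assumes "i \<noteq> k" "\<bar>u\<bar> \<le> \<delta>"
  shows "\<bar>(LINT \<omega>|M. of_bool (eps k \<omega> - eps i \<omega> \<le> u) - of_bool (eps k \<omega> - eps i \<omega> \<le> 0)) - h 0 * u\<bar> \<le> L * u\<^sup>2"
proof -
  define s :: "real \<Rightarrow> real" where "s x = of_bool (x \<le> u) - of_bool (x \<le> 0)" for x
  have [measurable]: "s \<in> borel_measurable borel" unfolding s_def by measurable
  have s1: "\<bar>s x\<bar> \<le> 1" for x by (auto simp: s_def)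
  have s_eq: "s = (if u \<ge> 0 then indicator {0<..u} else (\<lambda>x. - indicator {u<..0} x))"
    by (auto simp: s_def fun_eq_iff indicator_def)
  have sa: "(\<lambda>x. \<bar>s x\<bar>) = (if u \<ge> 0 then indicator {0<..u} else indicator {u<..0})"
    by (auto simp: s_def fun_eq_iff indicator_def)
  have si: "integrable lborel s" "(LINT x|lborel. s x) = u"
    by (cases "u \<ge> 0"; simp add: s_eq)+
  have sai: "integrable lborel (\<lambda>x. \<bar>s x\<bar>)" "(LINT x|lborel. \<bar>s x\<bar>) = \<bar>u\<bar>"
    by (cases "u \<ge> 0"; simp add: sa)+
  have hs: "integrable lborel (\<lambda>x. h x * s x)" by (rule integrable_h_mult[of _ 1 k i]) (use s1 assms in auto)
  have "(LINT \<omega>|M. of_bool (eps k \<omega> - eps i \<omega> \<le> u) - of_bool (eps k \<omega> - eps i \<omega> \<le> 0)) = (LINT \<omega>|M. s (eps k \<omega> - eps i \<omega>))"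
    by (simp only: s_def)
  also have "\<dots> = (LINT x|lborel. h x * s x)"
    by (rule expectation_eps_diff[of _ 1]) (use s1 assms in auto)
  finally have "(LINT \<omega>|M. of_bool (eps k \<omega> - eps i \<omega> \<le> u) - of_bool (eps k \<omega> - eps i \<omega> \<le> 0)) - h 0 * u
      = (LINT x|lborel. h x * s x) - (LINT x|lborel. h 0 * s x)" using si by simp
  also have "\<dots> = (LINT x|lborel. h x * s x - h 0 * s x)" using si hs by simp
  finally have eq: "(LINT \<omega>|M. of_bool (eps k \<omega> - eps i \<omega> \<le> u) - of_bool (eps k \<omega> - eps i \<omega> \<le> 0)) - h 0 * u
      = (LINT x|lborel. h x * s x - h 0 * s x)" .
  have "\<bar>LINT x|lborel. h x * s x - h 0 * s x\<bar> \<le> (LINT x|lborel. \<bar>h x * s x - h 0 * s x\<bar>)"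
    by (rule integral_abs_bound)
  also have "\<dots> \<le> (LINT x|lborel. L * \<bar>u\<bar> * \<bar>s x\<bar>)"
  proof (rule integral_mono)
    show "integrable lborel (\<lambda>x. \<bar>h x * s x - h 0 * s x\<bar>)" using hs si by simp
    show "integrable lborel (\<lambda>x. L * \<bar>u\<bar> * \<bar>s x\<bar>)" using sai by simp
    show "\<bar>h x * s x - h 0 * s x\<bar> \<le> L * \<bar>u\<bar> * \<bar>s x\<bar>" for x
    proof (cases "s x = 0")
      case False
      then have x: "\<bar>x\<bar> \<le> \<bar>u\<bar>" by (auto simp: s_def of_bool_def split: if_splits)
      then have "\<bar>h x - h 0\<bar> \<le> L * \<bar>x\<bar>" using assms by (intro h_near_0) auto
      also have "\<dots> \<le> L * \<bar>u\<bar>" using x L_nonneg by (intro mult_left_mono) auto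
      finally have "\<bar>h x - h 0\<bar> * \<bar>s x\<bar> \<le> L * \<bar>u\<bar> * \<bar>s x\<bar>" by (intro mult_right_mono) auto
      then show ?thesis by (simp add: abs_mult[symmetric] left_diff_distrib)
    qed simp
  qed
  also have "\<dots> = L * u\<^sup>2" using sai by (simp add: power2_eq_square)
  finally show ?thesis unfolding eq .
qed

text \<open>The change in a comparison of two errors when the shifts b are added. It is nonzero only
  if the errors differ by at most the difference of their shifts, hence rarely.\<close>

definition W :: "(nat \<Rightarrow> real) \<Rightarrow> nat \<times> nat \<Rightarrow> 'a \<Rightarrow> real" where
  "W b p \<omega> = of_bool (eps (snd p) \<omega> + b (snd p) \<le> eps (fst p) \<omega> + b (fst p)) - of_bool (eps (snd p) \<omega> \<le> eps (fst p) \<omega>)"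

lemma W_measurable [measurable]: "random_variable borel (W b p)"
  unfolding W_def by measurable

lemma W_bound: "\<bar>W b p \<omega>\<bar> \<le> 1"
  by (auto simp: W_def)

lemma integrable_W: "integrable M (W b p)" "integrable M (\<lambda>\<omega>. \<bar>W b p \<omega>\<bar>)" "integrable M (\<lambda>\<omega>. W b p \<omega> * W b q \<omega>)"
  by (rule integrable_bounded[of _ 1]; auto simp: W_bound abs_mult intro!: mult_le_one)+

lemma W_disjoint_uncorrelated:
  assumes "{fst p, snd p} \<inter> {fst q, snd q} = {}"
  shows "(LINT \<omega>|M. W b p \<omega> * W b q \<omega>) = (LINT \<omega>|M. W b p \<omega>) * (LINT \<omega>|M. W b q \<omega>)"
proof -
  let ?w = "\<lambda>p v. of_bool (v (snd p) + b (snd p) \<le> v (fst p) + b (fst p)) - of_bool (v (snd p) \<le> v (fst p)) :: real"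
  have m: "?w p \<in> borel_measurable (PiM {fst p, snd p} (\<lambda>_. borel))" for p
  proof -
    have base: "(\<lambda>z. of_bool (snd z + b (snd p) \<le> fst z + b (fst p)) - of_bool (snd z \<le> fst z) :: real)
        \<in> borel_measurable (borel \<Otimes>\<^sub>M borel)"
      by measurable
    have "(\<lambda>v. v (fst p)) \<in> borel_measurable (PiM {fst p, snd p} (\<lambda>_. borel :: real measure))"
      "(\<lambda>v. v (snd p)) \<in> borel_measurable (PiM {fst p, snd p} (\<lambda>_. borel :: real measure))"
      by (intro measurable_component_singleton; simp)+
    from measurable_compose[OF measurable_Pair[OF this] base] show ?thesis by simp
  qed
  have "indep_var (PiM {fst p, snd p} (\<lambda>_. borel)) (\<lambda>\<omega>. restrict (\<lambda>i. eps i \<omega>) {fst p, snd p}) (PiM {fst q, snd q} (\<lambda>_. borel)) (\<lambda>\<omega>. restrict (\<lambda>i. eps i \<omega>) {fst q, snd q})"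
    by (rule indep_var_restrict[OF eps_indep assms]) auto
  from indep_var_compose[OF this m[of p] m[of q]]
  have "indep_var borel (W b p) borel (W b q)" by (simp add: comp_def W_def[abs_def])
  then show ?thesis using integrable_W by (intro indep_var_lebesgue_integral)
qed

context
  fixes b :: "nat \<Rightarrow> real" and Bb :: real and n :: nat
  assumes b: "\<And>i. i \<in> {1..n} \<Longrightarrow> \<bar>b i\<bar> \<le> Bb" and Bb: "0 \<le> Bb" "2 * Bb \<le> \<delta>"
begin

lemma W_mean:
  assumes "p \<in> {1..n} \<times> {1..n}"
  shows "\<bar>(LINT \<omega>|M. W b p \<omega>) - h 0 * (b (fst p) - b (snd p))\<bar> \<le> L * (2 * Bb)\<^sup>2"
proof (cases "fst p = snd p")
  case True
  then show ?thesis using L_nonneg by (simp add: W_def)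
next
  case False
  define u where "u = b (fst p) - b (snd p)"
  have u: "\<bar>u\<bar> \<le> 2 * Bb" using b[of "fst p"] b[of "snd p"] assms by (auto simp: u_def)
  have "W b p \<omega> = of_bool (eps (snd p) \<omega> - eps (fst p) \<omega> \<le> u) - of_bool (eps (snd p) \<omega> - eps (fst p) \<omega> \<le> 0)" for \<omega>
    unfolding W_def u_def by (intro arg_cong2[where f="(-)"] arg_cong[where f=of_bool]) linarith+
  then have "\<bar>(LINT \<omega>|M. W b p \<omega>) - h 0 * u\<bar> \<le> L * u\<^sup>2"
    using expectation_eps_shift[OF False, of u] u Bb by simp
  also have "\<dots> \<le> L * (2 * Bb)\<^sup>2"
    using power_mono[OF u abs_ge_zero, of 2] L_nonneg by (intro mult_left_mono) auto
  finally show ?thesis by (simp add: u_def)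
qed

lemma W_abs_mean:
  assumes "p \<in> {1..n} \<times> {1..n}"
  shows "(LINT \<omega>|M. \<bar>W b p \<omega>\<bar>) \<le> 4 * Bb * hmax"
proof (cases "fst p = snd p")
  case True
  then show ?thesis using Bb hmax_nonneg by (simp add: W_def)
next
  case False
  have "(LINT \<omega>|M. \<bar>W b p \<omega>\<bar>) \<le> (LINT \<omega>|M. of_bool (\<bar>eps (snd p) \<omega> - eps (fst p) \<omega>\<bar> \<le> 2 * Bb))"
  proof (rule integral_mono[OF integrable_W(2)])
    show "integrable M (\<lambda>\<omega>. of_bool (\<bar>eps (snd p) \<omega> - eps (fst p) \<omega>\<bar> \<le> 2 * Bb) :: real)"
      by (rule integrable_bounded[of _ 1]) auto
    show "\<bar>W b p \<omega>\<bar> \<le> of_bool (\<bar>eps (snd p) \<omega> - eps (fst p) \<omega>\<bar> \<le> 2 * Bb)" for \<omega>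
      using b[of "fst p"] b[of "snd p"] assms by (auto simp: W_def of_bool_def)
  qed
  also have "\<dots> \<le> 2 * (2 * Bb) * hmax"
    by (rule expectation_eps_close) (use False Bb in auto)
  finally show ?thesis by simp
qed

text \<open>Only the \<open>O(n\<^sup>3)\<close> pairs of index pairs sharing an index contribute, each at most of order \<open>Bb\<close>.\<close>
lemma W_centred_second_moment:
  fixes c :: "nat \<Rightarrow> real"
  assumes c: "\<And>i. \<bar>c i\<bar> \<le> 1"
  shows "(LINT \<omega>|M. (\<Sum>p\<in>{1..n}\<times>{1..n}. c (fst p) * (W b p \<omega> - (LINT \<omega>'|M. W b p \<omega>')))\<^sup>2) \<le> 32 * (real n)^3 * Bb * hmax"
proof -
  define P where "P = {1..n} \<times> {1..n}"
  define e where "e p = (LINT \<omega>|M. W b p \<omega>)" for p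
  define X where "X p \<omega> = c (fst p) * (W b p \<omega> - e p)" for p \<omega>
  \<comment> \<open>A covariance is at most E|W p| + |e p| |e q| \<le> 2 E|W p| in absolute value,
    and E|W p| \<le> 4 Bb hmax.\<close>
  define B where "B = 8 * Bb * hmax"
  define rel where "rel p = {q. {fst p, snd p} \<inter> {fst q, snd q} \<noteq> {}}" for p :: "nat \<times> nat"
  have e1: "\<bar>e p\<bar> \<le> (LINT \<omega>|M. \<bar>W b p \<omega>\<bar>)" for p unfolding e_def by (rule integral_abs_bound)
  have abs1: "(LINT \<omega>|M. \<bar>W b p \<omega>\<bar>) \<le> 1" for p
    using integral_mono[OF integrable_W(2)[of b p], of "\<lambda>_. 1"] W_bound by (simp add: prob_space)
  have XX: "X p \<omega> * X q \<omega> = c (fst p) * c (fst q) * (W b p \<omega> * W b q \<omega> - e q * W b p \<omega> - e p * W b q \<omega> + e p * e q)" for p q \<omega>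
    by (simp add: X_def algebra_simps)
  have int: "integrable M (\<lambda>\<omega>. X p \<omega> * X q \<omega>)" for p q
    unfolding XX using integrable_W by (intro integrable_mult_right Bochner_Integration.integrable_add Bochner_Integration.integrable_diff) auto
  have EX: "(LINT \<omega>|M. X p \<omega> * X q \<omega>) = c (fst p) * c (fst q) * ((LINT \<omega>|M. W b p \<omega> * W b q \<omega>) - e p * e q)" for p q
    unfolding XX using integrable_W[of b p] integrable_W[of b q] integrable_W(3)[of b p q]
    by (simp add: e_def[symmetric] prob_space)
  have "(LINT \<omega>|M. (\<Sum>p\<in>P. X p \<omega>)\<^sup>2) \<le> real (card P) * real (4 * n) * B"
  proof (rule second_moment_sum_sparse[where rel = rel, OF _ int])
    show "finite P" by (simp add: P_def)
    show "B \<ge> 0" using Bb hmax_nonneg by (simp add: B_def)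
    show "(LINT \<omega>|M. X p \<omega> * X q \<omega>) = 0" if "q \<notin> rel p" for p q
      using that W_disjoint_uncorrelated[of p q b] by (simp add: rel_def EX e_def)
    show "(LINT \<omega>|M. X p \<omega> * X q \<omega>) \<le> B" if "p \<in> P" "q \<in> P" for p q
    proof -
      have "\<bar>LINT \<omega>|M. W b p \<omega> * W b q \<omega>\<bar> \<le> (LINT \<omega>|M. \<bar>W b p \<omega> * W b q \<omega>\<bar>)" by (rule integral_abs_bound)
      also have "\<dots> \<le> (LINT \<omega>|M. \<bar>W b p \<omega>\<bar>)"
      proof (rule integral_mono[OF _ integrable_W(2)])
        show "integrable M (\<lambda>\<omega>. \<bar>W b p \<omega> * W b q \<omega>\<bar>)" using integrable_W(3) by simp
        show "\<bar>W b p \<omega> * W b q \<omega>\<bar> \<le> \<bar>W b p \<omega>\<bar>" for \<omega>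
          using mult_left_mono[OF W_bound[of b q \<omega>] abs_ge_zero[of "W b p \<omega>"]] by (simp add: abs_mult)
      qed
      finally have 1: "\<bar>LINT \<omega>|M. W b p \<omega> * W b q \<omega>\<bar> \<le> (LINT \<omega>|M. \<bar>W b p \<omega>\<bar>)" .
      have "\<bar>e p\<bar> * \<bar>e q\<bar> \<le> (LINT \<omega>|M. \<bar>W b p \<omega>\<bar>) * 1"
        using e1[of p] e1[of q] abs1[of q] by (intro mult_mono) auto
      with 1 have "\<bar>(LINT \<omega>|M. W b p \<omega> * W b q \<omega>) - e p * e q\<bar> \<le> 2 * (LINT \<omega>|M. \<bar>W b p \<omega>\<bar>)"
        using abs_triangle_ineq4[of "LINT \<omega>|M. W b p \<omega> * W b q \<omega>" "e p * e q"] by (simp add: abs_mult)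
      also have "\<dots> \<le> B" using W_abs_mean[of p] that by (simp add: P_def B_def)
      finally have 2: "\<bar>(LINT \<omega>|M. W b p \<omega> * W b q \<omega>) - e p * e q\<bar> \<le> B" .
      have "\<bar>LINT \<omega>|M. X p \<omega> * X q \<omega>\<bar> \<le> 1 * B"
        unfolding EX abs_mult[of "c (fst p) * c (fst q)"]
        by (intro mult_mono 2) (auto simp: abs_mult intro!: mult_le_one c)
      then show ?thesis by simp
    qed
    show "card (rel p \<inter> P) \<le> 4 * n" for p
    proof -
      \<comment> \<open>One of at most two shared indices sits in one of two positions, and the
        other position is free.\<close>
      have "rel p \<inter> P \<subseteq> (({fst p, snd p} \<times> {1..n}) \<union> ({1..n} \<times> {fst p, snd p}))"
        by (auto simp: rel_def P_def)
      then have "card (rel p \<inter> P) \<le> card (({fst p, snd p} \<times> {1..n}) \<union> ({1..n} \<times> {fst p, snd p}))"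
        by (intro card_mono) auto
      also have "\<dots> \<le> card ({fst p, snd p} \<times> {1..n}) + card ({1..n} \<times> {fst p, snd p})" by (rule card_Un_le)
      also have "\<dots> = 2 * (card {fst p, snd p} * n)" by (simp add: card_cartesian_product)
      also have "\<dots> \<le> 2 * (2 * n)" by (intro mult_left_mono mult_right_mono) (auto simp: card_insert_if)
      finally show ?thesis by simp
    qed
  qed
  also have "\<dots> = 32 * (real n)^3 * Bb * hmax"
    by (simp add: P_def B_def card_cartesian_product power3_eq_cube)
  finally show ?thesis by (simp add: X_def P_def e_def)
qed

end

end

section \<open>Decomposition of the rank coefficients\<close>

lemma phi_hat_eq_double_sum:
  "phi_hat n Y j = 1 / (real n * (real n + 1)) *
     (\<Sum>p\<in>{1..n}\<times>{1..n}. cos (pi * real j * xpt n (fst p)) * of_bool (Y (snd p) \<le> Y (fst p)))"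
proof -
  have rank: "real (rank n Y i) = (\<Sum>k=1..n. of_bool (Y k \<le> Y i))" for i
    unfolding rank_def by (subst sum_of_bool_eq) (auto intro!: arg_cong[where f=card])
  have "(\<Sum>i=1..n. (real (rank n Y i) / (real n + 1)) * cos (pi * real j * xpt n i))
      = (\<Sum>i=1..n. \<Sum>k=1..n. cos (pi * real j * xpt n i) * of_bool (Y k \<le> Y i)) / (real n + 1)"
    unfolding rank sum_divide_distrib
    by (intro sum.cong refl) (simp add: sum_distrib_left[symmetric] sum_divide_distrib[symmetric])
  also have "(\<Sum>i=1..n. \<Sum>k=1..n. cos (pi * real j * xpt n i) * of_bool (Y k \<le> Y i))
      = (\<Sum>p\<in>{1..n}\<times>{1..n}. cos (pi * real j * xpt n (fst p)) * of_bool (Y (snd p) \<le> Y (fst p)))"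
    unfolding sum.cartesian_product by (intro sum.cong refl) auto
  finally show ?thesis by (simp add: phi_hat_def)
qed

lemma square_sum5_le: "(a + b + c + d + e)\<^sup>2 \<le> 5 * (a\<^sup>2 + b\<^sup>2 + c\<^sup>2 + d\<^sup>2 + (e :: real)\<^sup>2)"
proof -
  have "5 * (a\<^sup>2 + b\<^sup>2 + c\<^sup>2 + d\<^sup>2 + e\<^sup>2) - (a + b + c + d + e)\<^sup>2 =
    (a - b)\<^sup>2 + (a - c)\<^sup>2 + (a - d)\<^sup>2 + (a - e)\<^sup>2 + (b - c)\<^sup>2 + (b - d)\<^sup>2 + (b - e)\<^sup>2 + (c - d)\<^sup>2 + (c - e)\<^sup>2 + (d - e)\<^sup>2"
    by (simp add: power2_eq_square algebra_simps)
  also have "\<dots> \<ge> 0" by (intro add_nonneg_nonneg zero_le_power2)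
  finally show ?thesis by simp
qed

locale rank_alternative = rank_sample_diff +
  fixes \<beta> :: "real \<Rightarrow> real" and B\<beta> :: real
  assumes B\<beta>: "B\<beta> > 0" "\<And>x. x \<in> {0..1} \<Longrightarrow> \<bar>\<beta> x\<bar> \<le> B\<beta>"
begin

definition shift :: "nat \<Rightarrow> nat \<Rightarrow> real" where
  "shift n j = sqrt 24 * h 0 * ((1 / real n) * (\<Sum>i=1..n. \<beta> (xpt n i) * cos (pi * real j * xpt n i)))"

definition root_term :: "nat \<Rightarrow> nat \<Rightarrow> 'a \<Rightarrow> real" where
  "root_term n j \<omega> = sqrt (24 * real n) * phi_hat n (Yobs \<beta> eps n \<omega>) j"

definition res :: "nat \<Rightarrow> nat \<Rightarrow> 'a \<Rightarrow> real" where
  "res n j \<omega> = root_term n j \<omega> - V n j \<omega> - shift n j"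

lemma root_term_measurable [measurable]: "random_variable borel (root_term n j)"
  unfolding root_term_def phi_hat_eq_double_sum Yobs_def by measurable

lemma res_measurable [measurable]: "random_variable borel (res n j)"
  unfolding res_def by measurable

lemma shift_bound: "\<bar>shift n j\<bar> \<le> sqrt 24 * h 0 * B\<beta>"
proof (cases "n = 0")
  case False
  have "\<bar>\<Sum>i=1..n. \<beta> (xpt n i) * cos (pi * real j * xpt n i)\<bar> \<le> (\<Sum>i=1..n. B\<beta> * 1)"
  proof (intro order_trans[OF sum_abs] sum_mono)
    fix i assume "i \<in> {1..n}"
    then have "xpt n i \<in> {0..1}" using xpt_mem[of i n] by auto
    then show "\<bar>\<beta> (xpt n i) * cos (pi * real j * xpt n i)\<bar> \<le> B\<beta> * 1"
      unfolding abs_mult using B\<beta> by (intro mult_mono abs_cos_le_one) auto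
  qed
  then have "(1 / real n) * \<bar>\<Sum>i=1..n. \<beta> (xpt n i) * cos (pi * real j * xpt n i)\<bar> \<le> (1 / real n) * (real n * B\<beta>)"
    by (intro mult_left_mono) auto
  then have "\<bar>(1 / real n) * (\<Sum>i=1..n. \<beta> (xpt n i) * cos (pi * real j * xpt n i))\<bar> \<le> B\<beta>"
    using False by (simp add: abs_mult)
  then have "sqrt 24 * h 0 * \<bar>(1 / real n) * (\<Sum>i=1..n. \<beta> (xpt n i) * cos (pi * real j * xpt n i))\<bar> \<le> sqrt 24 * h 0 * B\<beta>"
    using h_nonneg[of 0] by (intro mult_left_mono) auto
  then show ?thesis using h_nonneg[of 0] by (simp add: shift_def abs_mult)
qed (use B\<beta> h_nonneg in \<open>simp add: shift_def\<close>)

text \<open>The factor 5 comes from squaring a sum of five terms. The summands belong to the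
  degenerate kernel (192 = 24 * 8), the centred effect of the shifts (768 = 24 * 32), its bias (384
  = 24 * 16), and the parts V / (n + 1) and shift / (n + 1).\<close>

definition Cres :: real where
  "Cres = 5 * (192 + 768 * B\<beta> * hmax + 384 * L\<^sup>2 * B\<beta>^4 + 6 + 24 * (h 0)\<^sup>2 * B\<beta>\<^sup>2)"

lemma Cres_nonneg: "Cres \<ge> 0"
  using B\<beta>(1) hmax_nonneg by (simp add: Cres_def add_nonneg_nonneg)

text \<open>The comparison of two observations splits into the degenerate kernel K, functions of a
  single index, the centred effect of the shifts, its bias and its linear part. The vanishing cosine
  sum removes whatever depends on the second index alone; what then remains besides V and shift is
  small.\<close>

lemma
  assumes n: "2 \<le> n" "2 * (B\<beta> / sqrt (real n)) \<le> \<delta>" and j: "1 \<le> j" "j < n"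
  shows integrable_res_square: "integrable M (\<lambda>\<omega>. (res n j \<omega>)\<^sup>2)"
    and res_second_moment: "(LINT \<omega>|M. (res n j \<omega>)\<^sup>2) \<le> Cres / sqrt (real n)"
proof -
  define b where "b i = \<beta> (xpt n i) / sqrt (real n)" for i
  define Bb where "Bb = B\<beta> / sqrt (real n)"
  define c where "c i = cos (pi * real j * xpt n i)" for i
  define I where "I = {1..n}"
  define P where "P = I \<times> I"
  define K where "K p \<omega> = (if fst p = snd p then 0 else of_bool (eps (snd p) \<omega> \<le> eps (fst p) \<omega>) - F (eps (fst p) \<omega>) + F (eps (snd p) \<omega>) - 1 / 2)" for p \<omega>
  define w where "w p \<omega> = W b p \<omega>" for p \<omega>
  define e where "e p = (LINT \<omega>|M. w p \<omega>)" for p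
  \<comment> \<open>Equals sqrt (24 n) / (n (n + 1)), the factor of the double sum in
    \<open>root_term\<close>.\<close>
  define a where "a = sqrt (24 / real n) / (real n + 1)"
  define SK where "SK \<omega> = (\<Sum>p\<in>P. c (fst p) * K p \<omega>)" for \<omega>
  define SW where "SW \<omega> = (\<Sum>p\<in>P. c (fst p) * (w p \<omega> - e p))" for \<omega>
  define SE where "SE = (\<Sum>p\<in>P. c (fst p) * (e p - h 0 * (b (fst p) - b (snd p))))"
  have n0: "real n > 0" using n by simp
  have b: "\<bar>b i\<bar> \<le> Bb" if "i \<in> {1..n}" for i
    using B\<beta>(2)[of "xpt n i"] xpt_mem[OF that] by (auto simp: b_def Bb_def divide_right_mono)
  have Bb: "0 \<le> Bb" "2 * Bb \<le> \<delta>" using n B\<beta>(1) by (auto simp: Bb_def)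
  have c1: "\<bar>c i\<bar> \<le> 1" for i by (simp add: c_def)
  have c0: "(\<Sum>i\<in>I. c i) = 0" unfolding c_def I_def using j by (intro sum_cos_midpoints) auto
  have fin: "finite I" by (simp add: I_def)
  have cardI: "real (card I) = real n" by (simp add: I_def)
  have Psum: "(\<Sum>p\<in>P. c (fst p) * g (fst p)) = real n * (\<Sum>i\<in>I. c i * g i)" for g
    unfolding P_def sum.cartesian_product' by (simp add: sum_distrib_left cardI)
  have Psum': "(\<Sum>p\<in>P. c (fst p) * g (snd p)) = 0" for g
  proof -
    have "(\<Sum>p\<in>P. c (fst p) * g (snd p)) = (\<Sum>i\<in>I. c i) * (\<Sum>k\<in>I. g k)"
      unfolding P_def sum_product sum.cartesian_product' by simp
    then show ?thesis by (simp add: c0)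
  qed
  \<comment> \<open>Comparisons of an index with itself contribute a multiple of the cosine sum,
    hence nothing.\<close>
  have Pdiag: "(\<Sum>p\<in>P. c (fst p) * (if fst p = snd p then 1 / 2 else 0)) = 0"
  proof -
    have "(\<Sum>p\<in>P. c (fst p) * (if fst p = snd p then 1 / 2 else 0)) = (\<Sum>i\<in>I. \<Sum>k\<in>I. c i * (if i = k then 1 / 2 else 0))"
      unfolding P_def sum.cartesian_product' by simp
    also have "\<dots> = (\<Sum>i\<in>I. c i) / 2" using fin by (simp add: if_distrib sum_divide_distrib cong: if_cong)
    finally show ?thesis by (simp add: c0)
  qed
  have decomp: "res n j \<omega> = a * SK \<omega> + a * SW \<omega> + a * SE + (- (V n j \<omega> / (real n + 1))) + (- (shift n j / (real n + 1)))" for \<omega>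
  proof -
    \<comment> \<open>On the diagonal the indicator is 1 and K is 0; the term 1/2 restores the
      identity there.\<close>
    have "of_bool (Yobs \<beta> eps n \<omega> (snd p) \<le> Yobs \<beta> eps n \<omega> (fst p)) =
        K p \<omega> + (if fst p = snd p then 1 / 2 else 0) + \<zeta> (fst p) \<omega> - F (eps (snd p) \<omega>) + 1 + (w p \<omega> - e p)
         + (e p - h 0 * (b (fst p) - b (snd p))) + h 0 * b (fst p) - h 0 * b (snd p)" for p
      by (auto simp: K_def w_def W_def Yobs_def b_def \<zeta>_def algebra_simps)
    then have "(\<Sum>p\<in>P. c (fst p) * of_bool (Yobs \<beta> eps n \<omega> (snd p) \<le> Yobs \<beta> eps n \<omega> (fst p))) =
      (\<Sum>p\<in>P. c (fst p) * K p \<omega> + c (fst p) * (if fst p = snd p then 1 / 2 else 0) + c (fst p) * \<zeta> (fst p) \<omega>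
        - c (fst p) * F (eps (snd p) \<omega>) + c (fst p) * 1 + c (fst p) * (w p \<omega> - e p)
        + c (fst p) * (e p - h 0 * (b (fst p) - b (snd p))) + c (fst p) * (h 0 * b (fst p)) - c (fst p) * (h 0 * b (snd p)))"
      by (intro sum.cong refl) (simp only: distrib_left right_diff_distrib)
    also have "\<dots> = SK \<omega> + real n * (\<Sum>i\<in>I. c i * \<zeta> i \<omega>) + SW \<omega> + SE + real n * (\<Sum>i\<in>I. c i * (h 0 * b i))"
      unfolding sum.distrib sum_subtractf SK_def SW_def SE_def
      using Psum[of "\<lambda>i. \<zeta> i \<omega>"] Psum'[of "\<lambda>k. F (eps k \<omega>)"] Psum'[of "\<lambda>k. 1"] Psum[of "\<lambda>i. h 0 * b i"] Psum'[of "\<lambda>k. h 0 * b k"] Pdiag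
      by linarith
    finally have *: "(\<Sum>p\<in>P. c (fst p) * of_bool (Yobs \<beta> eps n \<omega> (snd p) \<le> Yobs \<beta> eps n \<omega> (fst p))) =
       SK \<omega> + real n * (\<Sum>i\<in>I. c i * \<zeta> i \<omega>) + SW \<omega> + SE + real n * (\<Sum>i\<in>I. c i * (h 0 * b i))" .
    have sq: "sqrt (24 * real n) = sqrt (24 / real n) * real n"
    proof -
      have "24 * real n = (24 / real n) * (real n)\<^sup>2" using n0 by (simp add: power2_eq_square)
      then have "sqrt (24 * real n) = sqrt ((24 / real n) * (real n)\<^sup>2)" by (rule arg_cong)
      then show ?thesis using n0 by (simp only: real_sqrt_mult) simp
    qed
    have "root_term n j \<omega> = a * (SK \<omega> + real n * (\<Sum>i\<in>I. c i * \<zeta> i \<omega>) + SW \<omega> + SE + real n * (\<Sum>i\<in>I. c i * (h 0 * b i)))"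
    proof -
      have "sqrt (24 * real n) * (1 / (real n * (real n + 1)) * T) = a * T" for T
        using n0 by (simp add: sq a_def)
      with * show ?thesis
        by (simp only: root_term_def phi_hat_eq_double_sum c_def P_def I_def)
    qed
    \<comment> \<open>Ranks are divided by n + 1 rather than n, so V appears with the factor n / (n
      + 1) = 1 - 1 / (n + 1); the deficit goes into the remainder. The same happens to the
      shift.\<close>
    moreover have "a * (real n * (\<Sum>i\<in>I. c i * \<zeta> i \<omega>)) = V n j \<omega> - V n j \<omega> / (real n + 1)"
    proof -
      have "V n j \<omega> = sqrt (24 / real n) * (\<Sum>i\<in>I. c i * \<zeta> i \<omega>)"
        by (simp add: V_def I_def c_def mult.commute)
      moreover have "x - x / (real n + 1) = x * real n / (real n + 1)" for x using n0 by (simp add: field_simps)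
      ultimately show ?thesis by (simp add: a_def)
    qed
    moreover have "a * (real n * (\<Sum>i\<in>I. c i * (h 0 * b i))) = shift n j - shift n j / (real n + 1)"
    proof -
      have "(\<Sum>i\<in>I. c i * (h 0 * b i)) = h 0 / sqrt (real n) * (\<Sum>i=1..n. \<beta> (xpt n i) * cos (pi * real j * xpt n i))"
        unfolding sum_distrib_left by (intro sum.cong) (auto simp: I_def b_def c_def)
      moreover have "sqrt (24 / real n) * (h 0 / sqrt (real n) * T) = sqrt 24 * h 0 * (1 / real n * T)" for T
        using n0 by (simp add: real_sqrt_divide)
      ultimately have "sqrt (24 / real n) * (\<Sum>i\<in>I. c i * (h 0 * b i)) = shift n j"
        by (simp only: shift_def)
      moreover have "x - x / (real n + 1) = x * real n / (real n + 1)" for x using n0 by (simp add: field_simps)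
      ultimately show ?thesis by (simp add: a_def field_simps)
    qed
    ultimately show ?thesis by (simp add: res_def algebra_simps)
  qed
  have a2: "a\<^sup>2 \<le> 24 / (real n)^3"
  proof -
    have "a\<^sup>2 = 24 / real n / (real n + 1)\<^sup>2" by (simp add: a_def power_divide)
    also have "\<dots> \<le> 24 / real n / (real n)\<^sup>2" using n0 by (intro divide_left_mono) auto
    finally show ?thesis by (simp add: power3_eq_cube power2_eq_square)
  qed
  have Wm [measurable]: "random_variable borel (w p)" for p unfolding w_def by (rule W_measurable)
  have Km [measurable]: "random_variable borel (K p)" for p unfolding K_def by measurable
  have SKm [measurable]: "random_variable borel SK" unfolding SK_def by measurable
  have SWm [measurable]: "random_variable borel SW" unfolding SW_def by measurable
  have Kb: "\<bar>K p \<omega>\<bar> \<le> 2" for p \<omega>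
    using F_bounds[of "eps (fst p) \<omega>"] F_bounds[of "eps (snd p) \<omega>"] unfolding K_def
    by (cases "eps (snd p) \<omega> \<le> eps (fst p) \<omega>") auto
  have wb: "\<bar>w p \<omega>\<bar> \<le> 1" for p \<omega> unfolding w_def by (rule W_bound)
  have SKb: "\<bar>SK \<omega>\<bar> \<le> (\<Sum>p\<in>P. 1 * 2)" for \<omega>
    unfolding SK_def by (intro order_trans[OF sum_abs] sum_mono) (unfold abs_mult, intro mult_mono c1 Kb; simp)
  have SWb: "\<bar>SW \<omega>\<bar> \<le> (\<Sum>p\<in>P. 1 * (1 + \<bar>e p\<bar>))" for \<omega>
    unfolding SW_def
  proof (intro order_trans[OF sum_abs] sum_mono)
    fix p
    have "\<bar>w p \<omega> - e p\<bar> \<le> 1 + \<bar>e p\<bar>" using wb[of p \<omega>] by linarith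
    then show "\<bar>c (fst p) * (w p \<omega> - e p)\<bar> \<le> 1 * (1 + \<bar>e p\<bar>)"
      unfolding abs_mult by (intro mult_mono c1) auto
  qed
  have iSK: "integrable M (\<lambda>\<omega>. (SK \<omega>)\<^sup>2)"
    by (rule integrable_bounded[of _ "(\<Sum>p\<in>P. 1 * 2)\<^sup>2"]) (use power_mono[OF SKb abs_ge_zero, of _ 2] in auto)
  have iSW: "integrable M (\<lambda>\<omega>. (SW \<omega>)\<^sup>2)"
    by (rule integrable_bounded[of _ "(\<Sum>p\<in>P. 1 * (1 + \<bar>e p\<bar>))\<^sup>2"]) (use power_mono[OF SWb abs_ge_zero, of _ 2] in auto)
  have ESK: "(LINT \<omega>|M. (SK \<omega>)\<^sup>2) \<le> 8 * (real n)\<^sup>2"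
    unfolding SK_def K_def P_def I_def by (rule degenerate_rank_kernel_second_moment[OF c1])
  have ESW: "(LINT \<omega>|M. (SW \<omega>)\<^sup>2) \<le> 32 * (real n)^3 * Bb * hmax"
    unfolding SW_def P_def I_def e_def w_def by (rule W_centred_second_moment[OF b Bb c1])
  have bSE: "\<bar>SE\<bar> \<le> 4 * L * B\<beta>\<^sup>2 * real n"
  proof -
    have "\<bar>SE\<bar> \<le> (\<Sum>p\<in>P. 1 * (L * (2 * Bb)\<^sup>2))"
      unfolding SE_def
    proof (intro order_trans[OF sum_abs] sum_mono)
      fix p assume "p \<in> P"
      then have "\<bar>e p - h 0 * (b (fst p) - b (snd p))\<bar> \<le> L * (2 * Bb)\<^sup>2"
        unfolding e_def w_def P_def I_def by (intro W_mean[OF b Bb])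
      then show "\<bar>c (fst p) * (e p - h 0 * (b (fst p) - b (snd p)))\<bar> \<le> 1 * (L * (2 * Bb)\<^sup>2)"
        unfolding abs_mult by (intro mult_mono c1) auto
    qed
    also have "\<dots> = 4 * L * B\<beta>\<^sup>2 * real n"
      using n0 by (simp add: P_def I_def card_cartesian_product Bb_def power_divide power_mult_distrib)
    finally show ?thesis .
  qed
  define U where "U \<omega> = 5 * ((a * SK \<omega>)\<^sup>2 + (a * SW \<omega>)\<^sup>2 + 384 * L\<^sup>2 * B\<beta>^4 / real n + 6 / real n + 24 * (h 0)\<^sup>2 * B\<beta>\<^sup>2 / real n)" for \<omega>
  have sq_n: "x / (real n + 1)\<^sup>2 \<le> x / real n" if "x \<ge> 0" for x
  proof -
    have "real n \<le> (real n + 1)\<^sup>2" by (simp add: power2_eq_square algebra_simps)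
    then show ?thesis using that n0 by (intro divide_left_mono) auto
  qed
  have le: "(res n j \<omega>)\<^sup>2 \<le> U \<omega>" for \<omega>
  proof -
    have "(a * SE)\<^sup>2 \<le> 24 / (real n)^3 * (4 * L * B\<beta>\<^sup>2 * real n)\<^sup>2"
      unfolding power_mult_distrib[of a] using power_mono[OF bSE abs_ge_zero, of 2] n0
      by (intro mult_mono a2) auto
    also have "\<dots> = 384 * L\<^sup>2 * B\<beta>^4 / real n"
      using n0 by (simp add: power_mult_distrib power2_eq_square power3_eq_cube power4_eq_xxxx)
    finally have 1: "(a * SE)\<^sup>2 \<le> 384 * L\<^sup>2 * B\<beta>^4 / real n" .
    have "(- (V n j \<omega> / (real n + 1)))\<^sup>2 \<le> 6 * real n / (real n + 1)\<^sup>2"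
      using V_square_bound[of n j \<omega>] by (simp add: power_divide divide_right_mono)
    also have "\<dots> \<le> 6 * real n / (real n)\<^sup>2" using n0 by (intro divide_left_mono) auto
    also have "\<dots> = 6 / real n" by (simp add: power2_eq_square)
    finally have 2: "(- (V n j \<omega> / (real n + 1)))\<^sup>2 \<le> 6 / real n" .
    have "(shift n j)\<^sup>2 \<le> 24 * (h 0)\<^sup>2 * B\<beta>\<^sup>2"
      using power_mono[OF shift_bound abs_ge_zero, of n j 2] by (simp add: power_mult_distrib)
    then have "(- (shift n j / (real n + 1)))\<^sup>2 \<le> 24 * (h 0)\<^sup>2 * B\<beta>\<^sup>2 / (real n + 1)\<^sup>2"
      by (simp add: power_divide divide_right_mono)
    also have "\<dots> \<le> 24 * (h 0)\<^sup>2 * B\<beta>\<^sup>2 / real n" by (intro sq_n) auto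
    finally have 3: "(- (shift n j / (real n + 1)))\<^sup>2 \<le> 24 * (h 0)\<^sup>2 * B\<beta>\<^sup>2 / real n" .
    show ?thesis unfolding decomp U_def
      by (rule order_trans[OF square_sum5_le]) (intro mult_left_mono add_mono order_refl 1 2 3; simp)
  qed
  have iU: "integrable M U"
    unfolding U_def power_mult_distrib[of a] using iSK iSW by simp
  show ires: "integrable M (\<lambda>\<omega>. (res n j \<omega>)\<^sup>2)"
    by (rule Bochner_Integration.integrable_bound[OF iU]) (use le in \<open>auto intro!: AE_I2 order_trans[OF _ abs_ge_self]\<close>)
  have "(LINT \<omega>|M. (res n j \<omega>)\<^sup>2) \<le> (LINT \<omega>|M. U \<omega>)"
    by (rule integral_mono[OF ires iU le])
  also have "\<dots> = 5 * (a\<^sup>2 * (LINT \<omega>|M. (SK \<omega>)\<^sup>2) + a\<^sup>2 * (LINT \<omega>|M. (SW \<omega>)\<^sup>2) + 384 * L\<^sup>2 * B\<beta>^4 / real n + 6 / real n + 24 * (h 0)\<^sup>2 * B\<beta>\<^sup>2 / real n)"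
    unfolding U_def power_mult_distrib[of a] using iSK iSW by (simp add: prob_space)
  also have "\<dots> \<le> 5 * (24 / (real n)^3 * (8 * (real n)\<^sup>2) + 24 / (real n)^3 * (32 * (real n)^3 * Bb * hmax) + 384 * L\<^sup>2 * B\<beta>^4 / real n + 6 / real n + 24 * (h 0)\<^sup>2 * B\<beta>\<^sup>2 / real n)"
    using n0 by (intro mult_left_mono add_mono mult_mono a2 ESK ESW order_refl) auto
  also have "\<dots> = 5 * (192 / real n + 768 * B\<beta> * hmax / sqrt (real n) + 384 * L\<^sup>2 * B\<beta>^4 / real n + 6 / real n + 24 * (h 0)\<^sup>2 * B\<beta>\<^sup>2 / real n)"
    using n0 by (simp add: Bb_def power2_eq_square power3_eq_cube)
  \<comment> \<open>Only the term from SW is of order n^(-1/2); the others are of order 1/n and are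
    weakened to the common rate.\<close>
  also have "\<dots> \<le> 5 * (192 / sqrt (real n) + 768 * B\<beta> * hmax / sqrt (real n) + 384 * L\<^sup>2 * B\<beta>^4 / sqrt (real n) + 6 / sqrt (real n) + 24 * (h 0)\<^sup>2 * B\<beta>\<^sup>2 / sqrt (real n))"
  proof -
    have "sqrt (real n) \<le> real n"
      using n by (intro real_le_lsqrt) (auto simp: power2_eq_square)
    then show ?thesis using n0 by (intro mult_left_mono add_mono order_refl divide_left_mono) auto
  qed
  also have "\<dots> = Cres / sqrt (real n)" by (simp add: Cres_def add_divide_distrib)
  finally show "(LINT \<omega>|M. (res n j \<omega>)\<^sup>2) \<le> Cres / sqrt (real n)" .
qed

end

section \<open>Gaussian linearisation and weak convergence\<close>

locale normal_sequence = prob_space N for N :: "'b measure" +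
  fixes Z :: "nat \<Rightarrow> 'b \<Rightarrow> real"
  assumes Z_indep: "indep_vars (\<lambda>_. borel) Z UNIV"
    and Z_normal: "\<And>j. distributed N lborel (Z j) (\<lambda>x. ennreal (std_normal_density x))"
begin

lemma Z_measurable [measurable]: "random_variable borel (Z j)"
  using Z_indep by (auto simp: indep_vars_def)

lemma distr_Z: "distr N borel (Z j) = std_normal_distribution"
  using distributed_distr_eq_density[OF Z_normal[of j]] by (metis distr_cong sets_lborel)

lemma expectation_iexp_linear:
  "(LINT \<omega>|N. iexp (\<Sum>j\<in>J. a j * Z j \<omega>)) = complex_of_real (exp (- (\<Sum>j\<in>J. (a j)\<^sup>2) / 2))"
proof (cases "finite J")
  case True
  have ind: "indep_vars (\<lambda>_. borel) (\<lambda>j \<omega>. a j * Z j \<omega>) J"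
    by (rule indep_vars_compose2[where M' = "\<lambda>_. borel" and X = Z, OF indep_vars_subset[OF Z_indep]]) auto
  have "(LINT \<omega>|N. iexp (\<Sum>j\<in>J. a j * Z j \<omega>)) = char (distr N borel (\<lambda>\<omega>. \<Sum>j\<in>J. a j * Z j \<omega>)) 1"
    unfolding char_def by (subst integral_distr) auto
  also have "\<dots> = (\<Prod>j\<in>J. char (distr N borel (\<lambda>\<omega>. a j * Z j \<omega>)) 1)"
    by (rule char_distr_sum[OF ind])
  also have "\<dots> = (\<Prod>j\<in>J. complex_of_real (exp (- (a j)\<^sup>2 / 2)))"
  proof (intro prod.cong refl)
    fix j
    have "char (distr N borel (\<lambda>\<omega>. a j * Z j \<omega>)) 1 = char (distr N borel (Z j)) (a j)"
      unfolding char_def by (subst (1 2) integral_distr) auto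
    then show "char (distr N borel (\<lambda>\<omega>. a j * Z j \<omega>)) 1 = complex_of_real (exp (- (a j)\<^sup>2 / 2))"
      by (simp add: distr_Z char_std_normal_distribution)
  qed
  also have "\<dots> = complex_of_real (exp (\<Sum>j\<in>J. - (a j)\<^sup>2 / 2))"
    using True by (simp add: exp_sum)
  finally show ?thesis by (simp add: sum_negf sum_divide_distrib)
qed (simp add: prob_space)

text \<open>The Hubbard--Stratonovich linearisation: \<open>exp (- w x\<^sup>2)\<close> is the expectation of \<open>exp (\<i> sqrt (2 w) x Z)\<close>,
  so Laplace transforms of quadratic forms reduce to characteristic functions of linear forms.\<close>
lemma expectation_exp_quadratic:
  fixes P :: "'c measure" and X :: "nat \<Rightarrow> 'c \<Rightarrow> real" and w c :: "nat \<Rightarrow> real"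
  assumes P: "prob_space P" and X [measurable]: "\<And>j. X j \<in> borel_measurable P" and w: "\<And>j. w j \<ge> 0"
  shows "(LINT \<omega>|N. iexp (\<Sum>j\<in>J. sqrt (2 * w j) * Z j \<omega> * c j) * (LINT x|P. iexp (\<Sum>j\<in>J. sqrt (2 * w j) * Z j \<omega> * X j x)))
       = complex_of_real (LINT x|P. exp (- (\<Sum>j\<in>J. w j * (X j x + c j)\<^sup>2)))"
proof -
  interpret P: prob_space P by (rule P)
  interpret PN: pair_prob_space P N ..
  define f where "f x \<omega> = iexp (\<Sum>j\<in>J. (sqrt (2 * w j) * (X j x + c j)) * Z j \<omega>)" for x \<omega>
  have int: "integrable (P \<Otimes>\<^sub>M N) (case_prod f)"
    unfolding f_def by (rule PN.P.integrable_const_bound[of _ 1]) auto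
  have 1: "(LINT x|P. f x \<omega>) = iexp (\<Sum>j\<in>J. sqrt (2 * w j) * Z j \<omega> * c j) * (LINT x|P. iexp (\<Sum>j\<in>J. sqrt (2 * w j) * Z j \<omega> * X j x))" for \<omega>
  proof -
    have "f x \<omega> = iexp (\<Sum>j\<in>J. sqrt (2 * w j) * Z j \<omega> * c j) * iexp (\<Sum>j\<in>J. sqrt (2 * w j) * Z j \<omega> * X j x)" for x
      unfolding f_def exp_add[symmetric] distrib_left[symmetric] of_real_add[symmetric] sum.distrib[symmetric]
      by (simp add: algebra_simps)
    then show ?thesis by simp
  qed
  have 2: "(LINT \<omega>|N. f x \<omega>) = complex_of_real (exp (- (\<Sum>j\<in>J. w j * (X j x + c j)\<^sup>2)))" for x
    unfolding f_def expectation_iexp_linear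
    by (simp add: power_mult_distrib w sum_divide_distrib)
  have "(LINT \<omega>|N. LINT x|P. f x \<omega>) = (LINT x|P. LINT \<omega>|N. f x \<omega>)"
    by (rule PN.Fubini_integral[OF int])
  then show ?thesis by (simp add: 1 2)
qed

end

section \<open>From Laplace transforms to probabilities of sublevel sets\<close>

lemma expectation_prod_uniform_approx:
  fixes Q :: "'a measure" and T :: "nat \<Rightarrow> 'a \<Rightarrow> real" and p g :: "real \<Rightarrow> real" and d :: real
  assumes Q: "prob_space Q" and T [measurable]: "\<And>k. T k \<in> borel_measurable Q" and T01: "\<And>k x. T k x \<in> {0..1}"
    and gm [measurable]: "g \<in> borel_measurable borel" and g1: "\<And>x. \<bar>g x\<bar> \<le> 1"
    and pm [measurable]: "p \<in> borel_measurable borel" and p1: "\<And>x. x \<in> {0..1} \<Longrightarrow> \<bar>p x\<bar> \<le> 1"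
    and gp: "\<And>x. x \<in> {0..1} \<Longrightarrow> \<bar>g x - p x\<bar> \<le> d"
  shows "\<bar>(LINT x|Q. (\<Prod>k\<in>K. g (T k x))) - (LINT x|Q. (\<Prod>k\<in>K. p (T k x)))\<bar> \<le> real (card K) * d"
proof -
  interpret Q: prob_space Q by (rule Q)
  have ig: "integrable Q (\<lambda>x. \<Prod>k\<in>K. g (T k x))"
    by (rule Q.integrable_const_bound[of _ 1]) (auto simp: abs_prod intro!: prod_le_1 g1)
  have ip: "integrable Q (\<lambda>x. \<Prod>k\<in>K. p (T k x))"
    by (rule Q.integrable_const_bound[of _ 1]) (auto simp: abs_prod intro!: prod_le_1 p1 T01)
  have pt: "\<bar>(\<Prod>k\<in>K. g (T k x)) - (\<Prod>k\<in>K. p (T k x))\<bar> \<le> real (card K) * d" for x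
  proof -
    have "norm ((\<Prod>k\<in>K. g (T k x)) - (\<Prod>k\<in>K. p (T k x))) \<le> (\<Sum>k\<in>K. norm (g (T k x) - p (T k x)))"
      by (rule norm_prod_diff) (use g1 p1 T01 in auto)
    also have "\<dots> \<le> (\<Sum>k\<in>K. d)" by (intro sum_mono) (use gp T01 in auto)
    finally show ?thesis by simp
  qed
  have "(LINT x|Q. (\<Prod>k\<in>K. g (T k x))) - (LINT x|Q. (\<Prod>k\<in>K. p (T k x))) = (LINT x|Q. (\<Prod>k\<in>K. g (T k x)) - (\<Prod>k\<in>K. p (T k x)))"
    using ig ip by simp
  also have "\<bar>\<dots>\<bar> \<le> (LINT x|Q. \<bar>(\<Prod>k\<in>K. g (T k x)) - (\<Prod>k\<in>K. p (T k x))\<bar>)" by (rule integral_abs_bound)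
  also have "\<dots> \<le> (LINT x|Q. real (card K) * d)"
    by (rule integral_mono) (use ig ip pt in auto)
  finally show ?thesis by (simp add: Q.prob_space)
qed

lemma expectation_prod_polynomial:
  fixes Q :: "'a measure" and T :: "nat \<Rightarrow> 'a \<Rightarrow> real" and a :: "nat \<Rightarrow> real"
  assumes K: "finite K" and Q: "prob_space Q"
    and T [measurable]: "\<And>k. T k \<in> borel_measurable Q" and T01: "\<And>k x. T k x \<in> {0..1}"
  shows "(LINT x|Q. (\<Prod>k\<in>K. \<Sum>i\<le>d. a i * T k x ^ i)) = (\<Sum>r\<in>K \<rightarrow>\<^sub>E {..d}. (\<Prod>k\<in>K. a (r k)) * (LINT x|Q. (\<Prod>k\<in>K. T k x ^ r k)))"
proof -
  interpret Q: prob_space Q by (rule Q)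
  have "integrable Q (\<lambda>x. \<Prod>k\<in>K. T k x ^ r k)" for r
  proof (rule Q.integrable_const_bound[of _ 1])
    show "AE x in Q. norm (\<Prod>k\<in>K. T k x ^ r k) \<le> 1"
      using T01 by (intro AE_I2) (auto simp: abs_prod power_abs intro!: prod_le_1 power_le_one)
  qed simp
  then show ?thesis
    by (simp add: prod_sum_PiE[OF K] prod.distrib)
qed

text \<open>Mixed moments determine limits on the cube. Since the test functions are products,
  polynomial approximation of g in one variable is enough, and a product of polynomials is a finite
  combination of mixed moments.\<close>

lemma convergence_of_products:
  fixes Y :: "nat \<Rightarrow> nat \<Rightarrow> 'a \<Rightarrow> real" and Y' :: "nat \<Rightarrow> 'b \<Rightarrow> real" and g :: "real \<Rightarrow> real"
  assumes M: "prob_space M" and N: "prob_space N" and K: "finite K"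
    and Ym [measurable]: "\<And>n k. Y n k \<in> borel_measurable M" and Y'm [measurable]: "\<And>k. Y' k \<in> borel_measurable N"
    and Y: "\<And>n k x. Y n k x \<in> {0..1}" and Y': "\<And>k x. Y' k x \<in> {0..1}"
    and mom: "\<And>r. (\<lambda>n. LINT x|M. (\<Prod>k\<in>K. Y n k x ^ r k)) \<longlonglongrightarrow> (LINT x|N. (\<Prod>k\<in>K. Y' k x ^ r k))"
    and g: "continuous_on UNIV g" and g1: "\<And>x. \<bar>g x\<bar> \<le> 1"
  shows "(\<lambda>n. LINT x|M. (\<Prod>k\<in>K. g (Y n k x))) \<longlonglongrightarrow> (LINT x|N. (\<Prod>k\<in>K. g (Y' k x)))"
proof -
  interpret M: prob_space M by (rule M)
  interpret N: prob_space N by (rule N)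
  have gm [measurable]: "g \<in> borel_measurable borel" using g by (rule borel_measurable_continuous_onI)
  have poly: "(\<lambda>n. LINT x|M. (\<Prod>k\<in>K. \<Sum>i\<le>d. a i * Y n k x ^ i)) \<longlonglongrightarrow> (LINT x|N. (\<Prod>k\<in>K. \<Sum>i\<le>d. a i * Y' k x ^ i))" for a :: "nat \<Rightarrow> real" and d :: nat
  proof -
    show ?thesis
      unfolding expectation_prod_polynomial[OF K M Ym Y] expectation_prod_polynomial[OF K N Y'm Y']
      by (intro tendsto_sum tendsto_mult tendsto_const mom)
  qed
  show ?thesis
  proof (rule LIMSEQ_I)
    fix e :: real assume e: "e > 0"
    define d where "d = e / (8 * (real (card K) + 1))"
    have d: "d > 0" using e by (simp add: d_def)
    have de: "real (card K) * (2 * d) \<le> e / 4"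
    proof -
      have "real (card K) * (2 * d) \<le> (real (card K) + 1) * (2 * d)" using d by (intro mult_right_mono) auto
      moreover have "(real (card K) + 1) * d = e / 8" by (simp add: d_def divide_simps)
      ultimately show ?thesis by linarith
    qed
    have "continuous_on {0..1} g" using g continuous_on_subset by blast
    then obtain q where q: "real_polynomial_function q" "\<And>x. x \<in> {0..1} \<Longrightarrow> \<bar>g x - q x\<bar> < d"
      using Stone_Weierstrass_real_polynomial_function[of "{0..1::real}" g d] d by auto
    obtain a0 m where a0: "q = (\<lambda>x. \<Sum>i\<le>m. a0 i * x ^ i)"
      using q(1) real_polynomial_function_imp_sum by blast
    \<comment> \<open>Division by 1 + d brings the polynomial into [-1, 1], as the comparison of
      products requires factors bounded by 1; the error at most doubles.\<close>
    define p where "p x = (\<Sum>i\<le>m. (a0 i / (1 + d)) * x ^ i)" for x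
    have p_eq: "p x = q x / (1 + d)" for x by (simp add: p_def a0 sum_divide_distrib)
    have p1: "\<bar>p x\<bar> \<le> 1" if "x \<in> {0..1}" for x
    proof -
      have "\<bar>q x\<bar> \<le> 1 + d" using q(2)[OF that] g1[of x] by linarith
      then show ?thesis using d by (simp add: p_eq)
    qed
    have gp: "\<bar>g x - p x\<bar> \<le> 2 * d" if "x \<in> {0..1}" for x
    proof -
      have "g x - p x = ((g x - q x) + d * g x) / (1 + d)" using d by (simp add: p_eq field_simps)
      also have "\<bar>\<dots>\<bar> \<le> \<bar>(g x - q x) + d * g x\<bar> / 1" using d unfolding abs_divide by (intro divide_left_mono) auto
      also have "\<dots> \<le> \<bar>g x - q x\<bar> + d * \<bar>g x\<bar>" using d by (simp add: abs_mult order_trans[OF abs_triangle_ineq])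
      also have "\<dots> \<le> d + d * 1" using q(2)[OF that] g1[of x] d by (intro add_mono mult_left_mono) auto
      finally show ?thesis by simp
    qed
    have pm: "p \<in> borel_measurable borel" unfolding p_def by measurable
    have "(\<lambda>n. LINT x|M. (\<Prod>k\<in>K. p (Y n k x))) \<longlonglongrightarrow> (LINT x|N. (\<Prod>k\<in>K. p (Y' k x)))"
      unfolding p_def by (rule poly)
    then obtain n0 where n0: "\<And>n. n \<ge> n0 \<Longrightarrow> norm ((LINT x|M. (\<Prod>k\<in>K. p (Y n k x))) - (LINT x|N. (\<Prod>k\<in>K. p (Y' k x)))) < e / 4"
      using LIMSEQ_D[of _ _ "e / 4"] e by (metis zero_less_divide_iff zero_less_numeral)
    show "\<exists>n0. \<forall>n\<ge>n0. norm ((LINT x|M. (\<Prod>k\<in>K. g (Y n k x))) - (LINT x|N. (\<Prod>k\<in>K. g (Y' k x)))) < e"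
    proof (intro exI allI impI)
      fix n assume "n \<ge> n0"
      from n0[OF this] expectation_prod_uniform_approx[OF M, of "Y n", OF Ym Y gm g1 pm p1 gp, of K] expectation_prod_uniform_approx[OF N, of Y', OF Y'm Y' gm g1 pm p1 gp, of K] de e
      show "norm ((LINT x|M. (\<Prod>k\<in>K. g (Y n k x))) - (LINT x|N. (\<Prod>k\<in>K. g (Y' k x)))) < e"
        unfolding real_norm_def by linarith
    qed
  qed
qed

text \<open>A continuous cutoff, decreasing in x from 1 at a to 0 at b, but written in the variable
  y = exp (- x). That variable maps the half-line into [0, 1], where Laplace transforms at integer
  arguments become moments.\<close>

definition cutoff :: "real \<Rightarrow> real \<Rightarrow> real \<Rightarrow> real" where
  "cutoff a b y = max 0 (min 1 ((y - exp (- b)) / (exp (- a) - exp (- b))))"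

lemma
  assumes "a < b"
  shows cutoff_continuous: "continuous_on UNIV (cutoff a b)"
    and cutoff_bounds: "0 \<le> cutoff a b y" "cutoff a b y \<le> 1"
    and cutoff_eq_1: "x \<le> a \<Longrightarrow> cutoff a b (exp (- x)) = 1"
    and cutoff_eq_0: "b \<le> x \<Longrightarrow> cutoff a b (exp (- x)) = 0"
proof -
  have pos: "exp (- a) - exp (- b) > 0" using assms by simp
  show "continuous_on UNIV (cutoff a b)" unfolding cutoff_def using pos by (intro continuous_intros) auto
  show "0 \<le> cutoff a b y" "cutoff a b y \<le> 1" by (auto simp: cutoff_def)
  show "cutoff a b (exp (- x)) = 1" if "x \<le> a"
  proof -
    have "exp (- a) - exp (- b) \<le> exp (- x) - exp (- b)" using that by simp
    then have "1 \<le> (exp (- x) - exp (- b)) / (exp (- a) - exp (- b))" using pos by (simp add: le_divide_eq)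
    then show ?thesis by (simp add: cutoff_def)
  qed
  show "cutoff a b (exp (- x)) = 0" if "b \<le> x"
  proof -
    have "(exp (- x) - exp (- b)) / (exp (- a) - exp (- b)) \<le> 0" using that pos by (simp add: divide_le_0_iff)
    then show ?thesis by (simp add: cutoff_def min_def)
  qed
qed

lemma cutoff_sandwich:
  fixes Q :: "'a measure" and T :: "nat \<Rightarrow> 'a \<Rightarrow> real"
  assumes ab: "a < b" and K: "finite K" and Q: "prob_space Q" and T [measurable]: "\<And>k. T k \<in> borel_measurable Q"
  defines "g \<equiv> cutoff a b"
  shows "measure Q {x\<in>space Q. \<forall>k\<in>K. T k x \<le> a} \<le> (LINT x|Q. (\<Prod>k\<in>K. g (exp (- T k x))))"
    and "(LINT x|Q. (\<Prod>k\<in>K. g (exp (- T k x)))) \<le> measure Q {x\<in>space Q. \<forall>k\<in>K. T k x < b}"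
proof -
  interpret Q: prob_space Q by (rule Q)
  have g01: "0 \<le> g y" "g y \<le> 1" for y using cutoff_bounds[OF ab] by (simp_all add: g_def)
  have ghi: "g (exp (- x)) = 1" if "x \<le> a" for x using cutoff_eq_1[OF ab that] by (simp add: g_def)
  have glo: "g (exp (- x)) = 0" if "b \<le> x" for x using cutoff_eq_0[OF ab that] by (simp add: g_def)
  have [measurable]: "g \<in> borel_measurable borel"
    unfolding g_def using cutoff_continuous[OF ab] by (rule borel_measurable_continuous_onI)
  have S [measurable]: "{x\<in>space Q. \<forall>k\<in>K. T k x \<le> a} \<in> sets Q" "{x\<in>space Q. \<forall>k\<in>K. T k x < b} \<in> sets Q"
    using K by measurable
  have ig: "integrable Q (\<lambda>x. \<Prod>k\<in>K. g (exp (- T k x)))"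
    by (rule Q.integrable_const_bound[of _ 1]) (use g01 in \<open>auto simp: abs_prod intro!: prod_le_1\<close>)
  have m: "measure Q A = (LINT x|Q. indicator A x)" if "A \<in> sets Q" for A
    using that sets.sets_into_space[OF that] by (simp add: Int_absorb2)
  show "measure Q {x\<in>space Q. \<forall>k\<in>K. T k x \<le> a} \<le> (LINT x|Q. (\<Prod>k\<in>K. g (exp (- T k x))))"
    unfolding m[OF S(1)]
  proof (rule integral_mono[OF _ ig])
    show "indicator {x\<in>space Q. \<forall>k\<in>K. T k x \<le> a} x \<le> (\<Prod>k\<in>K. g (exp (- T k x)))" for x
      using ghi g01 by (auto simp: indicator_def intro!: prod_nonneg)
  qed (simp add: less_top[symmetric])
  show "(LINT x|Q. (\<Prod>k\<in>K. g (exp (- T k x)))) \<le> measure Q {x\<in>space Q. \<forall>k\<in>K. T k x < b}"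
    unfolding m[OF S(2)]
  proof (rule integral_mono[OF ig])
    show "(\<Prod>k\<in>K. g (exp (- T k x))) \<le> indicator {x\<in>space Q. \<forall>k\<in>K. T k x < b} x" if x: "x \<in> space Q" for x
    proof (cases "\<forall>k\<in>K. T k x < b")
      case True
      then show ?thesis using g01 x by (auto simp: indicator_def intro!: prod_le_1)
    next
      case False
      then obtain k where "k \<in> K" "b \<le> T k x" by auto
      then have "(\<Prod>k\<in>K. g (exp (- T k x))) = 0" using K glo by (intro prod_zero) auto
      then show ?thesis by simp
    qed
  qed (simp add: less_top[symmetric])
qed

text \<open>Integer weights r suffice, because the corresponding Laplace transforms are the mixed
  moments of the variables exp (- q). The gap between a and b takes the place of a continuity
  requirement on the limit law.\<close>

lemma sublevel_sandwich:
  fixes q :: "nat \<Rightarrow> nat \<Rightarrow> 'a \<Rightarrow> real" and q' :: "nat \<Rightarrow> 'b \<Rightarrow> real"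
  assumes M: "prob_space M" and N: "prob_space N" and K: "finite K"
    and qm [measurable]: "\<And>n k. q n k \<in> borel_measurable M" and q'm [measurable]: "\<And>k. q' k \<in> borel_measurable N"
    and q: "\<And>n k x. q n k x \<ge> 0" and q': "\<And>k x. q' k x \<ge> 0"
    and lap: "\<And>r :: nat \<Rightarrow> nat. (\<lambda>n. LINT x|M. exp (- (\<Sum>k\<in>K. real (r k) * q n k x))) \<longlonglongrightarrow> (LINT x|N. exp (- (\<Sum>k\<in>K. real (r k) * q' k x)))"
    and ab: "a < b" and e: "e > 0"
  shows "\<forall>\<^sub>F n in sequentially. measure M {x\<in>space M. \<forall>k\<in>K. q n k x \<le> a} \<le> measure N {x\<in>space N. \<forall>k\<in>K. q' k x < b} + e"
    and "\<forall>\<^sub>F n in sequentially. measure N {x\<in>space N. \<forall>k\<in>K. q' k x \<le> a} - e \<le> measure M {x\<in>space M. \<forall>k\<in>K. q n k x < b}"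
proof -
  interpret M: prob_space M by (rule M)
  interpret N: prob_space N by (rule N)
  define g where "g = cutoff a b"
  have gc: "continuous_on UNIV g" using cutoff_continuous[OF ab] by (simp add: g_def)
  have g01: "0 \<le> g y" "g y \<le> 1" for y using cutoff_bounds[OF ab] by (simp_all add: g_def)
  have conv: "(\<lambda>n. LINT x|M. (\<Prod>k\<in>K. g (exp (- q n k x)))) \<longlonglongrightarrow> (LINT x|N. (\<Prod>k\<in>K. g (exp (- q' k x))))"
  proof (rule convergence_of_products[OF M N K _ _ _ _ _ gc])
    fix r :: "nat \<Rightarrow> nat"
    have "(\<Prod>k\<in>K. exp (- t k) ^ r k) = exp (- (\<Sum>k\<in>K. real (r k) * t k))" for t :: "nat \<Rightarrow> real"
      using K by (simp add: exp_sum[symmetric] exp_of_nat_mult[symmetric] sum_negf[symmetric])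
    then show "(\<lambda>n. LINT x|M. (\<Prod>k\<in>K. exp (- q n k x) ^ r k)) \<longlonglongrightarrow> (LINT x|N. (\<Prod>k\<in>K. exp (- q' k x) ^ r k))"
      using lap[of r] by simp
  qed (use q q' g01 in \<open>auto simp: abs_le_iff\<close>)
  from tendstoD[OF conv e]
  show "\<forall>\<^sub>F n in sequentially. measure M {x\<in>space M. \<forall>k\<in>K. q n k x \<le> a} \<le> measure N {x\<in>space N. \<forall>k\<in>K. q' k x < b} + e"
  proof eventually_elim
    case (elim n)
    with cutoff_sandwich(1)[OF ab K M, of "q n", OF qm, folded g_def] cutoff_sandwich(2)[OF ab K N, of q', OF q'm, folded g_def]
    show ?case unfolding dist_real_def by linarith
  qed
  from tendstoD[OF conv e]
  show "\<forall>\<^sub>F n in sequentially. measure N {x\<in>space N. \<forall>k\<in>K. q' k x \<le> a} - e \<le> measure M {x\<in>space M. \<forall>k\<in>K. q n k x < b}"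
  proof eventually_elim
    case (elim n)
    with cutoff_sandwich(2)[OF ab K M, of "q n", OF qm, folded g_def] cutoff_sandwich(1)[OF ab K N, of q', OF q'm, folded g_def]
    show ?case unfolding dist_real_def by linarith
  qed
qed

section \<open>Central limit theorem for the linear part\<close>

definition mean_square :: "(nat \<Rightarrow> real) \<Rightarrow> nat \<Rightarrow> real" where
  "mean_square v k = (1 / real k) * (\<Sum>j=1..k. (v j)\<^sup>2)"

lemma mean_square_nonneg: "mean_square v k \<ge> 0"
  by (simp add: mean_square_def sum_nonneg)

lemma mean_square_measurable [measurable (raw)]:
  "(\<And>j. (\<lambda>x. v x j) \<in> borel_measurable M) \<Longrightarrow> (\<lambda>x. mean_square (v x) k) \<in> borel_measurable M"
  unfolding mean_square_def by measurable

text \<open>Exchanging the sums collects on (v j)^2 the total of r k / k over k \<ge> j. The joint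
  Laplace transform of the running averages thereby becomes that of a diagonal quadratic
  form.\<close>

lemma weighted_mean_squares:
  fixes r :: "nat \<Rightarrow> real"
  shows "(\<Sum>k=1..m. r k * mean_square v k) = (\<Sum>j=1..m. (\<Sum>k=1..m. if j \<le> k then r k / real k else 0) * (v j)\<^sup>2)"
proof -
  have "(\<Sum>k=1..m. r k * mean_square v k) = (\<Sum>k=1..m. \<Sum>j=1..m. (if j \<le> k then r k / real k else 0) * (v j)\<^sup>2)"
  proof (intro sum.cong refl)
    fix k assume "k \<in> {1..m}"
    then have "(\<Sum>j=1..k. (v j)\<^sup>2) = (\<Sum>j=1..m. if j \<le> k then (v j)\<^sup>2 else 0)"
      by (intro sum.mono_neutral_cong_left) auto
    then have "r k * mean_square v k = (\<Sum>j=1..m. r k * (1 / real k) * (if j \<le> k then (v j)\<^sup>2 else 0))"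
      by (simp only: mean_square_def sum_distrib_left mult.assoc)
    also have "\<dots> = (\<Sum>j=1..m. (if j \<le> k then r k / real k else 0) * (v j)\<^sup>2)"
      by (intro sum.cong refl) simp
    finally show "r k * mean_square v k = (\<Sum>j=1..m. (if j \<le> k then r k / real k else 0) * (v j)\<^sup>2)" .
  qed
  also have "\<dots> = (\<Sum>j=1..m. \<Sum>k=1..m. (if j \<le> k then r k / real k else 0) * (v j)\<^sup>2)" by (rule sum.swap)
  finally show ?thesis by (simp only: sum_distrib_right)
qed

lemma exp_minus_second_order:
  fixes x :: real
  assumes "x \<ge> 0"
  shows "\<bar>exp (- x) - (1 - x)\<bar> \<le> x\<^sup>2"
proof -
  have "1 - x \<le> exp (- x)" using exp_ge_add_one_self[of "- x"] by simp
  moreover have "exp (- x) \<le> 1 / (1 + x)"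
    using exp_ge_add_one_self[of x] assms by (simp add: exp_minus inverse_eq_divide frac_le)
  moreover have "1 / (1 + x) \<le> 1 - x + x\<^sup>2"
  proof -
    have "1 \<le> (1 - x + x\<^sup>2) * (1 + x)" using assms by (simp add: algebra_simps power2_eq_square)
    then show ?thesis using assms by (simp add: divide_le_eq)
  qed
  ultimately show ?thesis by (simp add: abs_le_iff)
qed

context rank_sample
begin

text \<open>Both functions agree with 1 - a^2 / 24 to second order, as the variance is 1/12. Every
  term of the bound contains a^2, which will be summed over i, times a factor that is uniformly
  small.\<close>

lemma char_\<zeta>_approx: "cmod (char (distr M borel (\<zeta> i)) a - complex_of_real (exp (- a\<^sup>2 / 24))) \<le> \<bar>a\<bar>^3 + a^4"
proof -
  have i1: "integrable M (\<zeta> i)" by (rule integrable_bounded[OF \<zeta>_measurable \<zeta>_bound])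
  have z2: "(\<zeta> i \<omega>)\<^sup>2 \<le> 1" for \<omega> using power_mono[OF \<zeta>_bound abs_ge_zero, of i \<omega> 2] by (simp add: power2_eq_square)
  have z3: "\<bar>\<zeta> i \<omega>\<bar>^3 \<le> 1" for \<omega> using \<zeta>_bound[of i \<omega>] by (intro power_le_one) auto
  have i2: "integrable M (\<lambda>\<omega>. (\<zeta> i \<omega>)\<^sup>2)" by (rule integrable_bounded[of _ 1]) (auto simp: z2)
  have "cmod (char (distr M borel (\<zeta> i)) a - (1 - a\<^sup>2 * (1 / 12) / 2)) \<le> (a\<^sup>2 / 6) * (LINT \<omega>|M. min (6 * (\<zeta> i \<omega>)\<^sup>2) (\<bar>a\<bar> * \<bar>\<zeta> i \<omega>\<bar>^3))"
    using char_approx3'[OF \<zeta>_measurable i1 i2 expectation_\<zeta>(1) _ refl, of "1/12" a] i1 i2 expectation_\<zeta>[of i] by simp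
  also have "\<dots> \<le> (a\<^sup>2 / 6) * (LINT \<omega>|M. \<bar>a\<bar>)"
  proof (intro mult_left_mono integral_mono)
    show "min (6 * (\<zeta> i \<omega>)\<^sup>2) (\<bar>a\<bar> * \<bar>\<zeta> i \<omega>\<bar>^3) \<le> \<bar>a\<bar>" for \<omega>
      using mult_left_mono[OF z3[of \<omega>] abs_ge_zero[of a]] by simp
    show "integrable M (\<lambda>\<omega>. min (6 * (\<zeta> i \<omega>)\<^sup>2) (\<bar>a\<bar> * \<bar>\<zeta> i \<omega>\<bar>^3))"
      by (rule integrable_bounded[of _ "\<bar>a\<bar>"])
        (use mult_left_mono[OF z3 abs_ge_zero[of a]] in \<open>auto intro: min.coboundedI2\<close>)
  qed auto
  also have "\<dots> \<le> \<bar>a\<bar>^3"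
  proof -
    have "\<bar>a\<bar>^3 = a\<^sup>2 * \<bar>a\<bar>" by (cases "a \<ge> 0") (simp_all add: power3_eq_cube power2_eq_square)
    moreover have "a\<^sup>2 / 6 * \<bar>a\<bar> \<le> a\<^sup>2 * \<bar>a\<bar>" by (intro mult_right_mono) auto
    ultimately show ?thesis by (simp add: prob_space)
  qed
  finally have 1: "cmod (char (distr M borel (\<zeta> i)) a - (1 - a\<^sup>2 * (1 / 12) / 2)) \<le> \<bar>a\<bar>^3" .
  have "cmod ((1 - a\<^sup>2 * (1 / 12) / 2) - complex_of_real (exp (- a\<^sup>2 / 24))) = \<bar>exp (- (a\<^sup>2 / 24)) - (1 - a\<^sup>2 / 24)\<bar>"
  proof -
    have "(1 - a\<^sup>2 * (1 / 12) / 2) - complex_of_real (exp (- a\<^sup>2 / 24)) = complex_of_real ((1 - a\<^sup>2 / 24) - exp (- (a\<^sup>2 / 24)))"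
      by simp
    then show ?thesis by (simp only: norm_of_real)
  qed
  also have "\<dots> \<le> (a\<^sup>2 / 24)\<^sup>2" by (rule exp_minus_second_order) simp
  also have "\<dots> \<le> a^4" by (simp add: power_divide)
  finally have 2: "cmod ((1 - a\<^sup>2 * (1 / 12) / 2) - complex_of_real (exp (- a\<^sup>2 / 24))) \<le> a^4" .
  have "char (distr M borel (\<zeta> i)) a - complex_of_real (exp (- a\<^sup>2 / 24)) =
    (char (distr M borel (\<zeta> i)) a - (1 - a\<^sup>2 * (1 / 12) / 2)) + ((1 - a\<^sup>2 * (1 / 12) / 2) - complex_of_real (exp (- a\<^sup>2 / 24)))"
    by simp
  also have "cmod \<dots> \<le> \<bar>a\<bar>^3 + a^4" by (rule order_trans[OF norm_triangle_ineq add_mono[OF 1 2]])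
  finally show ?thesis .
qed

text \<open>Orthogonality of the cosines makes the sum of (a i)^2 exactly 12 times the sum of (l
  j)^2, so the Gaussian side factorises over i without discretisation error. The factors are then
  compared one by one, with \<eta> bounding every coefficient a i.\<close>

lemma char_V_bound:
  fixes l :: "nat \<Rightarrow> real"
  assumes "m < n"
  defines "\<eta> \<equiv> sqrt (24 / real n) * (\<Sum>j=1..m. \<bar>l j\<bar>)"
  shows "cmod ((LINT \<omega>|M. iexp (\<Sum>j=1..m. l j * V n j \<omega>)) - complex_of_real (exp (- (\<Sum>j=1..m. (l j)\<^sup>2) / 2)))
     \<le> (\<eta> + \<eta>\<^sup>2) * (12 * (\<Sum>j=1..m. (l j)\<^sup>2))"
proof -
  define c where "c j i = cos (pi * real j * xpt n i)" for j i
  define a where "a i = sqrt (24 / real n) * (\<Sum>j=1..m. l j * c j i)" for i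
  have n: "real n > 0" using assms by simp
  have sq24: "(sqrt (24 / real n))\<^sup>2 = 24 / real n" by (rule real_sqrt_pow2) simp
  have lin: "(\<Sum>j=1..m. l j * V n j \<omega>) = (\<Sum>i=1..n. a i * \<zeta> i \<omega>)" for \<omega>
  proof -
    have "(\<Sum>j=1..m. l j * V n j \<omega>) = (\<Sum>j=1..m. \<Sum>i=1..n. sqrt (24 / real n) * (l j * c j i * \<zeta> i \<omega>))"
      by (intro sum.cong refl) (simp add: V_def c_def sum_distrib_left algebra_simps)
    also have "\<dots> = (\<Sum>i=1..n. \<Sum>j=1..m. sqrt (24 / real n) * (l j * c j i * \<zeta> i \<omega>))" by (rule sum.swap)
    also have "\<dots> = (\<Sum>i=1..n. a i * \<zeta> i \<omega>)"
      by (intro sum.cong refl) (simp add: a_def sum_distrib_left sum_distrib_right mult_ac)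
    finally show ?thesis .
  qed
  have a2: "(\<Sum>i=1..n. (a i)\<^sup>2) = 12 * (\<Sum>j=1..m. (l j)\<^sup>2)"
  proof -
    have "(\<Sum>i=1..n. (a i)\<^sup>2) = 24 / real n * (\<Sum>i=1..n. \<Sum>j=1..m. \<Sum>k=1..m. l j * l k * (c j i * c k i))"
      unfolding a_def power_mult_distrib sq24 sum_distrib_left[symmetric]
      by (intro arg_cong2[where f="(*)"] sum.cong refl) (simp add: power2_eq_square sum_product algebra_simps)
    also have "(\<Sum>i=1..n. \<Sum>j=1..m. \<Sum>k=1..m. l j * l k * (c j i * c k i)) = (\<Sum>j=1..m. \<Sum>k=1..m. \<Sum>i=1..n. l j * l k * (c j i * c k i))"
      by (subst sum.swap) (intro sum.cong refl sum.swap)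
    also have "\<dots> = (\<Sum>j=1..m. \<Sum>k=1..m. if j = k then (l j)\<^sup>2 * (real n / 2) else 0)"
    proof (intro sum.cong refl)
      fix j k assume jk: "j \<in> {1..m}" "k \<in> {1..m}"
      have "(\<Sum>i=1..n. c j i * c k i) = (if j = k then real n / 2 else 0)"
        unfolding c_def using jk assms by (intro cos_midpoints_orthogonal) auto
      then show "(\<Sum>i=1..n. l j * l k * (c j i * c k i)) = (if j = k then (l j)\<^sup>2 * (real n / 2) else 0)"
        unfolding sum_distrib_left[symmetric] by (simp add: power2_eq_square)
    qed
    also have "\<dots> = (\<Sum>j=1..m. (l j)\<^sup>2) * (real n / 2)" by (simp add: sum_distrib_right)
    finally show ?thesis using n by simp
  qed
  have ab: "\<bar>a i\<bar> \<le> \<eta>" for i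
  proof -
    have "\<bar>\<Sum>j=1..m. l j * c j i\<bar> \<le> (\<Sum>j=1..m. \<bar>l j\<bar> * 1)"
    proof (intro order_trans[OF sum_abs] sum_mono)
      show "\<bar>l j * c j i\<bar> \<le> \<bar>l j\<bar> * 1" for j
        unfolding abs_mult c_def by (intro mult_left_mono abs_cos_le_one) auto
    qed
    then have "sqrt (24 / real n) * \<bar>\<Sum>j=1..m. l j * c j i\<bar> \<le> sqrt (24 / real n) * (\<Sum>j=1..m. \<bar>l j\<bar> * 1)"
      by (intro mult_left_mono) auto
    then show ?thesis by (simp add: a_def \<eta>_def abs_mult)
  qed
  have \<eta>0: "\<eta> \<ge> 0" unfolding \<eta>_def by (intro mult_nonneg_nonneg sum_nonneg) auto
  have ind: "indep_vars (\<lambda>_. borel) (\<lambda>i \<omega>. a i * \<zeta> i \<omega>) {1..n}"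
    unfolding \<zeta>_def
    by (rule indep_vars_compose2[where M' = "\<lambda>_. borel" and X = eps and Y = "\<lambda>i x. a i * (F x - 1 / 2)", OF indep_vars_subset[OF eps_indep]]) auto
  have "(LINT \<omega>|M. iexp (\<Sum>j=1..m. l j * V n j \<omega>)) = char (distr M borel (\<lambda>\<omega>. \<Sum>i\<in>{1..n}. a i * \<zeta> i \<omega>)) 1"
    unfolding char_def lin by (subst integral_distr) auto
  also have "\<dots> = (\<Prod>i\<in>{1..n}. char (distr M borel (\<lambda>\<omega>. a i * \<zeta> i \<omega>)) 1)"
    by (rule char_distr_sum[OF ind])
  also have "\<dots> = (\<Prod>i\<in>{1..n}. char (distr M borel (\<zeta> i)) (a i))"
    unfolding char_def by (intro prod.cong refl) (subst (1 2) integral_distr; simp)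
  finally have 1: "(LINT \<omega>|M. iexp (\<Sum>j=1..m. l j * V n j \<omega>)) = (\<Prod>i\<in>{1..n}. char (distr M borel (\<zeta> i)) (a i))" .
  have 2: "complex_of_real (exp (- (\<Sum>j=1..m. (l j)\<^sup>2) / 2)) = (\<Prod>i\<in>{1..n}. complex_of_real (exp (- (a i)\<^sup>2 / 24)))"
  proof -
    have "- (\<Sum>j=1..m. (l j)\<^sup>2) / 2 = (\<Sum>i=1..n. - (a i)\<^sup>2 / 24)"
      using a2 by (simp add: sum_negf sum_divide_distrib[symmetric])
    then show ?thesis by (simp add: exp_sum)
  qed
  have "cmod ((\<Prod>i\<in>{1..n}. char (distr M borel (\<zeta> i)) (a i)) - (\<Prod>i\<in>{1..n}. complex_of_real (exp (- (a i)\<^sup>2 / 24))))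
      \<le> (\<Sum>i\<in>{1..n}. cmod (char (distr M borel (\<zeta> i)) (a i) - complex_of_real (exp (- (a i)\<^sup>2 / 24))))"
  proof (rule norm_prod_diff)
    show "cmod (char (distr M borel (\<zeta> i)) (a i)) \<le> 1" for i
      by (intro real_distribution.cmod_char_le_1 real_distribution_distr) auto
  qed simp
  also have "\<dots> \<le> (\<Sum>i\<in>{1..n}. (\<eta> + \<eta>\<^sup>2) * (a i)\<^sup>2)"
  proof (rule sum_mono)
    fix i
    have "\<bar>a i\<bar>^3 + (a i)^4 = (\<bar>a i\<bar> + \<bar>a i\<bar>\<^sup>2) * (a i)\<^sup>2"
      by (simp add: power3_eq_cube power4_eq_xxxx power2_eq_square algebra_simps)
    also have "\<dots> \<le> (\<eta> + \<eta>\<^sup>2) * (a i)\<^sup>2" using power_mono[OF ab abs_ge_zero, of i 2] ab[of i] by (intro mult_right_mono add_mono) auto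
    finally show "cmod (char (distr M borel (\<zeta> i)) (a i) - complex_of_real (exp (- (a i)\<^sup>2 / 24))) \<le> (\<eta> + \<eta>\<^sup>2) * (a i)\<^sup>2"
      using char_\<zeta>_approx[of i "a i"] by linarith
  qed
  also have "\<dots> = (\<eta> + \<eta>\<^sup>2) * (12 * (\<Sum>j=1..m. (l j)\<^sup>2))" by (simp only: sum_distrib_left[symmetric] a2)
  finally show ?thesis by (simp only: 1 2)
qed

lemma char_V_tendsto:
  "(\<lambda>n. LINT \<omega>|M. iexp (\<Sum>j=1..m. l j * V n j \<omega>)) \<longlonglongrightarrow> complex_of_real (exp (- (\<Sum>j=1..m. (l j)\<^sup>2) / 2))"
proof (rule Lim_null[THEN iffD2, OF Lim_null_comparison])
  let ?\<eta> = "\<lambda>n. sqrt (24 / real n) * (\<Sum>j=1..m. \<bar>l j\<bar>)"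
  show "\<forall>\<^sub>F n in sequentially. cmod ((LINT \<omega>|M. iexp (\<Sum>j=1..m. l j * V n j \<omega>)) - complex_of_real (exp (- (\<Sum>j=1..m. (l j)\<^sup>2) / 2)))
     \<le> (?\<eta> n + (?\<eta> n)\<^sup>2) * (12 * (\<Sum>j=1..m. (l j)\<^sup>2))"
    using eventually_gt_at_top[of m] by eventually_elim (rule char_V_bound)
  have "(\<lambda>n. 24 / real n) \<longlonglongrightarrow> 0" by (rule lim_const_over_n)
  then have "(\<lambda>n. sqrt (24 / real n)) \<longlonglongrightarrow> sqrt 0" by (rule tendsto_real_sqrt)
  then have "?\<eta> \<longlonglongrightarrow> 0" by (intro tendsto_mult_left_zero) simp
  then have "(\<lambda>n. (?\<eta> n + (?\<eta> n)\<^sup>2) * (12 * (\<Sum>j=1..m. (l j)\<^sup>2))) \<longlonglongrightarrow> (0 + 0\<^sup>2) * (12 * (\<Sum>j=1..m. (l j)\<^sup>2))"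
    by (intro tendsto_intros)
  then show "(\<lambda>n. (?\<eta> n + (?\<eta> n)\<^sup>2) * (12 * (\<Sum>j=1..m. (l j)\<^sup>2))) \<longlonglongrightarrow> 0" by simp
qed

text \<open>After linearisation the transform is an average over \<omega> of characteristic
  functions of linear forms in V with coefficients depending on \<omega>. These converge pointwise
  and are bounded by 1.\<close>

lemma laplace_V_tendsto:
  fixes N :: "'b measure" and Z :: "nat \<Rightarrow> 'b \<Rightarrow> real" and w c :: "nat \<Rightarrow> real"
  assumes NZ: "normal_sequence N Z" and w: "\<And>j. w j \<ge> 0"
  shows "(\<lambda>n. LINT x|M. exp (- (\<Sum>j=1..m. w j * (V n j x + c j)\<^sup>2))) \<longlonglongrightarrow> (LINT \<omega>|N. exp (- (\<Sum>j=1..m. w j * (Z j \<omega> + c j)\<^sup>2)))"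
proof -
  interpret N: normal_sequence N Z by (rule NZ)
  define A where "A \<omega> = iexp (\<Sum>j=1..m. sqrt (2 * w j) * Z j \<omega> * c j)" for \<omega>
  define ch where "ch n \<omega> = (LINT x|M. iexp (\<Sum>j=1..m. sqrt (2 * w j) * Z j \<omega> * V n j x))" for n \<omega>
  \<comment> \<open>Z plays two roles: with the outer \<omega> it supplies the random coefficients
    of the linearisation, with the inner x it is the limit of V.\<close>
  define ch' where "ch' \<omega> = (LINT x|N. iexp (\<Sum>j=1..m. sqrt (2 * w j) * Z j \<omega> * Z j x))" for \<omega>
  have "(\<lambda>n. LINT \<omega>|N. A \<omega> * ch n \<omega>) \<longlonglongrightarrow> (LINT \<omega>|N. A \<omega> * ch' \<omega>)"
  proof (rule integral_dominated_convergence[where w = "\<lambda>_. 1"])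
    show "(\<lambda>\<omega>. A \<omega> * ch' \<omega>) \<in> borel_measurable N" unfolding A_def ch'_def by measurable
    show "(\<lambda>\<omega>. A \<omega> * ch n \<omega>) \<in> borel_measurable N" for n unfolding A_def ch_def by measurable
    show "AE \<omega> in N. (\<lambda>n. A \<omega> * ch n \<omega>) \<longlonglongrightarrow> A \<omega> * ch' \<omega>"
      unfolding ch_def ch'_def N.expectation_iexp_linear
      by (intro AE_I2 tendsto_mult tendsto_const char_V_tendsto)
    show "AE \<omega> in N. norm (A \<omega> * ch n \<omega>) \<le> 1" for n
    proof (rule AE_I2)
      fix \<omega>
      have "cmod (ch n \<omega>) \<le> (LINT x|M. cmod (iexp (\<Sum>j=1..m. sqrt (2 * w j) * Z j \<omega> * V n j x)))"
        unfolding ch_def by (rule integral_norm_bound)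
      then have "cmod (ch n \<omega>) \<le> 1" by (simp add: prob_space)
      then show "norm (A \<omega> * ch n \<omega>) \<le> 1" by (simp add: A_def norm_mult)
    qed
  qed simp
  then have "(\<lambda>n. complex_of_real (LINT x|M. exp (- (\<Sum>j=1..m. w j * (V n j x + c j)\<^sup>2)))) \<longlonglongrightarrow> complex_of_real (LINT \<omega>|N. exp (- (\<Sum>j=1..m. w j * (Z j \<omega> + c j)\<^sup>2)))"
    unfolding A_def ch_def ch'_def
    by (simp only: N.expectation_exp_quadratic[OF prob_space_axioms V_measurable w] N.expectation_exp_quadratic[OF N.prob_space_axioms N.Z_measurable w])
  then show ?thesis by (simp only: tendsto_of_real_iff)
qed

lemma
  fixes N :: "'b measure" and Z :: "nat \<Rightarrow> 'b \<Rightarrow> real" and c :: "nat \<Rightarrow> real" and a b e :: real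
  assumes NZ: "normal_sequence N Z" and ab: "a < b" and e: "e > 0"
  shows V_sublevel_upper: "\<forall>\<^sub>F n in sequentially. measure M {x\<in>space M. \<forall>k\<in>{1..m}. mean_square (\<lambda>j. V n j x + c j) k \<le> a}
      \<le> measure N {x\<in>space N. \<forall>k\<in>{1..m}. mean_square (\<lambda>j. Z j x + c j) k < b} + e"
    and V_sublevel_lower: "\<forall>\<^sub>F n in sequentially. measure N {x\<in>space N. \<forall>k\<in>{1..m}. mean_square (\<lambda>j. Z j x + c j) k \<le> a} - e
      \<le> measure M {x\<in>space M. \<forall>k\<in>{1..m}. mean_square (\<lambda>j. V n j x + c j) k < b}"
proof -
  interpret N: normal_sequence N Z by (rule NZ)
  have lap: "(\<lambda>n. LINT x|M. exp (- (\<Sum>k=1..m. real (r k) * mean_square (\<lambda>j. V n j x + c j) k)))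
      \<longlonglongrightarrow> (LINT x|N. exp (- (\<Sum>k=1..m. real (r k) * mean_square (\<lambda>j. Z j x + c j) k)))" for r :: "nat \<Rightarrow> nat"
    unfolding weighted_mean_squares
    by (rule laplace_V_tendsto[OF NZ]) (intro sum_nonneg, simp)
  note sandwich = sublevel_sandwich[of M N "{1..m}" "\<lambda>n k x. mean_square (\<lambda>j. V n j x + c j) k" "\<lambda>k x. mean_square (\<lambda>j. Z j x + c j) k",
      OF prob_space_axioms N.prob_space_axioms _ _ _ _ _ lap ab e]
  show "\<forall>\<^sub>F n in sequentially. measure M {x\<in>space M. \<forall>k\<in>{1..m}. mean_square (\<lambda>j. V n j x + c j) k \<le> a}
      \<le> measure N {x\<in>space N. \<forall>k\<in>{1..m}. mean_square (\<lambda>j. Z j x + c j) k < b} + e"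
    by (rule sandwich(1)) (auto simp: mean_square_nonneg)
  show "\<forall>\<^sub>F n in sequentially. measure N {x\<in>space N. \<forall>k\<in>{1..m}. mean_square (\<lambda>j. Z j x + c j) k \<le> a} - e
      \<le> measure M {x\<in>space M. \<forall>k\<in>{1..m}. mean_square (\<lambda>j. V n j x + c j) k < b}"
    by (rule sandwich(2)) (auto simp: mean_square_nonneg)
qed

end

section \<open>The Gaussian limit\<close>

lemma mean_square_eq_L2: "k > 0 \<Longrightarrow> sqrt (mean_square v k) = L2_set v {1..k} / sqrt (real k)"
  unfolding mean_square_def L2_set_def by (simp only: times_divide_eq_left mult_1 real_sqrt_divide)

lemma sqrt_mean_square_triangle:
  "sqrt (mean_square (\<lambda>j. v j + w j) k) \<le> sqrt (mean_square v k) + sqrt (mean_square w k)"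
proof (cases "k = 0")
  case False
  have "L2_set (\<lambda>j. v j + w j) {1..k} / sqrt (real k) \<le> (L2_set v {1..k} + L2_set w {1..k}) / sqrt (real k)"
    by (intro divide_right_mono L2_set_triangle_ineq) auto
  then show ?thesis using False by (simp add: mean_square_eq_L2 add_divide_distrib)
qed (simp add: mean_square_def)

lemma mean_square_le:
  assumes "k > 0" "(\<Sum>j=1..k. (v j)\<^sup>2) \<le> C"
  shows "mean_square v k \<le> C / real k"
  using assms by (simp add: mean_square_def divide_right_mono)

text \<open>The margin is cut into two pieces d, one for the remainder and one for the shift or its
  distance from the limit.\<close>

lemma exists_sqrt_margin:
  fixes s t :: real
  assumes "0 \<le> s" "s < t"
  obtains d where "d > 0" "sqrt s + 2 * d \<le> sqrt t"
proof
  show "(sqrt t - sqrt s) / 2 > 0" using assms by simp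
  show "sqrt s + 2 * ((sqrt t - sqrt s) / 2) \<le> sqrt t" by (simp add: field_simps)
qed

lemma square_ratio_eventually:
  fixes s :: real
  assumes "s > 1"
  shows "\<forall>\<^sub>F L in sequentially. \<forall>l\<ge>L. real ((l + 1)\<^sup>2) \<le> (1 + s) / 2 * real (l\<^sup>2)"
proof -
  have "(\<lambda>n. (1 + 1 / real n)\<^sup>2) \<longlonglongrightarrow> (1 + 0)\<^sup>2" by (intro tendsto_intros lim_1_over_n)
  moreover have "(1 + 0)\<^sup>2 < (1 + s) / 2" using assms by simp
  ultimately have "\<forall>\<^sub>F n in sequentially. (1 + 1 / real n)\<^sup>2 < (1 + s) / 2" by (rule order_tendstoD(2))
  with eventually_gt_at_top[of 0] have "\<forall>\<^sub>F n in sequentially. real ((n + 1)\<^sup>2) \<le> (1 + s) / 2 * real (n\<^sup>2)"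
  proof eventually_elim
    case (elim n)
    have "real ((n + 1)\<^sup>2) = (1 + 1 / real n)\<^sup>2 * real (n\<^sup>2)"
      using elim(1) by (simp add: power_mult_distrib[symmetric] field_simps)
    also have "\<dots> \<le> (1 + s) / 2 * real (n\<^sup>2)" using elim by (intro mult_right_mono) auto
    finally show ?case .
  qed
  then show ?thesis by (simp only: eventually_all_ge_at_top)
qed

lemma (in prob_space) mean_square_tail_finite:
  fixes X :: "nat \<Rightarrow> 'a \<Rightarrow> real"
  assumes [measurable]: "\<And>j. random_variable borel (X j)"
    and int: "\<And>m. 1 \<le> m \<Longrightarrow> m < n \<Longrightarrow> integrable M (\<lambda>\<omega>. ((\<Sum>j=1..m. (X j \<omega>)\<^sup>2) - real m)\<^sup>2)"
    and var: "\<And>m. 1 \<le> m \<Longrightarrow> m < n \<Longrightarrow> (LINT \<omega>|M. ((\<Sum>j=1..m. (X j \<omega>)\<^sup>2) - real m)\<^sup>2) \<le> C * real m"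
    and C: "C \<ge> 0" and s: "s > 1" and L: "L \<ge> 1"
    and ratio: "\<And>l. l \<ge> L \<Longrightarrow> real ((l + 1)\<^sup>2) \<le> (1 + s) / 2 * real (l\<^sup>2)"
  shows "prob {\<omega>\<in>space M. \<exists>m. L\<^sup>2 \<le> m \<and> m < n \<and> s \<le> mean_square (\<lambda>j. X j \<omega>) m} \<le> 32 * C / ((s - 1)\<^sup>2 * real L)"
proof -
  have "{\<omega>\<in>space M. \<exists>m. L\<^sup>2 \<le> m \<and> m < n \<and> s \<le> mean_square (\<lambda>j. X j \<omega>) m} =
    {\<omega>\<in>space M. \<exists>m. L\<^sup>2 \<le> m \<and> m < n \<and> s * real m \<le> (\<Sum>j=1..m. (X j \<omega>)\<^sup>2)}"
  proof -
    have "s \<le> mean_square v m \<longleftrightarrow> s * real m \<le> (\<Sum>j=1..m. (v j)\<^sup>2)" if "L\<^sup>2 \<le> m" for m and v :: "nat \<Rightarrow> real"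
    proof -
      have "m > 0" using that L by (cases m) auto
      then show ?thesis by (simp add: mean_square_def le_divide_eq)
    qed
    then show ?thesis by (intro Collect_cong conj_cong refl ex_cong1) auto
  qed
  also have "prob \<dots> \<le> 32 * C / ((s - 1)\<^sup>2 * real L)"
    by (rule monotone_partial_sums_tail[OF _ _ int var C s L ratio]) (auto intro: sum_mono2)
  finally show ?thesis .
qed

context normal_sequence
begin

lemma Z_moments:
  "integrable N (\<lambda>\<omega>. (Z j \<omega>)\<^sup>2)" "integrable N (\<lambda>\<omega>. (Z j \<omega>)^4)"
  "(LINT \<omega>|N. (Z j \<omega>)\<^sup>2) = 1" "(LINT \<omega>|N. (Z j \<omega>)^4) = 3"
proof -
  have m: "integrable N (\<lambda>\<omega>. (Z j \<omega>)^(2*k))" "(LINT \<omega>|N. (Z j \<omega>)^(2*k)) = fact (2*k) / (2^k * fact k)" for k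
    using std_normal_moment_even[of k] distributed_integrable[OF Z_normal, of "\<lambda>x. x^(2*k)" j] distributed_integral[OF Z_normal, of "\<lambda>x. x^(2*k)" j]
    by (auto simp: has_bochner_integral_iff)
  from m[of 1] m[of 2] show "integrable N (\<lambda>\<omega>. (Z j \<omega>)\<^sup>2)" "integrable N (\<lambda>\<omega>. (Z j \<omega>)^4)"
    "(LINT \<omega>|N. (Z j \<omega>)\<^sup>2) = 1" "(LINT \<omega>|N. (Z j \<omega>)^4) = 3"
    by (simp_all add: fact_numeral)
qed

lemma Z_square_sums:
  "integrable N (\<lambda>\<omega>. ((\<Sum>j=1..m. (Z j \<omega>)\<^sup>2) - real m)\<^sup>2)" (is ?I)
  "(LINT \<omega>|N. ((\<Sum>j=1..m. (Z j \<omega>)\<^sup>2) - real m)\<^sup>2) \<le> 2 * real m" (is ?E)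
proof -
  define X where "X j \<omega> = (Z j \<omega>)\<^sup>2 - 1" for j \<omega>
  have sum_eq: "(\<Sum>j=1..m. (Z j \<omega>)\<^sup>2) - real m = (\<Sum>j\<in>{1..m}. X j \<omega>)" for \<omega>
    by (simp add: X_def sum_subtractf)
  have XI: "integrable N (X j)" "(LINT \<omega>|N. X j \<omega>) = 0" for j
    using Z_moments[of j] by (simp_all add: X_def[abs_def] prob_space)
  have sq: "X j \<omega> * X j \<omega> = (Z j \<omega>)^4 - 2 * (Z j \<omega>)\<^sup>2 + 1" for j \<omega>
    by (simp add: X_def power2_eq_square power4_eq_xxxx algebra_simps)
  have diag: "integrable N (\<lambda>\<omega>. X j \<omega> * X j \<omega>)" "(LINT \<omega>|N. X j \<omega> * X j \<omega>) = 2" for j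
    unfolding sq using Z_moments[of j] by (simp_all add: prob_space)
  have off: "integrable N (\<lambda>\<omega>. X j \<omega> * X k \<omega>)" "(LINT \<omega>|N. X j \<omega> * X k \<omega>) = 0" if "j \<noteq> k" for j k
  proof -
    have ind: "indep_vars (\<lambda>_. borel) X {j, k}"
      unfolding X_def[abs_def]
      by (rule indep_vars_compose2[where M' = "\<lambda>_. borel" and X = Z, OF indep_vars_subset[OF Z_indep]]) auto
    show "integrable N (\<lambda>\<omega>. X j \<omega> * X k \<omega>)" "(LINT \<omega>|N. X j \<omega> * X k \<omega>) = 0"
      using indep_vars_integrable[OF _ ind] indep_vars_lebesgue_integral[OF _ ind] XI that by simp_all
  qed
  have int: "integrable N (\<lambda>\<omega>. X j \<omega> * X k \<omega>)" for j k
    using diag off by (cases "j = k") auto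
  show ?I unfolding sum_eq by (rule second_moment_sum(1)[OF int])
  have "(LINT \<omega>|N. (\<Sum>j\<in>{1..m}. X j \<omega>)\<^sup>2) = (\<Sum>j\<in>{1..m}. \<Sum>k\<in>{1..m}. LINT \<omega>|N. X j \<omega> * X k \<omega>)"
    by (rule second_moment_sum(2)[OF int])
  also have "\<dots> = (\<Sum>j\<in>{1..m}. \<Sum>k\<in>{1..m}. if j = k then 2 else 0)"
    using diag off by (intro sum.cong refl) auto
  finally show ?E unfolding sum_eq by simp
qed

text \<open>The tail bound for horizon n does not depend on n, so continuity along the increasing
  events E n extends it to all m at once.\<close>

lemma Z_tail:
  assumes s: "s > 1" and e: "e > 0"
  shows "\<exists>K\<ge>1. prob {\<omega>\<in>space N. \<exists>m\<ge>K. s \<le> mean_square (\<lambda>j. Z j \<omega>) m} \<le> e"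
proof -
  have "(\<lambda>L. (64 / (s - 1)\<^sup>2) / real L) \<longlonglongrightarrow> 0" by (rule lim_const_over_n)
  then have "\<forall>\<^sub>F L in sequentially. (64 / (s - 1)\<^sup>2) / real L < e" using e by (rule order_tendstoD(2))
  with square_ratio_eventually[OF s] eventually_ge_at_top[of 1]
  have "\<forall>\<^sub>F L in sequentially. (\<forall>l\<ge>L. real ((l + 1)\<^sup>2) \<le> (1 + s) / 2 * real (l\<^sup>2)) \<and> L \<ge> 1 \<and> (64 / (s - 1)\<^sup>2) / real L < e"
    by eventually_elim auto
  then obtain L where L: "\<forall>l\<ge>L. real ((l + 1)\<^sup>2) \<le> (1 + s) / 2 * real (l\<^sup>2)" "L \<ge> 1" "(64 / (s - 1)\<^sup>2) / real L < e"
    using eventually_happens'[OF sequentially_bot] by blast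
  define E where "E n = {\<omega>\<in>space N. \<exists>m. L\<^sup>2 \<le> m \<and> m < n \<and> s \<le> mean_square (\<lambda>j. Z j \<omega>) m}" for n
  have [measurable]: "E n \<in> events" for n unfolding E_def by measurable
  have "prob (E n) \<le> 32 * 2 / ((s - 1)\<^sup>2 * real L)" for n
    unfolding E_def by (rule mean_square_tail_finite) (use L s Z_square_sums in auto)
  then have "prob (E n) \<le> e" for n using L(3) by (smt (verit) divide_divide_eq_left)
  moreover have "(\<lambda>n. prob (E n)) \<longlonglongrightarrow> prob (\<Union>n. E n)"
    by (rule finite_Lim_measure_incseq) (auto simp: incseq_def E_def)
  ultimately have "prob (\<Union>n. E n) \<le> e" by (intro LIMSEQ_le_const2) auto
  also have "(\<Union>n. E n) = {\<omega>\<in>space N. \<exists>m\<ge>L\<^sup>2. s \<le> mean_square (\<lambda>j. Z j \<omega>) m}"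
    unfolding E_def by auto
  finally show ?thesis using L(2) by (intro exI[of _ "L\<^sup>2"]) auto
qed

context
  fixes c :: "nat \<Rightarrow> real" and C :: real
  assumes c_sum: "\<And>m. (\<Sum>j=1..m. (c j)\<^sup>2) \<le> C"
begin

text \<open>The shift has total energy at most C, hence mean square at most C / m, which is
  negligible for large m; lowering the level from s to s' absorbs it.\<close>

lemma shifted_tail:
  assumes s: "s > 1" and e: "e > 0"
  shows "\<exists>K\<ge>1. prob {\<omega>\<in>space N. \<exists>m\<ge>K. s \<le> mean_square (\<lambda>j. Z j \<omega> + c j) m} \<le> e"
proof -
  define s' where "s' = (1 + s) / 2"
  have s': "1 < s'" "s' < s" using s by (auto simp: s'_def)
  obtain d where d: "d > 0" "sqrt s' + 2 * d \<le> sqrt s" using exists_sqrt_margin[of s' s] s' by auto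
  obtain K where K: "K \<ge> 1" "prob {\<omega>\<in>space N. \<exists>m\<ge>K. s' \<le> mean_square (\<lambda>j. Z j \<omega>) m} \<le> e"
    using Z_tail[OF s'(1) e] by auto
  have C0: "C \<ge> 0" using c_sum[of 0] by simp
  obtain K' where K': "real K' > C / d\<^sup>2" using reals_Archimedean2 by blast
  have small: "sqrt (mean_square c m) \<le> d" if "m \<ge> max K (K' + 1)" for m
  proof -
    have m: "m > 0" "real m > C / d\<^sup>2" using that K' by auto
    have "mean_square c m \<le> C / real m" by (rule mean_square_le[OF m(1) c_sum])
    also have "\<dots> \<le> d\<^sup>2" using m d by (simp add: divide_simps mult.commute)
    finally show ?thesis using d by (intro real_le_lsqrt) (auto simp: mean_square_nonneg)
  qed
  have "{\<omega>\<in>space N. \<exists>m\<ge>max K (K' + 1). s \<le> mean_square (\<lambda>j. Z j \<omega> + c j) m} \<subseteq> {\<omega>\<in>space N. \<exists>m\<ge>K. s' \<le> mean_square (\<lambda>j. Z j \<omega>) m}"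
  proof safe
    fix \<omega> m assume m: "m \<ge> max K (K' + 1)" and "s \<le> mean_square (\<lambda>j. Z j \<omega> + c j) m"
    then have "sqrt s \<le> sqrt (mean_square (\<lambda>j. Z j \<omega> + c j) m)" by simp
    also have "\<dots> \<le> sqrt (mean_square (\<lambda>j. Z j \<omega>) m) + d"
      using sqrt_mean_square_triangle[of "\<lambda>j. Z j \<omega>" c m] small[OF m] by simp
    finally have "sqrt s' \<le> sqrt (mean_square (\<lambda>j. Z j \<omega>) m)" using d by linarith
    then show "\<exists>m\<ge>K. s' \<le> mean_square (\<lambda>j. Z j \<omega>) m" using m by auto
  qed
  then have "prob {\<omega>\<in>space N. \<exists>m\<ge>max K (K' + 1). s \<le> mean_square (\<lambda>j. Z j \<omega> + c j) m} \<le> prob {\<omega>\<in>space N. \<exists>m\<ge>K. s' \<le> mean_square (\<lambda>j. Z j \<omega>) m}"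
    by (intro finite_measure_mono) auto
  with K show ?thesis by (intro exI[of _ "max K (K' + 1)"]) auto
qed

text \<open>With the other coordinates frozen, the equation confines the first one to at most two
  points, which a normal law does not charge.\<close>

lemma shifted_mean_square_no_atom:
  assumes m: "m \<ge> 1"
  shows "AE \<omega> in N. mean_square (\<lambda>j. Z j \<omega> + c j) m \<noteq> t"
proof -
  define J where "J = {2..m}"
  define \<phi> where "\<phi> x v = (of_bool ((x + c 1)\<^sup>2 + (\<Sum>j\<in>J. (v j + c j)\<^sup>2) = real m * t) :: real)" for x and v :: "nat \<Rightarrow> real"
  have "(LINT \<omega>|N. \<phi> (Z 1 \<omega>) (restrict (\<lambda>i. Z i \<omega>) J)) = 0"
  proof (rule indep_vars_integral_eq_0[OF Z_indep, where k = 1 and J = J and \<phi> = \<phi> and B = 1])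
    show "1 \<notin> J" by (simp add: J_def)
    show "\<bar>\<phi> x v\<bar> \<le> 1" for x v by (simp add: \<phi>_def)
    have "(\<lambda>z. \<Sum>j\<in>J. (snd z j + c j)\<^sup>2) \<in> borel_measurable ((borel :: real measure) \<Otimes>\<^sub>M PiM J (\<lambda>_. borel :: real measure))"
    proof (rule borel_measurable_sum)
      fix j assume "j \<in> J"
      then have [measurable]: "(\<lambda>z. snd z j) \<in> borel_measurable ((borel :: real measure) \<Otimes>\<^sub>M PiM J (\<lambda>_. borel :: real measure))"
        by (intro measurable_compose[OF measurable_snd measurable_component_singleton])
      show "(\<lambda>z. (snd z j + c j)\<^sup>2) \<in> borel_measurable ((borel :: real measure) \<Otimes>\<^sub>M PiM J (\<lambda>_. borel :: real measure))"
        by (intro borel_measurable_power borel_measurable_add) auto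
    qed
    then have "(\<lambda>z. of_bool ((fst z + c 1)\<^sup>2 + (\<Sum>j\<in>J. (snd z j + c j)\<^sup>2) = real m * t) :: real) \<in> borel_measurable (borel \<Otimes>\<^sub>M PiM J (\<lambda>_. borel))"
      by measurable
    then show "(\<lambda>(x, v). \<phi> x v) \<in> borel_measurable (borel \<Otimes>\<^sub>M PiM J (\<lambda>_. borel))"
      by (simp add: \<phi>_def split_beta)
    show "(LINT \<omega>|N. \<phi> (Z 1 \<omega>) v) = 0" for v
    proof -
      define r where "r = real m * t - (\<Sum>j\<in>J. (v j + c j)\<^sup>2)"
      have null: "\<phi> x v = 0" if "x \<noteq> sqrt r - c 1" "x \<noteq> - sqrt r - c 1" for x
      proof (rule ccontr)
        assume "\<phi> x v \<noteq> 0"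
        then have "(x + c 1)\<^sup>2 = r" by (auto simp: \<phi>_def r_def)
        then have "\<bar>x + c 1\<bar> = sqrt r" by (metis real_sqrt_abs)
        then show False using that by linarith
      qed
      have [measurable]: "(\<lambda>x. \<phi> x v) \<in> borel_measurable borel" unfolding \<phi>_def by measurable
      have "(LINT \<omega>|N. \<phi> (Z 1 \<omega>) v) = (LINT x|lborel. std_normal_density x * \<phi> x v)"
        using distributed_integral[OF Z_normal, of "\<lambda>x. \<phi> x v" 1] by simp
      also have "\<dots> = 0"
      proof (rule integral_eq_zero_AE)
        show "AE x in lborel. std_normal_density x * \<phi> x v = 0"
          using AE_lborel_singleton[of "sqrt r - c 1"] AE_lborel_singleton[of "- sqrt r - c 1"]
        proof eventually_elim
          case (elim x)
          then show ?case using null[of x] by simp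
        qed
      qed
      finally show ?thesis .
    qed
  qed
  moreover have "\<phi> (Z 1 \<omega>) (restrict (\<lambda>i. Z i \<omega>) J) = of_bool (mean_square (\<lambda>j. Z j \<omega> + c j) m = t)" for \<omega>
  proof -
    have J: "{1..m} = insert 1 J" "1 \<notin> J" "finite J" using m by (auto simp: J_def)
    have "(\<Sum>j=1..m. (Z j \<omega> + c j)\<^sup>2) = (Z 1 \<omega> + c 1)\<^sup>2 + (\<Sum>j\<in>J. (Z j \<omega> + c j)\<^sup>2)"
      unfolding J(1) by (rule sum.insert[OF J(3,2)])
    also have "(\<Sum>j\<in>J. (Z j \<omega> + c j)\<^sup>2) = (\<Sum>j\<in>J. (restrict (\<lambda>i. Z i \<omega>) J j + c j)\<^sup>2)"
      by (intro sum.cong) auto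
    finally have "(\<Sum>j=1..m. (Z j \<omega> + c j)\<^sup>2) = (Z 1 \<omega> + c 1)\<^sup>2 + (\<Sum>j\<in>J. (restrict (\<lambda>i. Z i \<omega>) J j + c j)\<^sup>2)" .
    moreover have "mean_square v m = t \<longleftrightarrow> (\<Sum>j=1..m. (v j)\<^sup>2) = real m * t" for v
      using m by (simp add: mean_square_def divide_eq_eq mult.commute)
    ultimately show ?thesis by (simp only: \<phi>_def)
  qed
  ultimately have "(LINT \<omega>|N. of_bool (mean_square (\<lambda>j. Z j \<omega> + c j) m = t)) = (0::real)" by simp
  then have "AE \<omega> in N. of_bool (mean_square (\<lambda>j. Z j \<omega> + c j) m = t) = (0::real)"
    by (subst (asm) integral_nonneg_eq_0_iff_AE) (auto intro!: integrable_const_bound[of _ 1])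
  then show ?thesis by simp
qed

end

end

text \<open>On an unbounded set the real supremum is a fixed junk value, which keeps level sets of \<open>T_lim\<close> measurable.\<close>
lemma unbounded_real_Sup:
  fixes X :: "real set"
  assumes "\<not> bdd_above X"
  shows "Sup X = (LEAST z. False)"
proof -
  have "(\<lambda>z. \<forall>x\<in>X. x \<le> z) = (\<lambda>z. False)" using assms by (auto simp: bdd_above_def fun_eq_iff)
  then show ?thesis by (simp only: Sup_real_def)
qed

text \<open>From K on the terms stay below s < t, so the supremum reaches t only if one of finitely
  many terms does, and that term then exceeds t because the value t is excluded. The same bound
  yields boundedness, without which the real supremum says nothing.\<close>

lemma Sup_ge_iff_exists_gt:
  fixes a :: "nat \<Rightarrow> real"
  assumes s: "s < t" and K: "\<And>m. m \<ge> K \<Longrightarrow> a m < s" and ne: "\<And>m. m \<ge> 1 \<Longrightarrow> a m \<noteq> t"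
  shows "t \<le> (SUP m\<in>{1..}. a m) \<longleftrightarrow> (\<exists>m\<ge>1. t < a m)"
proof -
  define b where "b = Max (insert s (a ` {1..K}))"
  have le: "a m \<le> b" if "m \<ge> 1" for m
  proof (cases "m \<le> K")
    case True
    then show ?thesis unfolding b_def using that by (intro Max_ge) auto
  next
    case False
    then have "a m < s" by (intro K) simp
    also have "s \<le> b" unfolding b_def by (intro Max_ge) auto
    finally show ?thesis by simp
  qed
  have bdd: "bdd_above (a ` {1..})" using le by (intro bdd_aboveI[of _ b]) auto
  show ?thesis
  proof
    assume t: "t \<le> (SUP m\<in>{1..}. a m)"
    show "\<exists>m\<ge>1. t < a m"
    proof (rule ccontr)
      assume "\<not> (\<exists>m\<ge>1. t < a m)"
      then have "a m < t" if "m \<ge> 1" for m using ne[OF that] that by force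
      then have "b < t" unfolding b_def using s by (subst Max_less_iff) auto
      moreover have "(SUP m\<in>{1..}. a m) \<le> b" using le by (intro cSUP_least) auto
      ultimately show False using t by simp
    qed
  next
    assume "\<exists>m\<ge>1. t < a m"
    then obtain m where m: "m \<ge> 1" "t < a m" by auto
    have "a m \<le> (SUP m\<in>{1..}. a m)" using m by (intro cSUP_upper bdd) auto
    with m show "t \<le> (SUP m\<in>{1..}. a m)" by simp
  qed
qed

text \<open>A supremum can reach t although no term does. The level set is therefore expressed
  through the countably many levels t - 1 / (l + 1), and boundedness through natural numbers as
  bounds.\<close>

lemma (in prob_space) Sup_level_set_measurable:
  fixes a :: "nat \<Rightarrow> 'a \<Rightarrow> real"
  assumes [measurable]: "\<And>m. random_variable borel (a m)"
  shows "{\<omega>\<in>space M. t \<le> (SUP m\<in>{1..}. a m \<omega>)} \<in> events"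
proof -
  let ?B = "\<lambda>\<omega>. \<exists>b::nat. \<forall>m\<ge>1. a m \<omega> \<le> real b"
  have B: "bdd_above ((\<lambda>m. a m \<omega>) ` {1..}) \<longleftrightarrow> ?B \<omega>" for \<omega>
  proof
    assume "bdd_above ((\<lambda>m. a m \<omega>) ` {1..})"
    then obtain z where "\<And>m. m \<ge> 1 \<Longrightarrow> a m \<omega> \<le> z" by (auto simp: bdd_above_def)
    moreover obtain b :: nat where "z \<le> real b" using real_arch_simple by blast
    ultimately show "?B \<omega>" by (meson order_trans)
  qed (auto simp: bdd_above_def)
  have lev: "t \<le> (SUP m\<in>{1..}. a m \<omega>) \<longleftrightarrow> (\<forall>l. \<exists>m\<ge>1. t - 1 / real (Suc l) < a m \<omega>)" if "?B \<omega>" for \<omega>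
  proof -
    have bdd: "bdd_above ((\<lambda>m. a m \<omega>) ` {1..})" using that B by simp
    show ?thesis
    proof (intro iffI allI)
      fix l assume "t \<le> (SUP m\<in>{1..}. a m \<omega>)"
      then have "t - 1 / real (Suc l) < (SUP m\<in>{1..}. a m \<omega>)" by (smt (verit) of_nat_0_less_iff zero_less_Suc zero_less_divide_1_iff)
      then show "\<exists>m\<ge>1. t - 1 / real (Suc l) < a m \<omega>" by (subst (asm) less_cSUP_iff[OF _ bdd]) auto
    next
      assume *: "\<forall>l. \<exists>m\<ge>1. t - 1 / real (Suc l) < a m \<omega>"
      show "t \<le> (SUP m\<in>{1..}. a m \<omega>)"
      proof (rule ccontr)
        assume "\<not> t \<le> (SUP m\<in>{1..}. a m \<omega>)"
        then obtain l where l: "1 / real (Suc l) < t - (SUP m\<in>{1..}. a m \<omega>)"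
          using reals_Archimedean[of "t - (SUP m\<in>{1..}. a m \<omega>)"] by (auto simp: inverse_eq_divide)
        obtain m where m: "m \<ge> 1" "t - 1 / real (Suc l) < a m \<omega>" using * by blast
        have "a m \<omega> \<le> (SUP m\<in>{1..}. a m \<omega>)" using m by (intro cSUP_upper bdd) auto
        with l m show False by linarith
      qed
    qed
  qed
  have "{\<omega>\<in>space M. t \<le> (SUP m\<in>{1..}. a m \<omega>)} =
      {\<omega>\<in>space M. (?B \<omega> \<and> (\<forall>l. \<exists>m\<ge>1. t - 1 / real (Suc l) < a m \<omega>)) \<or> (\<not> ?B \<omega> \<and> t \<le> (LEAST z. False))}"
  proof (intro Collect_cong conj_cong refl)
    fix \<omega>
    show "t \<le> (SUP m\<in>{1..}. a m \<omega>) \<longleftrightarrow> (?B \<omega> \<and> (\<forall>l. \<exists>m\<ge>1. t - 1 / real (Suc l) < a m \<omega>)) \<or> (\<not> ?B \<omega> \<and> t \<le> (LEAST z. False))"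
    proof (cases "?B \<omega>")
      case True
      then show ?thesis using lev[OF True] by simp
    next
      case False
      then have "(SUP m\<in>{1..}. a m \<omega>) = (LEAST z. False)" using B by (intro unbounded_real_Sup) simp
      then show ?thesis using False by (simp only: simp_thms)
    qed
  qed
  also have "\<dots> \<in> events" by measurable
  finally show ?thesis .
qed

section \<open>The limiting power as a limit over finitely many averages\<close>

context normal_sequence
begin

context
  fixes c :: "nat \<Rightarrow> real" and C t :: real
  assumes c_sum: "\<And>m. (\<Sum>j=1..m. (c j)\<^sup>2) \<le> C" and t: "t > 1"
begin

abbreviation ms :: "nat \<Rightarrow> 'b \<Rightarrow> real" where
  "ms m \<omega> \<equiv> mean_square (\<lambda>j. Z j \<omega> + c j) m"

text \<open>A strict inequality for a single average makes the event a countable union;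
  \<open>prob_Sup_ge\<close> shows that the supremum reaches t with the same probability.\<close>

definition power_limit :: real where
  "power_limit = prob {\<omega>\<in>space N. \<exists>m\<ge>1. t < ms m \<omega>}"

text \<open>Almost surely only finitely many averages reach a level s between 1 and t, and none
  equals t, so \<open>Sup_ge_iff_exists_gt\<close> applies pathwise.\<close>

lemma prob_Sup_ge: "prob {\<omega>\<in>space N. t \<le> (SUP m\<in>{1..}. ms m \<omega>)} = power_limit"
  unfolding power_limit_def
proof (rule finite_measure_eq_AE)
  define s where "s = (1 + t) / 2"
  have s: "1 < s" "s < t" using t by (auto simp: s_def)
  define E where "E = {\<omega>\<in>space N. \<forall>K. \<exists>m\<ge>K. s \<le> ms m \<omega>}"
  have [measurable]: "E \<in> events" unfolding E_def by measurable
  have "prob E \<le> 0 + e" if e: "e > 0" for e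
  proof -
    obtain K where "prob {\<omega>\<in>space N. \<exists>m\<ge>K. s \<le> ms m \<omega>} \<le> e" using shifted_tail[OF c_sum s(1) e] by auto
    moreover have "prob E \<le> prob {\<omega>\<in>space N. \<exists>m\<ge>K. s \<le> ms m \<omega>}" by (intro finite_measure_mono) (auto simp: E_def)
    ultimately show ?thesis by simp
  qed
  then have "prob E \<le> 0" by (rule field_le_epsilon)
  then have "prob E = 0" by (simp add: measure_le_0_iff)
  then have "AE \<omega> in N. \<omega> \<notin> E" by (intro AE_not_in) (simp add: null_setsI emeasure_eq_measure)
  moreover have "AE \<omega> in N. \<forall>m. m \<ge> 1 \<longrightarrow> ms m \<omega> \<noteq> t"
    unfolding AE_all_countable using shifted_mean_square_no_atom[OF c_sum] by auto
  ultimately show "AE \<omega> in N. (\<omega> \<in> {\<omega>\<in>space N. t \<le> (SUP m\<in>{1..}. ms m \<omega>)}) = (\<omega> \<in> {\<omega>\<in>space N. \<exists>m\<ge>1. t < ms m \<omega>})"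
    using AE_space
  proof eventually_elim
    case (elim \<omega>)
    then have "\<not> (\<forall>K. \<exists>m\<ge>K. s \<le> ms m \<omega>)" by (simp add: E_def)
    then obtain K where "\<And>m. m \<ge> K \<Longrightarrow> ms m \<omega> < s" by (meson not_le)
    then have "t \<le> (SUP m\<in>{1..}. ms m \<omega>) \<longleftrightarrow> (\<exists>m\<ge>1. t < ms m \<omega>)"
      by (rule Sup_ge_iff_exists_gt[OF s(2)]) (use elim in auto)
    then show ?case by simp
  qed
  show "{\<omega>\<in>space N. t \<le> (SUP m\<in>{1..}. ms m \<omega>)} \<in> events" by (rule Sup_level_set_measurable) measurable
qed measurable

text \<open>From K on the tail bound does the work. Up to K, the events for the levels t - 1 / (l +
  1) decrease to the event that some average reaches t, which in the absence of atoms means that it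
  exceeds t. The bound is uniform in m because the horizon will be chosen after s.\<close>

lemma power_limit_upper:
  assumes e: "e > 0"
  shows "\<exists>s. 1 < s \<and> s < t \<and> (\<forall>m. prob {\<omega>\<in>space N. \<exists>k\<in>{1..m}. s \<le> ms k \<omega>} \<le> power_limit + e)"
proof -
  define s1 where "s1 = (1 + t) / 2"
  have s1: "1 < s1" "s1 < t" using t by (auto simp: s1_def)
  obtain K where K: "prob {\<omega>\<in>space N. \<exists>m\<ge>K. s1 \<le> ms m \<omega>} \<le> e / 2"
    using shifted_tail[OF c_sum s1(1), of "e / 2"] e by auto
  define D where "D l = {\<omega>\<in>space N. \<exists>k\<in>{1..K}. t - 1 / real (Suc l) \<le> ms k \<omega>}" for l
  have [measurable]: "D l \<in> events" for l unfolding D_def by measurable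
  have "decseq D"
  proof (rule decseq_SucI, unfold D_def, safe)
    fix l \<omega> k assume "k \<in> {1..K}" "t - 1 / real (Suc (Suc l)) \<le> ms k \<omega>"
    moreover have "1 / real (Suc (Suc l)) \<le> 1 / real (Suc l)" by (intro divide_left_mono) auto
    ultimately show "\<exists>k\<in>{1..K}. t - 1 / real (Suc l) \<le> ms k \<omega>" by force
  qed
  then have lim: "(\<lambda>l. prob (D l)) \<longlonglongrightarrow> prob (\<Inter>l. D l)"
    by (intro finite_Lim_measure_decseq) auto
  have tl: "(\<lambda>l. t - 1 / real (Suc l)) \<longlonglongrightarrow> t"
    using tendsto_diff[OF tendsto_const LIMSEQ_Suc[OF lim_1_over_n], of t] by simp
  have "prob (\<Inter>l. D l) \<le> power_limit"
    unfolding power_limit_def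
  proof (rule finite_measure_mono_AE)
    have "AE \<omega> in N. \<forall>m. m \<ge> 1 \<longrightarrow> ms m \<omega> \<noteq> t"
      unfolding AE_all_countable using shifted_mean_square_no_atom[OF c_sum] by auto
    then show "AE \<omega> in N. \<omega> \<in> (\<Inter>l. D l) \<longrightarrow> \<omega> \<in> {\<omega>\<in>space N. \<exists>m\<ge>1. t < ms m \<omega>}"
    proof eventually_elim
      case (elim \<omega>)
      show ?case
      proof
        assume \<omega>: "\<omega> \<in> (\<Inter>l. D l)"
        have "\<exists>k\<in>{1..K}. t < ms k \<omega>"
        proof (rule ccontr)
          assume "\<not> ?thesis"
          then have "ms k \<omega> < t" if "k \<in> {1..K}" for k using elim that by force
          then have "\<forall>\<^sub>F l in sequentially. ms k \<omega> < t - 1 / real (Suc l)" if "k \<in> {1..K}" for k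
            using order_tendstoD(1)[OF tl] that by auto
          then have "\<forall>\<^sub>F l in sequentially. \<forall>k\<in>{1..K}. ms k \<omega> < t - 1 / real (Suc l)"
            by (intro eventually_ball_finite) auto
          then obtain l where "\<forall>k\<in>{1..K}. ms k \<omega> < t - 1 / real (Suc l)"
            using eventually_happens'[OF sequentially_bot] by blast
          moreover have "\<exists>k\<in>{1..K}. t - 1 / real (Suc l) \<le> ms k \<omega>" using \<omega> unfolding D_def by blast
          ultimately show False by (meson not_le)
        qed
        with \<omega> show "\<omega> \<in> {\<omega>\<in>space N. \<exists>m\<ge>1. t < ms m \<omega>}" by (auto simp: D_def)
      qed
    qed
  qed measurable
  then have "prob (\<Inter>l. D l) < power_limit + e / 2" using e by simp
  then have "\<forall>\<^sub>F l in sequentially. prob (D l) < power_limit + e / 2" by (rule order_tendstoD(2)[OF lim])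
  moreover have "\<forall>\<^sub>F l in sequentially. s1 < t - 1 / real (Suc l)" by (rule order_tendstoD(1)[OF tl s1(2)])
  ultimately obtain l where l: "prob (D l) < power_limit + e / 2" "s1 < t - 1 / real (Suc l)"
    using eventually_happens'[OF sequentially_bot eventually_conj] by blast
  show ?thesis
  proof (intro exI[of _ "t - 1 / real (Suc l)"] conjI allI)
    show "1 < t - 1 / real (Suc l)" using l s1 by linarith
    show "t - 1 / real (Suc l) < t" by simp
    fix m
    have "{\<omega>\<in>space N. \<exists>k\<in>{1..m}. t - 1 / real (Suc l) \<le> ms k \<omega>} \<subseteq> D l \<union> {\<omega>\<in>space N. \<exists>m\<ge>K. s1 \<le> ms m \<omega>}"
    proof
      fix \<omega> assume "\<omega> \<in> {\<omega>\<in>space N. \<exists>k\<in>{1..m}. t - 1 / real (Suc l) \<le> ms k \<omega>}"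
      then obtain k where k: "\<omega> \<in> space N" "k \<in> {1..m}" "t - 1 / real (Suc l) \<le> ms k \<omega>" by blast
      show "\<omega> \<in> D l \<union> {\<omega>\<in>space N. \<exists>m\<ge>K. s1 \<le> ms m \<omega>}"
      proof (cases "K \<le> k")
        case True
        moreover have "s1 \<le> ms k \<omega>" using k(3) l(2) by linarith
        ultimately show ?thesis using k(1) by blast
      next
        case False
        then have "k \<in> {1..K}" using k(2) by simp
        then show ?thesis using k(1,3) unfolding D_def by blast
      qed
    qed
    then have "prob {\<omega>\<in>space N. \<exists>k\<in>{1..m}. t - 1 / real (Suc l) \<le> ms k \<omega>} \<le> prob (D l \<union> {\<omega>\<in>space N. \<exists>m\<ge>K. s1 \<le> ms m \<omega>})"
      by (intro finite_measure_mono) auto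
    also have "\<dots> \<le> prob (D l) + prob {\<omega>\<in>space N. \<exists>m\<ge>K. s1 \<le> ms m \<omega>}" by (intro measure_Un_le) auto
    finally show "prob {\<omega>\<in>space N. \<exists>k\<in>{1..m}. t - 1 / real (Suc l) \<le> ms k \<omega>} \<le> power_limit + e"
      using l(1) K by linarith
  qed
qed

text \<open>A single index l serves both as horizon and, through 1 / (l + 1), as margin; the events
  D l increase to the one defining \<open>power_limit\<close>.\<close>

lemma power_limit_lower:
  assumes e: "e > 0"
  shows "\<exists>b m. t < b \<and> power_limit - e \<le> prob {\<omega>\<in>space N. \<exists>k\<in>{1..m}. b \<le> ms k \<omega>}"
proof -
  define D where "D l = {\<omega>\<in>space N. \<exists>k\<in>{1..l}. t + 1 / real (Suc l) \<le> ms k \<omega>}" for l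
  have [measurable]: "D l \<in> events" for l unfolding D_def by measurable
  have "incseq D"
  proof (rule incseq_SucI, unfold D_def, safe)
    fix l \<omega> k assume "k \<in> {1..l}" "t + 1 / real (Suc l) \<le> ms k \<omega>"
    moreover have "1 / real (Suc (Suc l)) \<le> 1 / real (Suc l)" by (intro divide_left_mono) auto
    ultimately show "\<exists>k\<in>{1..Suc l}. t + 1 / real (Suc (Suc l)) \<le> ms k \<omega>" by (intro bexI[of _ k]) auto
  qed
  then have lim: "(\<lambda>l. prob (D l)) \<longlonglongrightarrow> prob (\<Union>l. D l)"
    by (intro finite_Lim_measure_incseq) auto
  have tl: "(\<lambda>l. t + 1 / real (Suc l)) \<longlonglongrightarrow> t"
    using tendsto_add[OF tendsto_const LIMSEQ_Suc[OF lim_1_over_n], of t] by simp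
  have "{\<omega>\<in>space N. \<exists>m\<ge>1. t < ms m \<omega>} \<subseteq> (\<Union>l. D l)"
  proof safe
    fix \<omega> m assume \<omega>: "\<omega> \<in> space N" and m: "1 \<le> m" "t < ms m \<omega>"
    have "\<forall>\<^sub>F l in sequentially. t + 1 / real (Suc l) < ms m \<omega> \<and> m \<le> l"
      using order_tendstoD(2)[OF tl m(2)] eventually_ge_at_top[of m] by eventually_elim auto
    then obtain l where "t + 1 / real (Suc l) < ms m \<omega>" "m \<le> l" using eventually_happens'[OF sequentially_bot] by blast
    then show "\<omega> \<in> (\<Union>l. D l)" using \<omega> m(1) by (auto simp: D_def intro!: exI[of _ l] bexI[of _ m])
  qed
  then have "power_limit \<le> prob (\<Union>l. D l)"
    unfolding power_limit_def by (intro finite_measure_mono) auto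
  then have "power_limit - e < prob (\<Union>l. D l)" using e by simp
  then have "\<forall>\<^sub>F l in sequentially. power_limit - e < prob (D l)" by (rule order_tendstoD(1)[OF lim])
  then obtain l where "power_limit - e < prob (D l)" using eventually_happens'[OF sequentially_bot] by blast
  then show ?thesis by (intro exI[of _ "t + 1 / real (Suc l)"] exI[of _ l]) (simp add: D_def)
qed

end

end

section \<open>Limiting power\<close>

text \<open>Harmonic numbers grow like a logarithm. Up to a constant the quotient bounds the
  expectation of the weighted remainder: n^(-1/2) for each frequency j, with weight 1 / j.\<close>

lemma harm_over_sqrt_tendsto_0: "(\<lambda>n. harm n / sqrt (real n)) \<longlonglongrightarrow> 0"
proof -
  have inv: "(\<lambda>n. 1 / sqrt (real n)) \<longlonglongrightarrow> 0"
    using tendsto_real_sqrt[OF lim_1_over_n] by (simp add: real_sqrt_divide)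
  have "(\<lambda>n. (harm n - ln (real n)) * (1 / sqrt (real n))) \<longlonglongrightarrow> euler_mascheroni * 0"
    by (intro tendsto_mult inv) (rule euler_mascheroni_LIMSEQ)
  moreover have "(\<lambda>n. ln (real n) / real n powr (1/2)) \<longlonglongrightarrow> 0" by (rule lim_ln_over_power) simp
  then have "(\<lambda>n. ln (real n) / sqrt (real n)) \<longlonglongrightarrow> 0" by (simp add: powr_half_sqrt)
  ultimately have "(\<lambda>n. (harm n - ln (real n)) * (1 / sqrt (real n)) + ln (real n) / sqrt (real n)) \<longlonglongrightarrow> euler_mascheroni * 0 + 0"
    by (rule tendsto_add)
  then show ?thesis by (simp add: diff_divide_distrib)
qed

context rank_alternative
begin

lemma Rn_ge_iff:
  assumes "n \<ge> 2"
  shows "t \<le> Rn n (Yobs \<beta> eps n \<omega>) \<longleftrightarrow> (\<exists>m\<in>{1..<n}. t \<le> mean_square (\<lambda>j. root_term n j \<omega>) m)"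
proof -
  have "(1 / real m) * (\<Sum>j=1..m. 24 * real n * (phi_hat n (Yobs \<beta> eps n \<omega>) j)\<^sup>2) = mean_square (\<lambda>j. root_term n j \<omega>) m" for m
    by (simp add: mean_square_def root_term_def power_mult_distrib)
  then have eq: "Rn n (Yobs \<beta> eps n \<omega>) = Max ((\<lambda>m. mean_square (\<lambda>j. root_term n j \<omega>) m) ` {1..<n})"
    by (simp add: Rn_def)
  \<comment> \<open>For n \<ge> 2 the index set of the maximum is nonempty.\<close>
  show ?thesis unfolding eq using assms by (subst Max_ge_iff) auto
qed

lemma eventually_sample_size: "\<forall>\<^sub>F n in sequentially. 2 \<le> n \<and> 2 * (B\<beta> / sqrt (real n)) \<le> \<delta>"
proof -
  have "(\<lambda>n. 2 * B\<beta> * sqrt (1 / real n)) \<longlonglongrightarrow> 2 * B\<beta> * sqrt 0"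
    by (intro tendsto_mult tendsto_const tendsto_real_sqrt lim_1_over_n)
  then have "\<forall>\<^sub>F n in sequentially. 2 * B\<beta> * sqrt (1 / real n) < \<delta>"
    using \<delta>_pos by (intro order_tendstoD(2)[where a = \<delta>]) auto
  with eventually_ge_at_top[of 2] show ?thesis
    by eventually_elim (simp add: real_sqrt_divide)
qed

text \<open>The weights \<open>1 / j\<close> make this sum dominate the mean square of the remainder over every range
  \<open>j \<le> m\<close> at the price of a logarithmic factor only.\<close>
definition total_res :: "nat \<Rightarrow> 'a \<Rightarrow> real" where
  "total_res n \<omega> = (\<Sum>j\<in>{1..<n}. (res n j \<omega>)\<^sup>2 / real j)"

lemma total_res_measurable [measurable]: "random_variable borel (total_res n)"
  unfolding total_res_def by measurable

lemma mean_square_res_le: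
  assumes "1 \<le> m" "m < n"
  shows "mean_square (\<lambda>j. res n j \<omega>) m \<le> total_res n \<omega>"
proof -
  have "mean_square (\<lambda>j. res n j \<omega>) m = (\<Sum>j=1..m. (res n j \<omega>)\<^sup>2 / real m)"
    by (simp add: mean_square_def sum_divide_distrib)
  also have "\<dots> \<le> (\<Sum>j=1..m. (res n j \<omega>)\<^sup>2 / real j)"
    by (intro sum_mono divide_left_mono) auto
  also have "\<dots> \<le> total_res n \<omega>"
    unfolding total_res_def using assms by (intro sum_mono2) auto
  finally show ?thesis .
qed

lemma total_res_small:
  assumes d: "d > 0" and e: "e > 0"
  shows "\<forall>\<^sub>F n in sequentially. prob {\<omega>\<in>space M. d \<le> total_res n \<omega>} \<le> e"
proof -
  have "(\<lambda>n. Cres / d * (harm n / sqrt (real n))) \<longlonglongrightarrow> Cres / d * 0"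
    by (intro tendsto_mult tendsto_const harm_over_sqrt_tendsto_0)
  then have "\<forall>\<^sub>F n in sequentially. Cres / d * (harm n / sqrt (real n)) < e"
    using e by (intro order_tendstoD(2)[where a = e]) auto
  with eventually_sample_size show ?thesis
  proof eventually_elim
    case (elim n)
    then have n: "2 \<le> n" "2 * (B\<beta> / sqrt (real n)) \<le> \<delta>" by auto
    have int: "integrable M (\<lambda>\<omega>. (res n j \<omega>)\<^sup>2 / real j)" if "j \<in> {1..<n}" for j
      using integrable_res_square[OF n, of j] that by simp
    have "(LINT \<omega>|M. total_res n \<omega>) = (\<Sum>j\<in>{1..<n}. (LINT \<omega>|M. (res n j \<omega>)\<^sup>2) / real j)"
      unfolding total_res_def using int by (subst Bochner_Integration.integral_sum) auto
    also have "\<dots> \<le> (\<Sum>j\<in>{1..<n}. Cres / sqrt (real n) * (1 / real j))"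
    proof (rule sum_mono)
      fix j assume "j \<in> {1..<n}"
      then have "(LINT \<omega>|M. (res n j \<omega>)\<^sup>2) / real j \<le> (Cres / sqrt (real n)) / real j"
        using res_second_moment[OF n, of j] by (intro divide_right_mono) auto
      then show "(LINT \<omega>|M. (res n j \<omega>)\<^sup>2) / real j \<le> Cres / sqrt (real n) * (1 / real j)" by simp
    qed
    also have "\<dots> = Cres / sqrt (real n) * (\<Sum>j\<in>{1..<n}. 1 / real j)" by (simp only: sum_distrib_left)
    also have "\<dots> \<le> Cres / sqrt (real n) * harm n"
    proof (rule mult_left_mono)
      show "(\<Sum>j\<in>{1..<n}. 1 / real j) \<le> harm n"
        unfolding harm_def inverse_eq_divide by (intro sum_mono2) auto
    qed (use Cres_nonneg in auto)
    finally have E: "(LINT \<omega>|M. total_res n \<omega>) \<le> Cres * (harm n / sqrt (real n))" by simp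
    have "prob {\<omega>\<in>space M. d \<le> total_res n \<omega>} \<le> (LINT \<omega>|M. total_res n \<omega>) / d"
    proof (rule integral_Markov_inequality_measure[where A = "space M"])
      show "integrable M (total_res n)" unfolding total_res_def using int by (intro Bochner_Integration.integrable_sum)
      show "AE \<omega> in M. 0 \<le> total_res n \<omega>" unfolding total_res_def by (intro AE_I2 sum_nonneg) auto
    qed (use d in auto)
    also have "\<dots> \<le> Cres * (harm n / sqrt (real n)) / d" using E d by (intro divide_right_mono) auto
    also have "\<dots> \<le> e" using elim(2) by (simp add: mult.commute)
    finally show ?case .
  qed
qed

text \<open>The discrete Bessel inequality bounds the energy by 24 (h 0)^2 / n^2 times n / 2 times n
  \<open>B\<beta>\<close>^2, hence the factor 12 and a bound free of n.\<close>

definition shift_energy :: real where "shift_energy = 12 * (h 0)\<^sup>2 * B\<beta>\<^sup>2"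

lemma shift_sum_squares:
  assumes "m < n"
  shows "(\<Sum>j=1..m. (shift n j)\<^sup>2) \<le> shift_energy"
proof -
  have n: "real n > 0" using assms by simp
  have "(\<Sum>i=1..n. (\<beta> (xpt n i))\<^sup>2) \<le> (\<Sum>i=1..n. B\<beta>\<^sup>2)"
  proof (rule sum_mono)
    fix i assume "i \<in> {1..n}"
    then have "xpt n i \<in> {0..1}" using xpt_mem[of i n] by auto
    from power_mono[OF B\<beta>(2)[OF this] abs_ge_zero, of 2] show "(\<beta> (xpt n i))\<^sup>2 \<le> B\<beta>\<^sup>2" by simp
  qed
  then have b2: "(\<Sum>i=1..n. (\<beta> (xpt n i))\<^sup>2) \<le> real n * B\<beta>\<^sup>2" by simp
  have "(\<Sum>j=1..m. (shift n j)\<^sup>2) = (sqrt 24 * h 0 / real n)\<^sup>2 * (\<Sum>j=1..m. (\<Sum>i=1..n. \<beta> (xpt n i) * cos (pi * real j * xpt n i))\<^sup>2)"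
    unfolding sum_distrib_left by (intro sum.cong refl) (simp add: shift_def power_mult_distrib power_divide)
  also have "\<dots> \<le> (sqrt 24 * h 0 / real n)\<^sup>2 * (real n / 2 * (\<Sum>i=1..n. (\<beta> (xpt n i))\<^sup>2))"
    by (intro mult_left_mono discrete_cosine_bessel[OF assms]) auto
  also have "\<dots> \<le> (sqrt 24 * h 0 / real n)\<^sup>2 * (real n / 2 * (real n * B\<beta>\<^sup>2))"
    by (intro mult_left_mono b2) auto
  also have "\<dots> = shift_energy"
    using n by (simp add: shift_energy_def power_mult_distrib power_divide power2_eq_square)
  finally show ?thesis .
qed

text \<open>K must serve all n simultaneously, because the central limit theorem is applied only to
  averages up to a fixed index. This is possible since the second moment bound 288 m does not
  involve n.\<close>

lemma V_tail:
  assumes s: "s > 1" and e: "e > 0"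
  shows "\<exists>K\<ge>1. \<forall>n. prob {\<omega>\<in>space M. \<exists>m. K \<le> m \<and> m < n \<and> s \<le> mean_square (\<lambda>j. V n j \<omega>) m} \<le> e"
proof -
  have "(\<lambda>L. (32 * 288 / (s - 1)\<^sup>2) / real L) \<longlonglongrightarrow> 0" by (rule lim_const_over_n)
  then have "\<forall>\<^sub>F L in sequentially. (32 * 288 / (s - 1)\<^sup>2) / real L < e" using e by (rule order_tendstoD(2))
  with square_ratio_eventually[OF s] eventually_ge_at_top[of 1]
  have "\<forall>\<^sub>F L in sequentially. (\<forall>l\<ge>L. real ((l + 1)\<^sup>2) \<le> (1 + s) / 2 * real (l\<^sup>2)) \<and> L \<ge> 1 \<and> (32 * 288 / (s - 1)\<^sup>2) / real L < e"
    by eventually_elim auto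
  then obtain L where L: "\<forall>l\<ge>L. real ((l + 1)\<^sup>2) \<le> (1 + s) / 2 * real (l\<^sup>2)" "L \<ge> 1" "(32 * 288 / (s - 1)\<^sup>2) / real L < e"
    using eventually_happens'[OF sequentially_bot] by blast
  have bound: "prob {\<omega>\<in>space M. \<exists>m. L\<^sup>2 \<le> m \<and> m < n \<and> s \<le> mean_square (\<lambda>j. V n j \<omega>) m} \<le> 32 * 288 / ((s - 1)\<^sup>2 * real L)" for n
    by (rule mean_square_tail_finite) (use L s integrable_V_sums V_sums_second_moment in auto)
  have "prob {\<omega>\<in>space M. \<exists>m. L\<^sup>2 \<le> m \<and> m < n \<and> s \<le> mean_square (\<lambda>j. V n j \<omega>) m} \<le> e" for n
    using bound[of n] L(3) by (simp only: divide_divide_eq_left)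
  then show ?thesis using L(2) by (intro exI[of _ "L\<^sup>2"]) auto
qed

lemma root_term_decomp: "root_term n j \<omega> = V n j \<omega> + shift n j + res n j \<omega>"
  by (simp add: res_def)

text \<open>An exceedance by \<open>root_term\<close> comes from a large remainder, a late
  exceedance by V or an early exceedance by V + c, which gives the upper bound. For the lower bound
  finitely many early averages already carry nearly all of the limiting power. Roots of mean squares
  obey the triangle inequality, so the perturbations simply add.\<close>

lemma power_tendsto:
  fixes N :: "'b measure" and Z :: "nat \<Rightarrow> 'b \<Rightarrow> real" and c :: "nat \<Rightarrow> real" and t :: real
  assumes NZ: "normal_sequence N Z" and c: "\<And>j. (\<lambda>n. shift n j) \<longlonglongrightarrow> c j" and t: "t > 1"
  shows "(\<lambda>n. prob {\<omega>\<in>space M. t \<le> Rn n (Yobs \<beta> eps n \<omega>)})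
    \<longlonglongrightarrow> measure N {\<omega>\<in>space N. t \<le> (SUP m\<in>{1..}. mean_square (\<lambda>j. Z j \<omega> + c j) m)}"
proof -
  interpret N: normal_sequence N Z by (rule NZ)
  define p where "p = N.power_limit c t"
  have c_sum: "(\<Sum>j=1..m. (c j)\<^sup>2) \<le> shift_energy" for m
  proof (rule LIMSEQ_le_const2)
    show "(\<lambda>n. \<Sum>j=1..m. (shift n j)\<^sup>2) \<longlonglongrightarrow> (\<Sum>j=1..m. (c j)\<^sup>2)" by (intro tendsto_intros c)
    show "\<exists>n0. \<forall>n\<ge>n0. (\<Sum>j=1..m. (shift n j)\<^sup>2) \<le> shift_energy"
      by (intro exI[of _ "Suc m"] allI impI shift_sum_squares) simp
  qed
  have shift_close: "\<forall>\<^sub>F n in sequentially. \<forall>k\<in>{1..m}. sqrt (mean_square (\<lambda>j. shift n j - c j) k) \<le> d" if d: "d > 0" for m d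
  proof (rule eventually_ball_finite)
    show "\<forall>k\<in>{1..m}. \<forall>\<^sub>F n in sequentially. sqrt (mean_square (\<lambda>j. shift n j - c j) k) \<le> d"
    proof
      fix k
      have "(\<lambda>n. sqrt (mean_square (\<lambda>j. shift n j - c j) k)) \<longlonglongrightarrow> sqrt (1 / real k * (\<Sum>j=1..k. (c j - c j)\<^sup>2))"
        unfolding mean_square_def by (intro tendsto_intros c)
      then have "\<forall>\<^sub>F n in sequentially. sqrt (mean_square (\<lambda>j. shift n j - c j) k) < d"
        using d by (intro order_tendstoD(2)[where a = d]) auto
      then show "\<forall>\<^sub>F n in sequentially. sqrt (mean_square (\<lambda>j. shift n j - c j) k) \<le> d"
        by eventually_elim simp
    qed
  qed simp
  define P where "P n = prob {\<omega>\<in>space M. t \<le> Rn n (Yobs \<beta> eps n \<omega>)}" for n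
  have P_eq: "P n = prob {\<omega>\<in>space M. \<exists>m\<in>{1..<n}. t \<le> mean_square (\<lambda>j. root_term n j \<omega>) m}" if "n \<ge> 2" for n
    unfolding P_def using Rn_ge_iff[OF that] by simp
  \<comment> \<open>The four errors stem from the remainder, the late averages, the transfer of the
    early averages to N, and the choice of s0.\<close>
  have upper: "\<forall>\<^sub>F n in sequentially. P n \<le> p + 4 * e" if e: "e > 0" for e
  proof -
    obtain s0 where s0: "1 < s0" "s0 < t" "\<And>m. measure N {\<omega>\<in>space N. \<exists>k\<in>{1..m}. s0 \<le> mean_square (\<lambda>j. Z j \<omega> + c j) k} \<le> p + e"
      using N.power_limit_upper[OF c_sum t e] unfolding p_def by blast
    define s where "s = (s0 + t) / 2"
    have s: "1 < s" "s0 < s" "s < t" using s0 by (auto simp: s_def)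
    obtain d where d: "d > 0" "sqrt s + 2 * d \<le> sqrt t" using exists_sqrt_margin[of s t] s by auto
    obtain K where K: "K \<ge> 1" "\<And>n. prob {\<omega>\<in>space M. \<exists>m. K \<le> m \<and> m < n \<and> s \<le> mean_square (\<lambda>j. V n j \<omega>) m} \<le> e"
      using V_tail[OF s(1) e] by auto
    obtain K' where K': "real K' > shift_energy / d\<^sup>2" using reals_Archimedean2 by blast
    \<comment> \<open>From K on exceedances by V are rare; beyond K' the shift has root mean square
      at most d.\<close>
    define m0 where "m0 = max K K'"
    have big: "sqrt (mean_square (shift n) m) \<le> d" if "m0 < m" "m < n" for m n
    proof -
      have m: "m > 0" "real m > shift_energy / d\<^sup>2" using that K' by (auto simp: m0_def)
      have "mean_square (shift n) m \<le> shift_energy / real m" by (rule mean_square_le[OF m(1) shift_sum_squares[OF that(2)]])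
      also have "\<dots> \<le> d\<^sup>2" using m d by (simp add: divide_simps mult.commute)
      finally show ?thesis using d by (intro real_le_lsqrt) (auto simp: mean_square_nonneg)
    qed
    have low: "\<forall>\<^sub>F n in sequentially. measure N {\<omega>\<in>space N. \<forall>k\<in>{1..m0}. mean_square (\<lambda>j. Z j \<omega> + c j) k \<le> s0} - e
      \<le> prob {\<omega>\<in>space M. \<forall>k\<in>{1..m0}. mean_square (\<lambda>j. V n j \<omega> + c j) k < s}"
      by (rule V_sublevel_lower[OF NZ s(2) e])
    have d2: "d\<^sup>2 > 0" using d by simp
    from low total_res_small[OF d2 e] shift_close[OF d(1), of m0] eventually_ge_at_top[of 2]
    show ?thesis
    proof eventually_elim
      case (elim n)
      let ?R = "{\<omega>\<in>space M. d\<^sup>2 \<le> total_res n \<omega>}"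
      let ?T = "{\<omega>\<in>space M. \<exists>m. K \<le> m \<and> m < n \<and> s \<le> mean_square (\<lambda>j. V n j \<omega>) m}"
      let ?L = "{\<omega>\<in>space M. \<forall>k\<in>{1..m0}. mean_square (\<lambda>j. V n j \<omega> + c j) k < s}"
      let ?LN = "{\<omega>\<in>space N. \<forall>k\<in>{1..m0}. mean_square (\<lambda>j. Z j \<omega> + c j) k \<le> s0}"
      have sub: "{\<omega>\<in>space M. \<exists>m\<in>{1..<n}. t \<le> mean_square (\<lambda>j. root_term n j \<omega>) m} \<subseteq> (?R \<union> ?T) \<union> (space M - ?L)"
      proof
        fix \<omega> assume "\<omega> \<in> {\<omega>\<in>space M. \<exists>m\<in>{1..<n}. t \<le> mean_square (\<lambda>j. root_term n j \<omega>) m}"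
        then obtain m where m: "\<omega> \<in> space M" "1 \<le> m" "m < n" "t \<le> mean_square (\<lambda>j. root_term n j \<omega>) m" by auto
        show "\<omega> \<in> (?R \<union> ?T) \<union> (space M - ?L)"
        proof (cases "d\<^sup>2 \<le> total_res n \<omega>")
          case True
          then show ?thesis using m by simp
        next
          case False
          then have "mean_square (\<lambda>j. res n j \<omega>) m \<le> d\<^sup>2" using mean_square_res_le[OF m(2,3), of \<omega>] by linarith
          then have r: "sqrt (mean_square (\<lambda>j. res n j \<omega>) m) \<le> d" using d by (intro real_le_lsqrt) (auto simp: mean_square_nonneg)
          have "sqrt t \<le> sqrt (mean_square (\<lambda>j. root_term n j \<omega>) m)" using m(4) by simp
          also have "\<dots> \<le> sqrt (mean_square (\<lambda>j. V n j \<omega> + shift n j) m) + sqrt (mean_square (\<lambda>j. res n j \<omega>) m)"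
            unfolding root_term_decomp by (rule sqrt_mean_square_triangle)
          finally have 1: "sqrt t - d \<le> sqrt (mean_square (\<lambda>j. V n j \<omega> + shift n j) m)" using r by linarith
          show ?thesis
          proof (cases "m \<le> m0")
            case True
            have "sqrt (mean_square (\<lambda>j. V n j \<omega> + shift n j) m) \<le> sqrt (mean_square (\<lambda>j. V n j \<omega> + c j) m) + sqrt (mean_square (\<lambda>j. shift n j - c j) m)"
              using sqrt_mean_square_triangle[of "\<lambda>j. V n j \<omega> + c j" "\<lambda>j. shift n j - c j" m] by simp
            also have "sqrt (mean_square (\<lambda>j. shift n j - c j) m) \<le> d" using elim(3) True m(2) by auto
            finally have "sqrt s \<le> sqrt (mean_square (\<lambda>j. V n j \<omega> + c j) m)" using 1 d by linarith
            then have "\<not> mean_square (\<lambda>j. V n j \<omega> + c j) m < s" by simp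
            then show ?thesis using True m(1,2) by auto
          next
            case False
            have "sqrt (mean_square (\<lambda>j. V n j \<omega> + shift n j) m) \<le> sqrt (mean_square (\<lambda>j. V n j \<omega>) m) + sqrt (mean_square (shift n) m)"
              by (rule sqrt_mean_square_triangle)
            also have "sqrt (mean_square (shift n) m) \<le> d" using False m(3) by (intro big) auto
            finally have "sqrt s \<le> sqrt (mean_square (\<lambda>j. V n j \<omega>) m)" using 1 d by linarith
            then have "s \<le> mean_square (\<lambda>j. V n j \<omega>) m" by simp
            then show ?thesis using False m(1,3) by (auto simp: m0_def)
          qed
        qed
      qed
      have "P n \<le> prob ((?R \<union> ?T) \<union> (space M - ?L))"
        unfolding P_eq[OF elim(4)] by (rule finite_measure_mono[OF sub]) measurable
      also have "\<dots> \<le> prob (?R \<union> ?T) + prob (space M - ?L)" by (rule measure_Un_le) measurable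
      also have "prob (?R \<union> ?T) \<le> prob ?R + prob ?T" by (rule measure_Un_le) measurable
      also have "prob (space M - ?L) = 1 - prob ?L" by (rule prob_compl) measurable
      finally have "P n \<le> prob ?R + prob ?T + (1 - prob ?L)" by simp
      moreover have "1 - measure N ?LN \<le> p + e"
      proof -
        have "1 - measure N ?LN = measure N (space N - ?LN)" by (rule N.prob_compl[symmetric]) measurable
        also have "\<dots> \<le> measure N {\<omega>\<in>space N. \<exists>k\<in>{1..m0}. s0 \<le> mean_square (\<lambda>j. Z j \<omega> + c j) k}"
          by (rule N.finite_measure_mono) (auto simp: not_le intro: less_imp_le)
        also have "\<dots> \<le> p + e" by (rule s0(3))
        finally show ?thesis .
      qed
      ultimately show ?case using elim(1,2) K(2)[of n] by linarith
    qed
  qed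
  \<comment> \<open>The three errors stem from the choice of b and m0, the transfer to N, and the
    remainder.\<close>
  have lower: "\<forall>\<^sub>F n in sequentially. p - 3 * e \<le> P n" if e: "e > 0" for e
  proof -
    obtain b m0 where b: "t < b" "p - e \<le> measure N {\<omega>\<in>space N. \<exists>k\<in>{1..m0}. b \<le> mean_square (\<lambda>j. Z j \<omega> + c j) k}"
      using N.power_limit_lower[OF c_sum t e] unfolding p_def by blast
    define s where "s = (t + b) / 2"
    have s: "t < s" "s < b" using b by (auto simp: s_def)
    obtain d where d: "d > 0" "sqrt t + 2 * d \<le> sqrt s" using exists_sqrt_margin[of t s] s t by auto
    have d2: "d\<^sup>2 > 0" using d by simp
    have "\<forall>\<^sub>F n in sequentially. prob {\<omega>\<in>space M. \<forall>k\<in>{1..m0}. mean_square (\<lambda>j. V n j \<omega> + c j) k \<le> s}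
      \<le> measure N {\<omega>\<in>space N. \<forall>k\<in>{1..m0}. mean_square (\<lambda>j. Z j \<omega> + c j) k < b} + e"
      by (rule V_sublevel_upper[OF NZ s(2) e])
    from this total_res_small[OF d2 e] shift_close[OF d(1), of m0] eventually_ge_at_top[of "m0 + 2"]
    show ?thesis
    proof eventually_elim
      case (elim n)
      let ?R = "{\<omega>\<in>space M. d\<^sup>2 \<le> total_res n \<omega>}"
      let ?L = "{\<omega>\<in>space M. \<forall>k\<in>{1..m0}. mean_square (\<lambda>j. V n j \<omega> + c j) k \<le> s}"
      let ?LN = "{\<omega>\<in>space N. \<forall>k\<in>{1..m0}. mean_square (\<lambda>j. Z j \<omega> + c j) k < b}"
      let ?E = "{\<omega>\<in>space M. \<exists>m\<in>{1..<n}. t \<le> mean_square (\<lambda>j. root_term n j \<omega>) m}"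
      have sub: "space M - ?L \<subseteq> ?E \<union> ?R"
      proof
        fix \<omega> assume "\<omega> \<in> space M - ?L"
        then obtain k where k: "\<omega> \<in> space M" "k \<in> {1..m0}" "s < mean_square (\<lambda>j. V n j \<omega> + c j) k" by auto
        have kn: "1 \<le> k" "k < n" using k(2) elim(4) by auto
        show "\<omega> \<in> ?E \<union> ?R"
        proof (cases "d\<^sup>2 \<le> total_res n \<omega>")
          case True
          then show ?thesis using k by simp
        next
          case False
          then have "mean_square (\<lambda>j. res n j \<omega>) k \<le> d\<^sup>2" using mean_square_res_le[OF kn, of \<omega>] by linarith
          then have r: "sqrt (mean_square (\<lambda>j. res n j \<omega>) k) \<le> d" using d by (intro real_le_lsqrt) (auto simp: mean_square_nonneg)
          have neg: "mean_square (\<lambda>j. - v j) k = mean_square v k" for v by (simp add: mean_square_def)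
          have "sqrt s \<le> sqrt (mean_square (\<lambda>j. V n j \<omega> + c j) k)" using k(3) by simp
          also have "\<dots> \<le> sqrt (mean_square (\<lambda>j. root_term n j \<omega> + - res n j \<omega>) k) + sqrt (mean_square (\<lambda>j. - (shift n j - c j)) k)"
            using sqrt_mean_square_triangle[of "\<lambda>j. root_term n j \<omega> + - res n j \<omega>" "\<lambda>j. - (shift n j - c j)" k]
            by (simp add: root_term_decomp)
          also have "sqrt (mean_square (\<lambda>j. root_term n j \<omega> + - res n j \<omega>) k) \<le> sqrt (mean_square (\<lambda>j. root_term n j \<omega>) k) + sqrt (mean_square (\<lambda>j. - res n j \<omega>) k)"
            by (rule sqrt_mean_square_triangle)
          finally have "sqrt s \<le> sqrt (mean_square (\<lambda>j. root_term n j \<omega>) k) + sqrt (mean_square (\<lambda>j. res n j \<omega>) k) + sqrt (mean_square (\<lambda>j. shift n j - c j) k)"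
            unfolding neg by simp
          moreover have "sqrt (mean_square (\<lambda>j. shift n j - c j) k) \<le> d" using elim(3) k(2) by auto
          ultimately have "sqrt t \<le> sqrt (mean_square (\<lambda>j. root_term n j \<omega>) k)" using r d by linarith
          then show ?thesis using k(1) kn by auto
        qed
      qed
      have "1 - prob ?L = prob (space M - ?L)" by (rule prob_compl[symmetric]) measurable
      also have "\<dots> \<le> prob (?E \<union> ?R)" by (rule finite_measure_mono[OF sub]) measurable
      also have "\<dots> \<le> prob ?E + prob ?R" by (rule measure_Un_le) measurable
      also have "prob ?E = P n" using elim(4) by (intro P_eq[symmetric]) simp
      finally have "1 - prob ?L \<le> P n + prob ?R" .
      moreover have "p - e \<le> 1 - measure N ?LN"
      proof -
        have "p - e \<le> measure N {\<omega>\<in>space N. \<exists>k\<in>{1..m0}. b \<le> mean_square (\<lambda>j. Z j \<omega> + c j) k}" by (rule b(2))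
        also have "\<dots> \<le> measure N (space N - ?LN)"
          by (rule N.finite_measure_mono) (auto simp: not_less)
        also have "\<dots> = 1 - measure N ?LN" by (rule N.prob_compl) measurable
        finally show ?thesis .
      qed
      ultimately show ?case using elim(1,2) by linarith
    qed
  qed
  have "P \<longlonglongrightarrow> p"
  proof (rule tendstoI)
    fix e :: real assume e: "e > 0"
    \<comment> \<open>Any divisor above 4 turns the two error bounds into strict
      inequalities.\<close>
    then have "e / 5 > 0" by simp
    from upper[OF this] lower[OF this] show "\<forall>\<^sub>F n in sequentially. dist (P n) p < e"
    proof eventually_elim
      case (elim n)
      have "P n - p < e" "p - P n < e" using elim e by simp_all
      then show ?case by (simp add: dist_real_def abs_less_iff)
    qed
  qed
  then show ?thesis unfolding P_def p_def N.prob_Sup_ge[OF c_sum t] .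
qed

end

theorem theorem2p2:
  fixes M :: "'a measure" and N :: "'b measure"
    and eps :: "nat \<Rightarrow> 'a \<Rightarrow> real" and Z :: "nat \<Rightarrow> 'b \<Rightarrow> real"
    and f h \<beta> :: "real \<Rightarrow> real" and \<alpha> :: real
  assumes M: "prob_space M"
    and eps_indep: "prob_space.indep_vars M (\<lambda>_. borel) eps UNIV"
    and f_nonneg: "\<And>x. f x \<ge> 0"
    and eps_dens: "\<And>i. distributed M lborel (eps i) (\<lambda>x. ennreal (f x))"
    and h_nonneg: "\<And>x. h x \<ge> 0"
    and h_dens: "distributed M lborel (\<lambda>\<omega>. eps 1 \<omega> - eps 2 \<omega>) (\<lambda>x. ennreal (h x))"
    and h_lip: "\<exists>\<delta>>0. \<exists>L. L-lipschitz_on {-\<delta>..\<delta>} h"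
    and beta_pos: "(LBINT x=0..1. (\<beta> x)\<^sup>2) > 0"
    and beta_pw_lip: "\<exists>S L. finite S \<and> S \<subseteq> {0..1} \<and>
           (\<forall>a b. {a..b} \<subseteq> {0..1} - S \<longrightarrow> L-lipschitz_on {a..b} \<beta>)"
    and alpha: "0 < \<alpha>" "\<alpha> < 1"
    and N: "prob_space N"
    and Z_indep: "prob_space.indep_vars N (\<lambda>_. borel) Z UNIV"
    and Z_normal: "\<And>j. distributed N lborel (Z j) (\<lambda>x. ennreal (std_normal_density x))"
  shows "(\<lambda>n. measure M {\<omega> \<in> space M. Rn n (Yobs \<beta> eps n \<omega>) \<ge> t_alpha \<alpha>})
           \<longlonglongrightarrow> measure N {\<omega> \<in> space N. T_lim (\<lambda>j. Z j \<omega>) (h 0) \<beta> \<ge> t_alpha \<alpha>}"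
proof -
  obtain \<delta> L where \<delta>: "\<delta> > 0" and L: "L-lipschitz_on {-\<delta>..\<delta>} h" using h_lip by blast
  obtain S L' where S: "finite S" and L': "\<And>a b. {a..b} \<subseteq> {0..1} - S \<Longrightarrow> L'-lipschitz_on {a..b} \<beta>"
    using beta_pw_lip by blast
  obtain B where B: "B > 0" "\<And>x. x \<in> {0..1} \<Longrightarrow> \<bar>\<beta> x\<bar> \<le> B"
    using piecewise_lipschitz_bounded[OF S L'] by blast
  interpret rank_alternative M eps f h \<delta> L \<beta> B
  proof (intro rank_alternative.intro rank_sample_diff.intro rank_sample.intro M)
    show "rank_sample_axioms M eps f" using eps_indep eps_dens by (rule rank_sample_axioms.intro)
    show "rank_sample_diff_axioms M eps h \<delta> L" using h_nonneg h_dens \<delta> L by (rule rank_sample_diff_axioms.intro)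
    show "rank_alternative_axioms \<beta> B" using B by (rule rank_alternative_axioms.intro)
  qed
  have NZ: "normal_sequence N Z"
    by (intro normal_sequence.intro N normal_sequence_axioms.intro Z_indep Z_normal)
  define c where "c j = sqrt 24 * h 0 * beta_coef \<beta> j" for j
  have "(\<lambda>n. shift n j) \<longlonglongrightarrow> c j" for j
    unfolding shift_def c_def beta_coef_def
  proof (intro tendsto_mult tendsto_const)
    show "(\<lambda>n. 1 / real n * (\<Sum>i=1..n. \<beta> (xpt n i) * cos (pi * real j * xpt n i))) \<longlonglongrightarrow> (LBINT x=0..1. \<beta> x * cos (pi * real j * x))"
    proof (rule midpoint_sum_tendsto_integral[OF S])
      show "isCont (\<lambda>x. \<beta> x * cos (pi * real j * x)) x" if "x \<in> {0<..<1} - S" for x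
        using piecewise_lipschitz_isCont[OF S L' that] by (intro continuous_intros)
      show "\<bar>\<beta> x * cos (pi * real j * x)\<bar> \<le> B" if "x \<in> {0..1}" for x
      proof -
        have "\<bar>\<beta> x\<bar> * \<bar>cos (pi * real j * x)\<bar> \<le> B * 1" using B that by (intro mult_mono abs_cos_le_one) auto
        then show ?thesis by (simp add: abs_mult)
      qed
    qed
  qed
  from power_tendsto[OF NZ this t_alpha_gt_1[OF alpha]] show ?thesis
    by (simp add: T_lim_def mean_square_def c_def)
qed

end
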